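(* Let $\mathcal S$ be an SGR with integral enveloping algebra $\mathcal U=\mathcal U_{\mathcal S}$. For each $\alpha\in\Delta\cup\{0\}$ let $\mathcal B_\alpha$ be a $\mathbb Z$-basis of $\mathfrak g_{\alpha\mathbb Z}$ (with $\mathcal B_{\alpha_i}=\{e_i\}$, $\mathcal B_{-\alpha_i}=\{f_i\}$, and, for $\alpha\in\Phi$, $\mathcal B_\alpha=\{e_\alpha\}$, $\mathcal B_{-\alpha}=\{f_\alpha\}$ with $[e_\alpha,f_\alpha]=-\alpha^\vee$), and give $\mathcal B=\bigcup_\alpha\mathcal B_\alpha$ an arbitrary total order. For each $x\in\mathcal B$, say $x\in\mathcal B_\alpha$, choose elements $x^{[n]}\in\mathcal U_{n\alpha}$ ($n\in\mathbb N$) with $x^{[0]}=1$, $x^{[1]}=x$ and $x^{[n]}-x^n/n!$ of filtration $<n$ in $\mathcal U_{\mathbb C}(\mathfrak g_{\mathcal S})$. For $N=(N_x)_{x\in\mathcal B}\in\mathbb N^{(\mathcal B)}$ (finitely supported) let $[N]=\prod_{x\in\mathcal B}x^{[N_x]}$, the product being taken in the chosen order. Then the elements $[N]$, $N\in\mathbb N^{(\mathcal B)}$, form a basis of $\mathcal U$ over $\mathbb Z$.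
   Context: A Kac–Moody matrix is an integer matrix $A=(a_{ij})_{i,j\in I}$, $I$ finite, with $a_{ii}=2$, $a_{ij}\le0$ for $i\ne j$, $a_{ij}=0\iff a_{ji}=0$. An SGR is $\mathcal S=(A,Y,(\overline\alpha_i),(\alpha_i^\vee))$ with $Y$ a free $\mathbb Z$-module of finite rank, $\overline\alpha_i\in X=Y^*$, $\alpha_i^\vee\in Y$, $\overline\alpha_j(\alpha_i^\vee)=a_{ij}$. $Q=\bigoplus\mathbb Z\alpha_i$, $Q^+=\bigoplus\mathbb N\alpha_i$; $\alpha\mapsto\overline\alpha$ is the linear map $Q\to X$, and $\alpha(h)$ means $\overline\alpha(h)$. $\mathfrak g=\mathfrak g_{\mathcal S}$ is the complex Lie algebra generated by $\mathfrak h=Y\otimes\mathbb C$, $e_i,f_i$ with $[h,h']=0$, $[h,e_i]=\alpha_i(h)e_i$, $[h,f_i]=-\alpha_i(h)f_i$, $[e_i,f_i]=-\alpha_i^\vee$, and for $i\neq j$: $[e_i,f_j]=0$, $(\mathrm{ad}\,e_i)^{1-a_{ij}}e_j=(\mathrm{ad}\,f_i)^{1-a_{ij}}f_j=0$. It is $Q$-graded: $\mathfrak g=\mathfrak h\oplus\bigoplus_{\alpha\in\Delta}\mathfrak g_\alpha$ ($\mathfrak g_0=\mathfrak h$). $W^v$ is the group generated by $s_i(\alpha)=\alpha-\alpha(\alpha_i^\vee)\alpha_i$ on $Q$ (acting similarly on $Y$); $\Phi=W^v\{\alpha_i\}\subset\Delta$, and for $\alpha=w\alpha_i\in\Phi$,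 $\alpha^\vee=w\alpha_i^\vee$. $\mathcal U_{\mathcal S}\subset\mathcal U_{\mathbb C}(\mathfrak g)$ is the $\mathbb Z$-subalgebra generated by $e_i^n/n!$, $f_i^n/n!$ and $\binom hn$ for $i\in I$, $h\in Y$, $n\in\mathbb N$; it is a $\mathbb Z$-form, graded by $Q$: $\mathcal U=\bigoplus_{\alpha\in Q}\mathcal U_\alpha$. $\mathfrak g_{\mathbb Z}=\mathfrak g\cap\mathcal U$, $\mathfrak g_{\alpha\mathbb Z}=\mathfrak g_\alpha\cap\mathcal U$ ($\mathfrak g_{0\mathbb Z}=Y$); for $\alpha\in\Phi$, $\mathfrak g_{\alpha\mathbb Z}\cong\mathbb Z$. "Filtration" is the standard filtration of the enveloping algebra. *)

theory Defs
  imports Complex_Main "HOL-Library.Poly_Mapping"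
begin

section \<open>Abelian groups as modules over the integers\<close>

definition zscale :: "int \<Rightarrow> 'a::ab_group_add \<Rightarrow> 'a" where
  "zscale k x = (\<Sum>_<nat k. x) - (\<Sum>_<nat (- k). x)"

lemma zscale_0 [simp]: "zscale 0 x = 0"
  by (simp add: zscale_def)

lemma zscale_1 [simp]: "zscale 1 x = x"
  by (simp add: zscale_def)

lemma zscale_plus_1: "zscale (k + 1) x = zscale k x + x"
proof (cases "k \<ge> 0")
  case True
  then show ?thesis by (simp add: zscale_def nat_add_distrib)
next
  case False
  then have "nat (- k) = Suc (nat (- (k + 1)))" by simp
  then show ?thesis using False by (simp add: zscale_def)
qed

lemma zscale_minus_1: "zscale (k - 1) x = zscale k x - x"
  using zscale_plus_1 [of "k - 1" x] by simp

lemma zscale_add_left: "zscale (k + l) x = zscale k x + zscale l x"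
proof (induction l rule: int_induct [where k = 0])
  case (step1 i)
  then show ?case
    by (simp only: add.assoc [symmetric] zscale_plus_1)
next
  case (step2 i)
  then show ?case
    by (simp only: add_diff_eq zscale_minus_1)
qed simp

lemma zscale_add_right: "zscale k (x + y) = zscale k x + zscale k y"
  by (simp add: zscale_def sum.distrib)

lemma zscale_zscale: "zscale k (zscale l x) = zscale (k * l) x"
proof (induction k rule: int_induct [where k = 0])
  case (step1 i)
  then show ?case by (simp add: zscale_plus_1 zscale_add_left distrib_right)
next
  case (step2 i)
  then show ?case using zscale_add_left [of "i * l - l" l x]
    by (simp add: zscale_minus_1 left_diff_distrib)
qed simp

global_interpretation zmod: module "zscale :: int \<Rightarrow> 'a \<Rightarrow> 'a::ab_group_add"
  by unfold_locales (simp_all add: zscale_add_left zscale_add_right zscale_zscale)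

definition is_Z_basis :: "'a::ab_group_add set \<Rightarrow> 'a set \<Rightarrow> bool" where
  "is_Z_basis B M \<longleftrightarrow> zmod.independent B \<and> zmod.span B = M"


section \<open>Complex Lie algebras and algebras\<close>

class complex_vector = ab_group_add +
  fixes scaleC :: "complex \<Rightarrow> 'a \<Rightarrow> 'a"  (infixr \<open>*\<^sub>C\<close> 75)
  assumes scaleC_add_right: "c *\<^sub>C (x + y) = c *\<^sub>C x + c *\<^sub>C y"
    and scaleC_add_left: "(c + d) *\<^sub>C x = c *\<^sub>C x + d *\<^sub>C x"
    and scaleC_scaleC: "c *\<^sub>C d *\<^sub>C x = (c * d) *\<^sub>C x"
    and scaleC_one: "1 *\<^sub>C x = x"

global_interpretation cvec: vector_space "scaleC :: complex \<Rightarrow> 'a \<Rightarrow> 'a::complex_vector"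
  by unfold_locales (simp_all add: scaleC_add_right scaleC_add_left scaleC_scaleC scaleC_one)

class complex_algebra = complex_vector + ring_1 +
  assumes scaleC_mult_left: "(c *\<^sub>C x) * y = c *\<^sub>C (x * y)"
    and scaleC_mult_right: "x * (c *\<^sub>C y) = c *\<^sub>C (x * y)"

class complex_lie_algebra = complex_vector +
  fixes lie_br :: "'a \<Rightarrow> 'a \<Rightarrow> 'a"
  assumes lie_br_add_left: "lie_br (x + y) z = lie_br x z + lie_br y z"
    and lie_br_add_right: "lie_br x (y + z) = lie_br x y + lie_br x z"
    and lie_br_scale_left: "lie_br (c *\<^sub>C x) y = c *\<^sub>C lie_br x y"
    and lie_br_scale_right: "lie_br x (c *\<^sub>C y) = c *\<^sub>C lie_br x y"
    and lie_br_self: "lie_br x x = 0"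
    and lie_jacobi: "lie_br x (lie_br y z) + lie_br y (lie_br z x) + lie_br z (lie_br x y) = 0"


section \<open>Lie algebras given by generators and relations\<close>

datatype (lgens: 'x) lterm =
    LGen 'x
  | LZero
  | LAdd "'x lterm" "'x lterm"
  | LScale complex "'x lterm"
  | LBr "'x lterm" "'x lterm"

primrec leval :: "('x \<Rightarrow> 'g::complex_lie_algebra) \<Rightarrow> 'x lterm \<Rightarrow> 'g" where
  "leval \<phi> (LGen x) = \<phi> x"
| "leval \<phi> LZero = 0"
| "leval \<phi> (LAdd s t) = leval \<phi> s + leval \<phi> t"
| "leval \<phi> (LScale c t) = c *\<^sub>C leval \<phi> t"
| "leval \<phi> (LBr s t) = lie_br (leval \<phi> s) (leval \<phi> t)"

text \<open>The congruence on terms generated by the axioms of complex Lie algebras and the relations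
  \<^term>\<open>R\<close>; the quotient by it is the Lie algebra presented by \<^term>\<open>R\<close>.\<close>

inductive lie_cong :: "('x lterm \<Rightarrow> 'x lterm \<Rightarrow> bool) \<Rightarrow> 'x lterm \<Rightarrow> 'x lterm \<Rightarrow> bool"
  for R :: "'x lterm \<Rightarrow> 'x lterm \<Rightarrow> bool"
where
  rel: "R s t \<Longrightarrow> lie_cong R s t"
| refl: "lie_cong R t t"
| sym: "lie_cong R s t \<Longrightarrow> lie_cong R t s"
| trans: "lie_cong R s t \<Longrightarrow> lie_cong R t u \<Longrightarrow> lie_cong R s u"
| add_cong: "lie_cong R s s' \<Longrightarrow> lie_cong R t t' \<Longrightarrow> lie_cong R (LAdd s t) (LAdd s' t')"
| scale_cong: "lie_cong R t t' \<Longrightarrow> lie_cong R (LScale c t) (LScale c t')"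
| br_cong: "lie_cong R s s' \<Longrightarrow> lie_cong R t t' \<Longrightarrow> lie_cong R (LBr s t) (LBr s' t')"
| add_assoc: "lie_cong R (LAdd (LAdd s t) u) (LAdd s (LAdd t u))"
| add_commute: "lie_cong R (LAdd s t) (LAdd t s)"
| add_zero: "lie_cong R (LAdd LZero t) t"
| add_inverse: "lie_cong R (LAdd (LScale (-1) t) t) LZero"
| scale_add_right: "lie_cong R (LScale c (LAdd s t)) (LAdd (LScale c s) (LScale c t))"
| scale_add_left: "lie_cong R (LScale (c + d) t) (LAdd (LScale c t) (LScale d t))"
| scale_scale: "lie_cong R (LScale c (LScale d t)) (LScale (c * d) t)"
| scale_one: "lie_cong R (LScale 1 t) t"
| br_add_left: "lie_cong R (LBr (LAdd s t) u) (LAdd (LBr s u) (LBr t u))"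
| br_add_right: "lie_cong R (LBr s (LAdd t u)) (LAdd (LBr s t) (LBr s u))"
| br_scale_left: "lie_cong R (LBr (LScale c s) t) (LScale c (LBr s t))"
| br_scale_right: "lie_cong R (LBr s (LScale c t)) (LScale c (LBr s t))"
| br_self: "lie_cong R (LBr t t) LZero"
| jacobi: "lie_cong R (LAdd (LAdd (LBr s (LBr t u)) (LBr t (LBr u s))) (LBr u (LBr s t))) LZero"

text \<open>The Lie algebra \<^typ>\<open>'g\<close>, with the generators \<^term>\<open>\<phi> x\<close> (\<^term>\<open>x \<in> G\<close>), is the one presented
  by \<^term>\<open>R\<close>: every element is a Lie polynomial in the generators, and two such polynomials
  agree exactly if the relations and the Lie algebra axioms force them to. The relations are
  meant to involve only the generators in \<^term>\<open>G\<close>. The universal property is proved below.\<close>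

definition lie_presented ::
  "'x set \<Rightarrow> ('x lterm \<Rightarrow> 'x lterm \<Rightarrow> bool) \<Rightarrow> ('x \<Rightarrow> 'g::complex_lie_algebra) \<Rightarrow> bool" where
  "lie_presented G R \<phi> \<longleftrightarrow>
     (\<forall>z. \<exists>t. lgens t \<subseteq> G \<and> leval \<phi> t = z) \<and>
     (\<forall>s t. lgens s \<subseteq> G \<longrightarrow> lgens t \<subseteq> G \<longrightarrow> (leval \<phi> s = leval \<phi> t \<longleftrightarrow> lie_cong R s t))"

definition lie_hom :: "('g::complex_lie_algebra \<Rightarrow> 'k::complex_lie_algebra) \<Rightarrow> bool" where
  "lie_hom F \<longleftrightarrow> (\<forall>x y. F (x + y) = F x + F y) \<and> (\<forall>c x. F (c *\<^sub>C x) = c *\<^sub>C F x) \<and>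
     (\<forall>x y. F (lie_br x y) = lie_br (F x) (F y))"

lemma lie_cong_sound:
  assumes "lie_cong R s t" and "\<And>s t. R s t \<Longrightarrow> leval \<psi> s = leval \<psi> t"
  shows "leval \<psi> s = leval \<psi> t"
  using assms(1)
proof (induction rule: lie_cong.induct)
  case (add_inverse t)
  have "(-1) *\<^sub>C leval \<psi> t + leval \<psi> t = (-1 + 1) *\<^sub>C leval \<psi> t"
    by (simp only: scaleC_add_left scaleC_one)
  then show ?case by simp
qed (simp_all add: assms(2) scaleC_add_right scaleC_add_left scaleC_scaleC scaleC_one add_ac
      lie_br_add_left lie_br_add_right lie_br_scale_left lie_br_scale_right lie_br_self,
     use lie_jacobi in \<open>simp add: add_ac\<close>)

lemma lie_hom_leval:
  assumes "lie_hom F" and "lgens t \<subseteq> G" and "\<And>x. x \<in> G \<Longrightarrow> F (\<phi> x) = \<psi> x"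
  shows "F (leval \<phi> t) = leval \<psi> t"
proof -
  have "F 0 = 0" using assms(1) unfolding lie_hom_def by (metis cvec.scale_zero_left)
  then show ?thesis using assms by (induction t) (auto simp: lie_hom_def)
qed

lemma lie_presented_universal:
  fixes \<phi> :: "'x \<Rightarrow> 'g::complex_lie_algebra" and \<psi> :: "'x \<Rightarrow> 'k::complex_lie_algebra"
  assumes P: "lie_presented G R \<phi>" and R: "\<And>s t. R s t \<Longrightarrow> leval \<psi> s = leval \<psi> t"
  shows "\<exists>!F. lie_hom F \<and> (\<forall>x\<in>G. F (\<phi> x) = \<psi> x)"
proof (rule ex_ex1I)
  define T where "T z = (SOME t. lgens t \<subseteq> G \<and> leval \<phi> t = z)" for z
  have T: "lgens (T z) \<subseteq> G" "leval \<phi> (T z) = z" for z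
    using P someI_ex [of "\<lambda>t. lgens t \<subseteq> G \<and> leval \<phi> t = z"]
    unfolding lie_presented_def T_def by blast+
  define F where "F z = leval \<psi> (T z)" for z
  have F: "F (leval \<phi> t) = leval \<psi> t" if "lgens t \<subseteq> G" for t
    using P T that lie_cong_sound [OF _ R] unfolding lie_presented_def F_def by metis
  have "F (x + y) = F x + F y" "F (c *\<^sub>C x) = c *\<^sub>C F x" "F (lie_br x y) = lie_br (F x) (F y)"
    for x y c
    using F [of "LAdd (T x) (T y)"] F [of "LScale c (T x)"] F [of "LBr (T x) (T y)"]
    by (simp_all add: T F_def)
  moreover have "F (\<phi> x) = \<psi> x" if "x \<in> G" for x
    using F [of "LGen x"] that by simp
  ultimately show "\<exists>F. lie_hom F \<and> (\<forall>x\<in>G. F (\<phi> x) = \<psi> x)"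
    unfolding lie_hom_def by blast
next
  fix F F' assume "lie_hom F \<and> (\<forall>x\<in>G. F (\<phi> x) = \<psi> x)" "lie_hom F' \<and> (\<forall>x\<in>G. F' (\<phi> x) = \<psi> x)"
  then have "F (leval \<phi> t) = F' (leval \<phi> t)" if "lgens t \<subseteq> G" for t
    using lie_hom_leval that by metis
  then show "F = F'" using P unfolding lie_presented_def by (metis ext)
qed


section \<open>The universal enveloping algebra\<close>

datatype 'g uterm =
    UGen 'g
  | UZero
  | UOne
  | UAdd "'g uterm" "'g uterm"
  | UScale complex "'g uterm"
  | UMul "'g uterm" "'g uterm"

primrec ueval :: "('g \<Rightarrow> 'u::complex_algebra) \<Rightarrow> 'g uterm \<Rightarrow> 'u" where
  "ueval \<phi> (UGen x) = \<phi> x"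
| "ueval \<phi> UZero = 0"
| "ueval \<phi> UOne = 1"
| "ueval \<phi> (UAdd s t) = ueval \<phi> s + ueval \<phi> t"
| "ueval \<phi> (UScale c t) = c *\<^sub>C ueval \<phi> t"
| "ueval \<phi> (UMul s t) = ueval \<phi> s * ueval \<phi> t"

inductive uea_cong :: "'g::complex_lie_algebra uterm \<Rightarrow> 'g uterm \<Rightarrow> bool" where
  refl: "uea_cong t t"
| sym: "uea_cong s t \<Longrightarrow> uea_cong t s"
| trans: "uea_cong s t \<Longrightarrow> uea_cong t u \<Longrightarrow> uea_cong s u"
| add_cong: "uea_cong s s' \<Longrightarrow> uea_cong t t' \<Longrightarrow> uea_cong (UAdd s t) (UAdd s' t')"
| scale_cong: "uea_cong t t' \<Longrightarrow> uea_cong (UScale c t) (UScale c t')"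
| mul_cong: "uea_cong s s' \<Longrightarrow> uea_cong t t' \<Longrightarrow> uea_cong (UMul s t) (UMul s' t')"
| add_assoc: "uea_cong (UAdd (UAdd s t) u) (UAdd s (UAdd t u))"
| add_commute: "uea_cong (UAdd s t) (UAdd t s)"
| add_zero: "uea_cong (UAdd UZero t) t"
| add_inverse: "uea_cong (UAdd (UScale (-1) t) t) UZero"
| scale_add_right: "uea_cong (UScale c (UAdd s t)) (UAdd (UScale c s) (UScale c t))"
| scale_add_left: "uea_cong (UScale (c + d) t) (UAdd (UScale c t) (UScale d t))"
| scale_scale: "uea_cong (UScale c (UScale d t)) (UScale (c * d) t)"
| scale_one: "uea_cong (UScale 1 t) t"
| mul_assoc: "uea_cong (UMul (UMul s t) u) (UMul s (UMul t u))"
| mul_one_left: "uea_cong (UMul UOne t) t"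
| mul_one_right: "uea_cong (UMul t UOne) t"
| mul_add_left: "uea_cong (UMul (UAdd s t) u) (UAdd (UMul s u) (UMul t u))"
| mul_add_right: "uea_cong (UMul s (UAdd t u)) (UAdd (UMul s t) (UMul s u))"
| mul_scale_left: "uea_cong (UMul (UScale c s) t) (UScale c (UMul s t))"
| mul_scale_right: "uea_cong (UMul s (UScale c t)) (UScale c (UMul s t))"
| gen_add: "uea_cong (UGen (x + y)) (UAdd (UGen x) (UGen y))"
| gen_scale: "uea_cong (UGen (c *\<^sub>C x)) (UScale c (UGen x))"
| gen_br: "uea_cong (UGen (lie_br x y))
     (UAdd (UMul (UGen x) (UGen y)) (UScale (-1) (UMul (UGen y) (UGen x))))"

quotient_type (overloaded) 'g uea = "'g::complex_lie_algebra uterm" / uea_cong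
proof (rule equivpI)
  show "reflp (uea_cong :: 'g uterm \<Rightarrow> _)" by (simp add: reflp_def uea_cong.refl)
  show "symp (uea_cong :: 'g uterm \<Rightarrow> _)" by (simp add: symp_def uea_cong.sym)
  show "transp (uea_cong :: 'g uterm \<Rightarrow> _)" by (auto simp: transp_def intro: uea_cong.trans)
qed

lemma uea_cong_sound:
  fixes \<psi> :: "'g::complex_lie_algebra \<Rightarrow> 'u::complex_algebra"
  assumes "uea_cong s t"
    and "\<And>x y. \<psi> (x + y) = \<psi> x + \<psi> y" "\<And>c x. \<psi> (c *\<^sub>C x) = c *\<^sub>C \<psi> x"
    and "\<And>x y. \<psi> (lie_br x y) = \<psi> x * \<psi> y - \<psi> y * \<psi> x"
  shows "ueval \<psi> s = ueval \<psi> t"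
  using assms(1)
proof (induction rule: uea_cong.induct)
  case (add_inverse t)
  have "(-1) *\<^sub>C ueval \<psi> t + ueval \<psi> t = (-1 + 1) *\<^sub>C ueval \<psi> t"
    by (simp only: scaleC_add_left scaleC_one)
  then show ?case by simp
next
  case (gen_br x y)
  then show ?case by (simp add: assms(4) scaleC_one)
qed (simp_all add: assms(2,3) scaleC_add_right scaleC_add_left scaleC_scaleC scaleC_one
      scaleC_mult_left scaleC_mult_right algebra_simps)

instantiation complex :: complex_algebra
begin
definition scaleC_complex :: "complex \<Rightarrow> complex \<Rightarrow> complex" where
  "scaleC_complex = (*)"
instance by standard (simp_all add: scaleC_complex_def algebra_simps)
end

lemma uea_zero_neq_one: "\<not> uea_cong UZero (UOne :: 'g::complex_lie_algebra uterm)"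
  using uea_cong_sound [of UZero "UOne :: 'g uterm" "\<lambda>_. 0 :: complex"]
  by (auto simp: scaleC_complex_def)

instantiation uea :: (complex_lie_algebra) complex_algebra
begin

lift_definition zero_uea :: "'a uea" is UZero .
lift_definition one_uea :: "'a uea" is UOne .
lift_definition plus_uea :: "'a uea \<Rightarrow> 'a uea \<Rightarrow> 'a uea" is UAdd by (rule uea_cong.add_cong)
lift_definition scaleC_uea :: "complex \<Rightarrow> 'a uea \<Rightarrow> 'a uea" is UScale by (rule uea_cong.scale_cong)
lift_definition times_uea :: "'a uea \<Rightarrow> 'a uea \<Rightarrow> 'a uea" is UMul by (rule uea_cong.mul_cong)
definition uminus_uea :: "'a uea \<Rightarrow> 'a uea" where "uminus_uea u = (-1) *\<^sub>C u"
definition minus_uea :: "'a uea \<Rightarrow> 'a uea \<Rightarrow> 'a uea" where "minus_uea u v = u + - v"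

instance
proof
  fix a b c :: "'a uea" and k l :: complex
  show "a + b + c = a + (b + c)" by transfer (rule uea_cong.add_assoc)
  show "a + b = b + a" by transfer (rule uea_cong.add_commute)
  show "0 + a = a" by transfer (rule uea_cong.add_zero)
  show "- a + a = 0" unfolding uminus_uea_def by transfer (rule uea_cong.add_inverse)
  show "a - b = a + - b" by (rule minus_uea_def)
  show "k *\<^sub>C (a + b) = k *\<^sub>C a + k *\<^sub>C b" by transfer (rule uea_cong.scale_add_right)
  show "(k + l) *\<^sub>C a = k *\<^sub>C a + l *\<^sub>C a" by transfer (rule uea_cong.scale_add_left)
  show "k *\<^sub>C l *\<^sub>C a = (k * l) *\<^sub>C a" by transfer (rule uea_cong.scale_scale)
  show "1 *\<^sub>C a = a" by transfer (rule uea_cong.scale_one)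
  show "a * b * c = a * (b * c)" by transfer (rule uea_cong.mul_assoc)
  show "1 * a = a" by transfer (rule uea_cong.mul_one_left)
  show "a * 1 = a" by transfer (rule uea_cong.mul_one_right)
  show "(a + b) * c = a * c + b * c" by transfer (rule uea_cong.mul_add_left)
  show "a * (b + c) = a * b + a * c" by transfer (rule uea_cong.mul_add_right)
  show "(k *\<^sub>C a) * b = k *\<^sub>C (a * b)" by transfer (rule uea_cong.mul_scale_left)
  show "a * (k *\<^sub>C b) = k *\<^sub>C (a * b)" by transfer (rule uea_cong.mul_scale_right)
  show "(0 :: 'a uea) \<noteq> 1" by transfer (rule uea_zero_neq_one)
qed

end

text \<open>The canonical map of the Lie algebra into its enveloping algebra. It is injective by the
  Poincare-Birkhoff-Witt theorem; the identification of an element with its image is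
  written out as \<open>\<iota>\<close> throughout.\<close>

lift_definition \<iota> :: "'g::complex_lie_algebra \<Rightarrow> 'g uea" is UGen .

lemma \<iota>_add: "\<iota> (x + y) = \<iota> x + \<iota> y"
  by transfer (rule uea_cong.gen_add)

lemma \<iota>_scaleC: "\<iota> (c *\<^sub>C x) = c *\<^sub>C \<iota> x"
  by transfer (rule uea_cong.gen_scale)

lemma \<iota>_lie_br: "\<iota> (lie_br x y) = \<iota> x * \<iota> y - \<iota> y * \<iota> x"
  unfolding minus_uea_def uminus_uea_def by transfer (rule uea_cong.gen_br)

text \<open>\<open>u\<close> has filtration \<open>< n\<close>: it is a combination of products of fewer than \<open>n\<close> elements of the
  Lie algebra. For \<open>n = 0\<close> only \<open>0\<close> qualifies.\<close>

definition filtration_less :: "nat \<Rightarrow> 'g::complex_lie_algebra uea set" where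
  "filtration_less n = cvec.span {prod_list (map \<iota> xs) | xs. length xs < n}"

definition divided_power :: "'u::complex_algebra \<Rightarrow> nat \<Rightarrow> 'u" where
  "divided_power u n = (1 / fact n) *\<^sub>C u ^ n"

definition alg_binomial :: "'u::complex_algebra \<Rightarrow> nat \<Rightarrow> 'u" where
  "alg_binomial u n = (1 / fact n) *\<^sub>C prod_list (map (\<lambda>k. u - of_nat k) [0..<n])"

definition is_subring :: "'u::ring_1 set \<Rightarrow> bool" where
  "is_subring T \<longleftrightarrow> 1 \<in> T \<and> (\<forall>x\<in>T. \<forall>y\<in>T. x - y \<in> T \<and> x * y \<in> T)"


section \<open>SGRs and their Kac-Moody algebras\<close>

record ('i, 'y) SGR =
  idx :: "'i set"
  cartan :: "'i \<Rightarrow> 'i \<Rightarrow> int"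
  root_bar :: "'i \<Rightarrow> 'y \<Rightarrow> int"
  coroot :: "'i \<Rightarrow> 'y"

definition is_kac_moody_matrix :: "'i set \<Rightarrow> ('i \<Rightarrow> 'i \<Rightarrow> int) \<Rightarrow> bool" where
  "is_kac_moody_matrix I A \<longleftrightarrow> finite I \<and> (\<forall>i\<in>I. A i i = 2) \<and>
     (\<forall>i\<in>I. \<forall>j\<in>I. i \<noteq> j \<longrightarrow> A i j \<le> 0) \<and> (\<forall>i\<in>I. \<forall>j\<in>I. A i j = 0 \<longleftrightarrow> A j i = 0)"

definition is_SGR :: "('i, 'y::ab_group_add) SGR \<Rightarrow> bool" where
  "is_SGR S \<longleftrightarrow> is_kac_moody_matrix (idx S) (cartan S) \<and>
     (\<exists>b :: 'y set. finite b \<and> is_Z_basis b UNIV) \<and>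
     (\<forall>i\<in>idx S. additive (root_bar S i)) \<and>
     (\<forall>i\<in>idx S. \<forall>j\<in>idx S. root_bar S j (coroot S i) = cartan S i j)"

text \<open>Elements of the root lattice are finitely supported integer functions on \<^typ>\<open>'i\<close> (those
  with support in \<^term>\<open>idx S\<close>).\<close>

abbreviation simple_root :: "'i \<Rightarrow> ('i \<Rightarrow>\<^sub>0 int)" where
  "simple_root i \<equiv> Poly_Mapping.single i 1"

definition root_eval :: "('i, 'y) SGR \<Rightarrow> ('i \<Rightarrow>\<^sub>0 int) \<Rightarrow> 'y \<Rightarrow> int" where
  "root_eval S \<alpha> y = (\<Sum>i\<in>Poly_Mapping.keys \<alpha>. Poly_Mapping.lookup \<alpha> i * root_bar S i y)"

definition refl_Q :: "('i, 'y) SGR \<Rightarrow> 'i \<Rightarrow> ('i \<Rightarrow>\<^sub>0 int) \<Rightarrow> ('i \<Rightarrow>\<^sub>0 int)" where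
  "refl_Q S i \<alpha> = \<alpha> - zscale (root_eval S \<alpha> (coroot S i)) (simple_root i)"

definition refl_Y :: "('i, 'y::ab_group_add) SGR \<Rightarrow> 'i \<Rightarrow> 'y \<Rightarrow> 'y" where
  "refl_Y S i y = y - zscale (root_bar S i y) (coroot S i)"

text \<open>Elements of the Weyl group, as pairs of their actions on the root lattice and on \<open>Y\<close>. The
  reflections are involutions, so their products already form a group.\<close>

inductive weyl :: "('i, 'y::ab_group_add) SGR \<Rightarrow> (('i \<Rightarrow>\<^sub>0 int) \<Rightarrow> ('i \<Rightarrow>\<^sub>0 int)) \<Rightarrow> ('y \<Rightarrow> 'y) \<Rightarrow> bool"
  for S where
  id: "weyl S id id"
| refl: "weyl S w v \<Longrightarrow> i \<in> idx S \<Longrightarrow> weyl S (refl_Q S i \<circ> w) (refl_Y S i \<circ> v)"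

text \<open>\<^term>\<open>real_root S \<alpha> c\<close>: \<open>\<alpha>\<close> is a real root (an element of \<open>\<Phi>\<close>) and \<open>c\<close> is its coroot.\<close>

definition real_root :: "('i, 'y::ab_group_add) SGR \<Rightarrow> ('i \<Rightarrow>\<^sub>0 int) \<Rightarrow> 'y \<Rightarrow> bool" where
  "real_root S \<alpha> c \<longleftrightarrow>
     (\<exists>w v. \<exists>i\<in>idx S. weyl S w v \<and> \<alpha> = w (simple_root i) \<and> c = v (coroot S i))"

datatype ('i, 'y) km_gen = GenE 'i | GenF 'i | GenH 'y

definition km_gens :: "('i, 'y) SGR \<Rightarrow> ('i, 'y) km_gen set" where
  "km_gens S = GenE ` idx S \<union> GenF ` idx S \<union> range GenH"

text \<open>The generator \<^term>\<open>GenH y\<close> stands for \<open>y \<otimes> 1\<close> in \<open>Y \<otimes> \<complex>\<close>. The complex vector space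
  presented by these generators and the relations \<open>H_add\<close> is \<open>Y \<otimes> \<complex>\<close>; the relations
  involving \<open>h\<close> in \<open>Y \<otimes> \<complex>\<close> follow by linearity from those for \<open>h\<close> in \<open>Y\<close>.\<close>

inductive km_rel :: "('i, 'y::ab_group_add) SGR \<Rightarrow> ('i, 'y) km_gen lterm \<Rightarrow> ('i, 'y) km_gen lterm \<Rightarrow> bool"
  for S where
  H_add: "km_rel S (LGen (GenH (y + y'))) (LAdd (LGen (GenH y)) (LGen (GenH y')))"
| H_H: "km_rel S (LBr (LGen (GenH y)) (LGen (GenH y'))) LZero"
| H_E: "i \<in> idx S \<Longrightarrow> km_rel S (LBr (LGen (GenH y)) (LGen (GenE i)))
     (LScale (of_int (root_bar S i y)) (LGen (GenE i)))"
| H_F: "i \<in> idx S \<Longrightarrow> km_rel S (LBr (LGen (GenH y)) (LGen (GenF i)))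
     (LScale (- of_int (root_bar S i y)) (LGen (GenF i)))"
| E_F: "i \<in> idx S \<Longrightarrow> km_rel S (LBr (LGen (GenE i)) (LGen (GenF i)))
     (LScale (-1) (LGen (GenH (coroot S i))))"
| E_F_neq: "i \<in> idx S \<Longrightarrow> j \<in> idx S \<Longrightarrow> i \<noteq> j \<Longrightarrow>
     km_rel S (LBr (LGen (GenE i)) (LGen (GenF j))) LZero"
| serre_E: "i \<in> idx S \<Longrightarrow> j \<in> idx S \<Longrightarrow> i \<noteq> j \<Longrightarrow>
     km_rel S ((LBr (LGen (GenE i)) ^^ nat (1 - cartan S i j)) (LGen (GenE j))) LZero"
| serre_F: "i \<in> idx S \<Longrightarrow> j \<in> idx S \<Longrightarrow> i \<noteq> j \<Longrightarrow>
     km_rel S ((LBr (LGen (GenF i)) ^^ nat (1 - cartan S i j)) (LGen (GenF j))) LZero"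

definition is_kac_moody_algebra ::
  "('i, 'y::ab_group_add) SGR \<Rightarrow> (('i, 'y) km_gen \<Rightarrow> 'g::complex_lie_algebra) \<Rightarrow> bool" where
  "is_kac_moody_algebra S \<phi> \<longleftrightarrow> lie_presented (km_gens S) (km_rel S) \<phi>"


section \<open>Gradings, roots and integral forms\<close>

text \<open>In this section \<open>\<phi>\<close> gives the generators of the Kac-Moody algebra of \<open>S\<close>. The
  grading by the root lattice is the one in which \<open>e\<^sub>i\<close>, \<open>f\<^sub>i\<close> and \<open>h\<close> have
  degrees \<open>\<alpha>\<^sub>i\<close>, \<open>- \<alpha>\<^sub>i\<close> and \<open>0\<close>.\<close>

inductive g_homogeneous :: "('i, 'y) SGR \<Rightarrow> (('i, 'y) km_gen \<Rightarrow> 'g::complex_lie_algebra) \<Rightarrow>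
    ('i \<Rightarrow>\<^sub>0 int) \<Rightarrow> 'g \<Rightarrow> bool"
  for S \<phi> where
  E: "i \<in> idx S \<Longrightarrow> g_homogeneous S \<phi> (simple_root i) (\<phi> (GenE i))"
| F: "i \<in> idx S \<Longrightarrow> g_homogeneous S \<phi> (- simple_root i) (\<phi> (GenF i))"
| H: "g_homogeneous S \<phi> 0 (\<phi> (GenH y))"
| zero: "g_homogeneous S \<phi> \<alpha> 0"
| add: "g_homogeneous S \<phi> \<alpha> x \<Longrightarrow> g_homogeneous S \<phi> \<alpha> y \<Longrightarrow> g_homogeneous S \<phi> \<alpha> (x + y)"
| scale: "g_homogeneous S \<phi> \<alpha> x \<Longrightarrow> g_homogeneous S \<phi> \<alpha> (c *\<^sub>C x)"
| br: "g_homogeneous S \<phi> \<alpha> x \<Longrightarrow> g_homogeneous S \<phi> \<beta> y \<Longrightarrow> g_homogeneous S \<phi> (\<alpha> + \<beta>) (lie_br x y)"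

definition root_space :: "('i, 'y) SGR \<Rightarrow> (('i, 'y) km_gen \<Rightarrow> 'g::complex_lie_algebra) \<Rightarrow>
    ('i \<Rightarrow>\<^sub>0 int) \<Rightarrow> 'g set" where
  "root_space S \<phi> \<alpha> = {x. g_homogeneous S \<phi> \<alpha> x}"

definition roots :: "('i, 'y) SGR \<Rightarrow> (('i, 'y) km_gen \<Rightarrow> 'g::complex_lie_algebra) \<Rightarrow>
    ('i \<Rightarrow>\<^sub>0 int) set" where
  "roots S \<phi> = {\<alpha>. \<alpha> \<noteq> 0 \<and> root_space S \<phi> \<alpha> \<noteq> {0}}"

inductive U_homogeneous :: "('i, 'y) SGR \<Rightarrow> (('i, 'y) km_gen \<Rightarrow> 'g::complex_lie_algebra) \<Rightarrow>
    ('i \<Rightarrow>\<^sub>0 int) \<Rightarrow> 'g uea \<Rightarrow> bool"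
  for S \<phi> where
  gen: "x \<in> root_space S \<phi> \<alpha> \<Longrightarrow> U_homogeneous S \<phi> \<alpha> (\<iota> x)"
| one: "U_homogeneous S \<phi> 0 1"
| zero: "U_homogeneous S \<phi> \<alpha> 0"
| add: "U_homogeneous S \<phi> \<alpha> u \<Longrightarrow> U_homogeneous S \<phi> \<alpha> v \<Longrightarrow> U_homogeneous S \<phi> \<alpha> (u + v)"
| scale: "U_homogeneous S \<phi> \<alpha> u \<Longrightarrow> U_homogeneous S \<phi> \<alpha> (c *\<^sub>C u)"
| mult: "U_homogeneous S \<phi> \<alpha> u \<Longrightarrow> U_homogeneous S \<phi> \<beta> v \<Longrightarrow> U_homogeneous S \<phi> (\<alpha> + \<beta>) (u * v)"

definition U_int :: "('i, 'y) SGR \<Rightarrow> (('i, 'y) km_gen \<Rightarrow> 'g::complex_lie_algebra) \<Rightarrow> 'g uea set" where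
  "U_int S \<phi> = is_subring hull
     ({divided_power (\<iota> (\<phi> (GenE i))) n | i n. i \<in> idx S} \<union>
      {divided_power (\<iota> (\<phi> (GenF i))) n | i n. i \<in> idx S} \<union>
      {alg_binomial (\<iota> (\<phi> (GenH y))) n | y n. True})"

definition U_int_deg :: "('i, 'y) SGR \<Rightarrow> (('i, 'y) km_gen \<Rightarrow> 'g::complex_lie_algebra) \<Rightarrow>
    ('i \<Rightarrow>\<^sub>0 int) \<Rightarrow> 'g uea set" where
  "U_int_deg S \<phi> \<alpha> = {u \<in> U_int S \<phi>. U_homogeneous S \<phi> \<alpha> u}"

definition g_int :: "('i, 'y) SGR \<Rightarrow> (('i, 'y) km_gen \<Rightarrow> 'g::complex_lie_algebra) \<Rightarrow>
    ('i \<Rightarrow>\<^sub>0 int) \<Rightarrow> 'g set" where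
  "g_int S \<phi> \<alpha> = {x \<in> root_space S \<phi> \<alpha>. \<iota> x \<in> U_int S \<phi>}"

definition basis_union :: "('i, 'y) SGR \<Rightarrow> (('i, 'y) km_gen \<Rightarrow> 'g::complex_lie_algebra) \<Rightarrow>
    (('i \<Rightarrow>\<^sub>0 int) \<Rightarrow> 'g set) \<Rightarrow> 'g set" where
  "basis_union S \<phi> B = (\<Union>\<alpha>\<in>roots S \<phi> \<union> {0}. B \<alpha>)"


section \<open>Ordered monomials\<close>

definition ordered_list :: "'a rel \<Rightarrow> 'a set \<Rightarrow> 'a list" where
  "ordered_list r K = (THE xs. distinct xs \<and> set xs = K \<and> sorted_wrt (\<lambda>x y. (x, y) \<in> r) xs)"

definition monomial :: "'a rel \<Rightarrow> ('a \<Rightarrow> nat \<Rightarrow> 'u::monoid_mult) \<Rightarrow> ('a \<Rightarrow>\<^sub>0 nat) \<Rightarrow> 'u" where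
  "monomial r p N =
     prod_list (map (\<lambda>x. p x (Poly_Mapping.lookup N x)) (ordered_list r (Poly_Mapping.keys N)))"

end

theory Submission
  imports Defs "HOL-Library.Multiset"
begin

text \<open>The elements \<open>[N]\<close> have the leading terms \<open>\<Prod>x x\<^bsup>N x\<^esup> / N x!\<close>, so by the Poincare-Birkhoff-Witt
  theorem they form a complex basis that is compatible with the filtration, and only the
  integrality of the coefficients of an element \<open>u\<close> of \<open>\<U>\<close> is at stake. It is proved by
  induction on the filtration degree. Since \<open>\<U>\<close> is closed under the coproduct, contracting the
  coproduct of \<open>u\<close> with a linear functional that is integral on \<open>\<U>\<close>, vanishes at \<open>1\<close> and is
  dual to \<open>x\<close> on the given basis of the Lie algebra yields an element of \<open>\<U>\<close> of lower degree.
  Its coefficient at \<open>[N']\<close>, where \<open>N'\<close> is \<open>N\<close> with one \<open>x\<close> removed, is that of \<open>u\<close> at \<open>[N]\<close>.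
  Functionals with these properties on the finitely many elements that occur exist because
  \<open>1\<close> and the basis elements span a pure subgroup of \<open>\<U>\<close>, and because elements of \<open>\<U>\<close> that are
  independent over the integers are independent over the complex numbers, as the defining
  relations of the Kac-Moody algebra are rational.\<close>

section \<open>Linear maps\<close>

text \<open>Purity rests on two facts: the counit is integral, which splits off multiples of 1, and
  the homogeneous components of an integral Lie algebra element are integral. These components and
  the passage from integral to complex independence come from one homomorphism, into the tensor
  product over the integers of the enveloping algebra with the complex group ring of the root
  lattice. It sends a generator to itself in its degree and moves scalars to the left factor; it
  exists because the relations are homogeneous with integral coefficients, and an additive map from
  the complex to the rational numbers can then be applied on the left. This tensor product and that
  of the coproduct are treated as formal sums tested by a class of functionals, so that a
  homomorphism into them is checked axiom by axiom on terms.\<close>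

definition clinear :: "('a::complex_vector \<Rightarrow> 'b::complex_vector) \<Rightarrow> bool" where
  "clinear f \<longleftrightarrow> (\<forall>x y. f (x + y) = f x + f y) \<and> (\<forall>c x. f (c *\<^sub>C x) = c *\<^sub>C f x)"

lemma clinearI:
  assumes "\<And>x y. f (x + y) = f x + f y" "\<And>c x. f (c *\<^sub>C x) = c *\<^sub>C f x"
  shows "clinear f"
  using assms by (simp add: clinear_def)

lemma clinear_add: "clinear f \<Longrightarrow> f (x + y) = f x + f y"
  and clinear_scale: "clinear f \<Longrightarrow> f (c *\<^sub>C x) = c *\<^sub>C f x"
  by (simp_all add: clinear_def)

lemma clinear_0: "clinear f \<Longrightarrow> f 0 = 0"
  using clinear_scale [of f 0 0] by simp

lemma clinear_minus: "clinear f \<Longrightarrow> f (- x) = - f x"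
  using clinear_add [of f x "- x"] clinear_0 [of f] by (simp add: eq_neg_iff_add_eq_0 add.commute)

lemma clinear_diff: "clinear f \<Longrightarrow> f (x - y) = f x - f y"
  using clinear_add [of f x "- y"] by (simp add: clinear_minus)

lemma clinear_sum: "clinear f \<Longrightarrow> f (sum h A) = (\<Sum>a\<in>A. f (h a))"
  by (induction A rule: infinite_finite_induct) (simp_all add: clinear_0 clinear_add [of f])

lemma clinear_eq_on_span:
  assumes "clinear f" "clinear h" "\<And>x. x \<in> A \<Longrightarrow> f x = h x" "x \<in> cvec.span A"
  shows "f x = h x"
  using assms(4)
  by (induction rule: cvec.span_induct_alt)
    (simp_all add: assms(3) clinear_0 [OF assms(1)] clinear_0 [OF assms(2)]
      clinear_add [OF assms(1)] clinear_add [OF assms(2)]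
      clinear_scale [OF assms(1)] clinear_scale [OF assms(2)])

lemma clinear_span_image:
  assumes "clinear f" "\<And>x. x \<in> A \<Longrightarrow> f x \<in> cvec.span C" "x \<in> cvec.span A"
  shows "f x \<in> cvec.span C"
  using assms(3)
  by (induction rule: cvec.span_induct_alt)
    (simp_all add: assms(2) clinear_0 [OF assms(1)] clinear_add [OF assms(1)]
      clinear_scale [OF assms(1)] cvec.span_zero cvec.span_add cvec.span_scale)

global_interpretation cvec_pair: vector_space_pair
  "scaleC :: complex \<Rightarrow> 'a \<Rightarrow> 'a::complex_vector" "scaleC :: complex \<Rightarrow> 'b \<Rightarrow> 'b::complex_vector" ..

lemma clinear_construct:
  "cvec.independent B \<Longrightarrow> clinear (cvec_pair.construct B f)"
  using cvec_pair.linear_construct [of B f]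
  by (simp add: clinear_def Vector_Spaces.linear_iff)

lemma clinear_functional_exists:
  fixes P :: "'a::complex_vector set" and h :: "'a \<Rightarrow> 'b::complex_vector"
  assumes "cvec.independent P"
  obtains \<psi> where "clinear \<psi>" "\<And>x. x \<in> P \<Longrightarrow> \<psi> x = h x"
  using clinear_construct [OF assms] cvec_pair.construct_basis [OF assms] by blast

section \<open>Free vector spaces on a set\<close>

instantiation poly_mapping :: (type, complex_vector) complex_vector
begin

lift_definition scaleC_poly_mapping :: "complex \<Rightarrow> ('a \<Rightarrow>\<^sub>0 'b) \<Rightarrow> 'a \<Rightarrow>\<^sub>0 'b"
  is "\<lambda>c f k. c *\<^sub>C f k"
  by (rule rev_finite_subset) auto

instance
  by standard (transfer, simp add: fun_eq_iff scaleC_add_right scaleC_add_left scaleC_scaleC scaleC_one)+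

end

lemma lookup_scaleC: "Poly_Mapping.lookup (c *\<^sub>C s) k = c *\<^sub>C Poly_Mapping.lookup s k"
  by transfer simp

definition free_ext :: "('k \<Rightarrow> 'v::complex_vector) \<Rightarrow> ('k \<Rightarrow>\<^sub>0 complex) \<Rightarrow> 'v" where
  "free_ext f s = (\<Sum>k\<in>Poly_Mapping.keys s. Poly_Mapping.lookup s k *\<^sub>C f k)"

lemma free_ext_superset:
  assumes "finite K" "Poly_Mapping.keys s \<subseteq> K"
  shows "free_ext f s = (\<Sum>k\<in>K. Poly_Mapping.lookup s k *\<^sub>C f k)"
  unfolding free_ext_def
  by (rule sum.mono_neutral_left) (use assms in \<open>auto simp: in_keys_iff\<close>)

lemma clinear_free_ext: "clinear (free_ext f)"
proof (rule clinearI)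
  fix s t :: "'a \<Rightarrow>\<^sub>0 complex" and c :: complex
  let ?K = "Poly_Mapping.keys s \<union> Poly_Mapping.keys t"
  have "Poly_Mapping.keys (c *\<^sub>C s) \<subseteq> Poly_Mapping.keys s"
    by (auto simp: in_keys_iff lookup_scaleC)
  then have "free_ext f (c *\<^sub>C s) =
      (\<Sum>k\<in>Poly_Mapping.keys s. Poly_Mapping.lookup (c *\<^sub>C s) k *\<^sub>C f k)"
    by (intro free_ext_superset) simp_all
  then show "free_ext f (c *\<^sub>C s) = c *\<^sub>C free_ext f s"
    by (simp add: free_ext_def lookup_scaleC scaleC_complex_def cvec.scale_sum_right)
  have "free_ext f (s + t) = (\<Sum>k\<in>?K. Poly_Mapping.lookup (s + t) k *\<^sub>C f k)"
    by (rule free_ext_superset) (simp_all add: Poly_Mapping.keys_add)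
  also have "\<dots> = (\<Sum>k\<in>?K. Poly_Mapping.lookup s k *\<^sub>C f k) + (\<Sum>k\<in>?K. Poly_Mapping.lookup t k *\<^sub>C f k)"
    by (simp add: lookup_add scaleC_add_left sum.distrib)
  also have "\<dots> = free_ext f s + free_ext f t"
    by (simp add: free_ext_superset [of ?K])
  finally show "free_ext f (s + t) = free_ext f s + free_ext f t" .
qed

lemma free_ext_single: "free_ext f (Poly_Mapping.single k 1) = f k"
  by (simp add: free_ext_def scaleC_one)

lemma clinear_lookup: "clinear (\<lambda>s. Poly_Mapping.lookup s k)"
  by (rule clinearI) (simp_all add: lookup_add lookup_scaleC)

lemma lie_br_antisym: "lie_br y x = - lie_br x (y::'g::complex_lie_algebra)"
proof -
  have "lie_br (x + y) (x + y) = (lie_br x x + lie_br x y) + (lie_br y x + lie_br y y)"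
    by (simp only: lie_br_add_left lie_br_add_right add_ac)
  then have "lie_br y x + lie_br x y = 0" by (simp add: lie_br_self add.commute)
  then show ?thesis by (simp add: eq_neg_iff_add_eq_0)
qed

lemma abs_rep_uea: "abs_uea (rep_uea u) = u"
  by (rule Quotient3_abs_rep [OF Quotient3_uea])

lemma uea_cong_iff: "uea_cong s t \<longleftrightarrow> abs_uea s = abs_uea t"
  using Quotient3_rel [OF Quotient3_uea, of s t] uea_cong.refl by blast

section \<open>The action of a Lie algebra on ordered words\<close>

text \<open>The ordered word \<open>ins r b U\<close> is the leading term of b times the ordered
  word U, both in the model built on words and in the enveloping algebra.\<close>

fun ins :: "'a rel \<Rightarrow> 'a \<Rightarrow> 'a list \<Rightarrow> 'a list" where
  "ins r b [] = [b]"
| "ins r b (j # U) = (if (b, j) \<in> r then b # j # U else j # ins r b U)"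

lemma set_ins [simp]: "set (ins r b T) = insert b (set T)"
  by (induction T) auto

lemma length_ins [simp]: "length (ins r b T) = Suc (length T)"
  by (induction T) auto

lemma mset_ins: "mset (ins r b T) = mset (b # T)"
  by (induction T) auto

locale ordered_lie_basis =
  fixes B :: "'g::complex_lie_algebra set" and r :: "'g rel"
  assumes indep: "cvec.independent B" and span_B: "cvec.span B = UNIV"
    and order: "linear_order_on B r"
begin

abbreviation le :: "'g \<Rightarrow> 'g \<Rightarrow> bool" where "le x y \<equiv> (x, y) \<in> r"

definition ordered :: "'g list \<Rightarrow> bool" where
  "ordered T \<longleftrightarrow> set T \<subseteq> B \<and> sorted_wrt le T"

lemma le_refl: "b \<in> B \<Longrightarrow> le b b"
  using order by (auto simp: order_on_defs refl_on_def)

lemma le_trans: "le a b \<Longrightarrow> le b c \<Longrightarrow> le a c"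
  using order by (auto simp: order_on_defs trans_def)

lemma le_antisym: "le a b \<Longrightarrow> le b a \<Longrightarrow> a = b"
  using order by (auto simp: order_on_defs antisym_def)

lemma le_total: "a \<in> B \<Longrightarrow> b \<in> B \<Longrightarrow> le a b \<or> le b a"
  using order le_refl by (cases "a = b") (auto simp: order_on_defs total_on_def)

lemma ordered_Nil [simp]: "ordered []"
  by (simp add: ordered_def)

lemma ordered_Cons: "ordered (j # U) \<longleftrightarrow> j \<in> B \<and> ordered U \<and> (\<forall>x\<in>set U. le j x)"
  by (auto simp: ordered_def)

lemma ordered_ins: "b \<in> B \<Longrightarrow> ordered T \<Longrightarrow> ordered (ins r b T)"
proof (induction T)
  case (Cons j U)
  then show ?case
    using le_total [of b j] by (auto simp: ordered_Cons intro: le_trans)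
qed (simp add: ordered_Cons)

text \<open>By antisymmetry the first letter is the only least one among the letters of the word, so
  the multiset determines the word.\<close>

lemma ordered_unique: "ordered T \<Longrightarrow> ordered T' \<Longrightarrow> mset T = mset T' \<Longrightarrow> T = T'"
proof (induction T arbitrary: T')
  case (Cons j U)
  then obtain k V where T': "T' = k # V" by (cases T') auto
  have "k \<in> set (j # U)" "j \<in> set (k # V)"
    using mset_eq_setD [OF Cons.prems(3)] by (auto simp: T')
  then have "j = k" using Cons.prems(1,2) le_antisym by (auto simp: T' ordered_Cons)
  then show ?case using Cons by (auto simp: T' ordered_Cons)
qed simp

abbreviation word :: "'g list \<Rightarrow> ('g list \<Rightarrow>\<^sub>0 complex)" where
  "word T \<equiv> Poly_Mapping.single T 1"

text \<open>Moving \<open>b\<close> past \<open>j < b\<close> gives \<open>b j U = j (b U) + [b, j] U\<close>, where \<open>b U\<close> is the word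
  \<^term>\<open>ins r b U\<close> plus terms of length at most that of \<open>U\<close>. The condition on the length
  of \<open>V\<close> is always satisfied; it serves termination.\<close>

function act :: "'g \<Rightarrow> 'g list \<Rightarrow> ('g list \<Rightarrow>\<^sub>0 complex)" where
  "act b [] = word [b]"
| "act b (j # U) = (if le b j then word (b # j # U) else
     word (j # ins r b U) +
     (\<Sum>V\<in>{V \<in> Poly_Mapping.keys (act b U - word (ins r b U)). length V \<le> length U}.
       Poly_Mapping.lookup (act b U - word (ins r b U)) V *\<^sub>C act j V) +
     (\<Sum>c | cvec.representation B (lie_br b j) c \<noteq> 0.
       cvec.representation B (lie_br b j) c *\<^sub>C act c U))"
  by pat_completeness auto
termination by (relation "measure (\<lambda>(b, T). length T)") auto

definition Act :: "'g \<Rightarrow> ('g list \<Rightarrow>\<^sub>0 complex) \<Rightarrow> ('g list \<Rightarrow>\<^sub>0 complex)" where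
  "Act x = free_ext (\<lambda>T. cvec_pair.construct B (\<lambda>b. act b T) x)"

lemma Act_add_right: "Act x (s + t) = Act x s + Act x t"
  and Act_scale_right: "Act x (c *\<^sub>C s) = c *\<^sub>C Act x s"
  by (simp_all add: Act_def clinear_add [OF clinear_free_ext] clinear_scale [OF clinear_free_ext])

lemma clinear_Act: "clinear (Act x)"
  by (simp add: clinearI Act_add_right Act_scale_right)

lemma Act_add_left: "Act (x + y) s = Act x s + Act y s"
  and Act_scale_left: "Act (c *\<^sub>C x) s = c *\<^sub>C Act x s"
  by (simp_all add: Act_def free_ext_def clinear_add [OF clinear_construct [OF indep]]
      clinear_scale [OF clinear_construct [OF indep]] scaleC_add_right sum.distrib
      cvec.scale_sum_right scaleC_scaleC mult.commute)

lemma clinear_Act_left: "clinear (\<lambda>x. Act x s)"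
  by (simp add: clinearI Act_add_left Act_scale_left)

lemma Act_word: "b \<in> B \<Longrightarrow> Act b (word T) = act b T"
  by (simp add: Act_def free_ext_single cvec_pair.construct_basis [OF indep])

lemma Act_word_expand:
  "Act x (word T) = (\<Sum>c | cvec.representation B x c \<noteq> 0. cvec.representation B x c *\<^sub>C act c T)"
proof -
  have "x = (\<Sum>c | cvec.representation B x c \<noteq> 0. cvec.representation B x c *\<^sub>C c)"
    using cvec.sum_nonzero_representation_eq [OF indep, of x] span_B by simp
  then have "Act x (word T) =
      Act (\<Sum>c | cvec.representation B x c \<noteq> 0. cvec.representation B x c *\<^sub>C c) (word T)"
    by simp
  also have "\<dots> = (\<Sum>c | cvec.representation B x c \<noteq> 0. cvec.representation B x c *\<^sub>C Act c (word T))"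
    by (simp add: clinear_sum [OF clinear_Act_left] Act_scale_left)
  also have "\<dots> = (\<Sum>c | cvec.representation B x c \<noteq> 0. cvec.representation B x c *\<^sub>C act c T)"
    by (intro sum.cong refl) (auto simp: Act_word dest: cvec.representation_ne_zero)
  finally show ?thesis .
qed

text \<open>Ordered words stand for commutative monomials in the letters, and this is the space of
  polynomials of degree at most n.\<close>

definition words :: "nat \<Rightarrow> ('g list \<Rightarrow>\<^sub>0 complex) set" where
  "words n = cvec.span {word T | T. ordered T \<and> length T \<le> n}"

lemma words_mono: "m \<le> n \<Longrightarrow> words m \<subseteq> words n"
  unfolding words_def by (rule cvec.span_mono) auto

lemma word_in_words: "ordered T \<Longrightarrow> length T \<le> n \<Longrightarrow> word T \<in> words n"
  unfolding words_def by (rule cvec.span_base) auto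

lemma words_keys: "s \<in> words n \<Longrightarrow> V \<in> Poly_Mapping.keys s \<Longrightarrow> length V \<le> n"
  unfolding words_def
proof (induction arbitrary: V rule: cvec.span_induct_alt)
  case (step c x y)
  then show ?case by (auto simp: in_keys_iff lookup_add lookup_scaleC lookup_single when_def split: if_splits)
qed simp

text \<open>Once the correction terms are known to be no longer than U, the filter on their length
  in the definition of \<open>act\<close> has no effect, and both sums become values of
  \<open>Act\<close>.\<close>

lemma act_Cons:
  assumes "\<not> le b j" "j \<in> B" "act b U - word (ins r b U) \<in> words (length U)"
  shows "act b (j # U) = word (j # ins r b U) + Act j (act b U - word (ins r b U)) +
    Act (lie_br b j) (word U)"
proof -
  let ?w = "act b U - word (ins r b U)"
  have "{V \<in> Poly_Mapping.keys ?w. length V \<le> length U} = Poly_Mapping.keys ?w"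
    using words_keys [OF assms(3)] by auto
  moreover have "Act j ?w = (\<Sum>V\<in>Poly_Mapping.keys ?w. Poly_Mapping.lookup ?w V *\<^sub>C act j V)"
    by (simp add: Act_def free_ext_def cvec_pair.construct_basis [OF indep assms(2)])
  ultimately show ?thesis using assms(1) by (simp add: Act_word_expand)
qed

text \<open>The leading term of \<open>act\<close> is a hypothesis here, and only up to length n, so
  that the lemma can be applied inside the induction that establishes it.\<close>

lemma Act_words_aux:
  assumes "\<And>b T. b \<in> B \<Longrightarrow> ordered T \<Longrightarrow> length T \<le> n \<Longrightarrow> act b T - word (ins r b T) \<in> words (length T)"
    and s: "s \<in> words n"
  shows "Act x s \<in> words (Suc n)"
proof -
  have *: "act b T \<in> words (Suc n)" if "b \<in> B" "ordered T" "length T \<le> n" for b T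
  proof -
    have "act b T - word (ins r b T) \<in> words (Suc n)"
      using assms(1) [OF that] words_mono [of "length T" "Suc n"] that(3) by auto
    moreover have "word (ins r b T) \<in> words (Suc n)"
      using that ordered_ins by (intro word_in_words) auto
    ultimately have "(act b T - word (ins r b T)) + word (ins r b T) \<in> words (Suc n)"
      unfolding words_def by (rule cvec.span_add)
    then show ?thesis by simp
  qed
  have "Act x (word T) \<in> words (Suc n)" if "ordered T" "length T \<le> n" for T
  proof -
    have "act c T \<in> cvec.span {word T | T. ordered T \<and> length T \<le> Suc n}"
      if "cvec.representation B x c \<noteq> 0" for c
      using * [OF cvec.representation_ne_zero [OF that] \<open>ordered T\<close> \<open>length T \<le> n\<close>]
      by (simp only: words_def)
    then show ?thesis
      unfolding Act_word_expand words_def by (intro cvec.span_sum cvec.span_scale) simp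
  qed
  then show ?thesis unfolding words_def
    by (intro clinear_span_image [OF clinear_Act _ s [unfolded words_def]]) blast
qed

text \<open>The induction runs over the length for all letters simultaneously: moving b past j
  leaves j and the letters of [b, j] acting on words shorter than T.\<close>

lemma act_lower: "b \<in> B \<Longrightarrow> ordered T \<Longrightarrow> act b T - word (ins r b T) \<in> words (length T)"
proof (induction "length T" arbitrary: b T rule: less_induct)
  case less
  show ?case
  proof (cases T)
    case Nil
    then show ?thesis by (simp add: words_def cvec.span_zero)
  next
    case (Cons j U)
    then have U: "ordered U" "j \<in> B" using less.prems by (auto simp: ordered_Cons)
    show ?thesis
    proof (cases "le b j")
      case True
      then show ?thesis by (simp add: Cons words_def cvec.span_zero)
    next
      case False
      have w: "act b U - word (ins r b U) \<in> words (length U)"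
        using less.hyps [of U b] U less.prems by (simp add: Cons)
      have "\<And>b T. b \<in> B \<Longrightarrow> ordered T \<Longrightarrow> length T \<le> length U \<Longrightarrow>
          act b T - word (ins r b T) \<in> words (length T)"
        using less.hyps by (simp add: Cons)
      from Act_words_aux [OF this] have "Act j (act b U - word (ins r b U)) \<in> words (Suc (length U))"
        "Act (lie_br b j) (word U) \<in> words (Suc (length U))"
        using w U word_in_words by auto
      then show ?thesis using act_Cons [OF False U(2) w] False
        by (simp add: Cons words_def cvec.span_add)
    qed
  qed
qed

lemma Act_words: "s \<in> words n \<Longrightarrow> Act x s \<in> words (Suc n)"
  using Act_words_aux act_lower by blast

lemma Act_le: "ordered (b # T) \<Longrightarrow> Act b (word T) = word (b # T)"
  by (cases T) (auto simp: Act_word ordered_Cons)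

section \<open>The bracket relation for the action on words\<close>

abbreviation (input) commutes_at where
  "commutes_at x y s \<equiv> Act x (Act y s) = Act y (Act x s) + Act (lie_br x y) s"

lemma commutes_at_sym: "commutes_at x y s \<Longrightarrow> commutes_at y x s"
  by (simp add: lie_br_antisym [of y x] clinear_minus [OF clinear_Act_left])

text \<open>Unless b = j, this is the recursive clause of \<open>act\<close> read backwards.\<close>

lemma commutes_at_le:
  assumes "b \<in> B" "ordered (j # T)" "le j b"
  shows "commutes_at b j (word T)"
proof -
  have T: "ordered T" "j \<in> B" using assms(2) by (auto simp: ordered_Cons)
  have *: "Act j (word T) = word (j # T)" by (rule Act_le [OF assms(2)])
  show ?thesis
  proof (cases "le b j")
    case True
    then have "b = j" using assms(3) le_antisym by blast
    then show ?thesis using clinear_0 [OF clinear_Act_left] by (simp add: lie_br_self)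
  next
    case False
    let ?w = "act b T - word (ins r b T)"
    have w: "?w \<in> words (length T)" using act_lower assms(1) T by blast
    have "ordered (j # ins r b T)"
      using assms T by (auto simp: ordered_Cons ordered_ins)
    then have "Act j (word (ins r b T)) = word (j # ins r b T)" by (rule Act_le)
    then have "Act j (act b T) = word (j # ins r b T) + Act j ?w"
      by (simp add: clinear_diff [OF clinear_Act])
    then show ?thesis
      using act_Cons [OF False T(2) w] assms(1) by (simp add: * Act_word)
  qed
qed

text \<open>The arguments are extended linearly from B in turn; antisymmetry lets the second
  extension reuse linearity in the first argument.\<close>

lemma commutes_at_span_left:
  assumes "\<And>b c. b \<in> B \<Longrightarrow> c \<in> B \<Longrightarrow> commutes_at b c s"
  shows "commutes_at x y s"
proof -
  have lin: "clinear (\<lambda>x. Act x (Act y s))" "clinear (\<lambda>x. Act y (Act x s) + Act (lie_br x y) s)" for y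
    by (simp_all add: clinear_def Act_add_left Act_scale_left Act_add_right Act_scale_right
        lie_br_add_left lie_br_scale_left scaleC_add_right add_ac)
  have "commutes_at x c s" if "c \<in> B" for c x
    by (rule clinear_eq_on_span [OF lin, of B], rule assms, assumption, rule that, simp only: span_B UNIV_I)
  then have *: "commutes_at c x s" if "c \<in> B" for c x
    using that commutes_at_sym by blast
  show ?thesis
    by (rule clinear_eq_on_span [OF lin, of B], rule *, assumption, simp only: span_B UNIV_I)
qed

lemma commutes_at_span_right:
  assumes "\<And>T. ordered T \<Longrightarrow> length T \<le> n \<Longrightarrow> commutes_at x y (word T)" "s \<in> words n"
  shows "commutes_at x y s"
proof -
  have lin: "clinear (\<lambda>s. Act x (Act y s))" "clinear (\<lambda>s. Act y (Act x s) + Act (lie_br x y) s)"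
    by (simp_all add: clinear_def Act_add_right Act_scale_right scaleC_add_right add_ac)
  show ?thesis
    by (rule clinear_eq_on_span [OF lin _ assms(2) [unfolded words_def]]) (use assms(1) in blast)
qed

text \<open>If b or c is at most the first letter of T, the recursive clause of \<open>act\<close>
  decides. Otherwise the first letter k lies below both, T is k applied to U, and moving both
  actions past k reduces the claim to U and the Jacobi identity.\<close>

lemma commutes_at_word: "ordered T \<Longrightarrow> commutes_at x y (word T)"
proof (induction "length T" arbitrary: x y T rule: less_induct)
  case less
  have "commutes_at b c (word T)" if bc: "b \<in> B" "c \<in> B" for b c
  proof -
    consider "ordered (b # T)" | "ordered (c # T)" | k U where "T = k # U" "\<not> le b k" "\<not> le c k"
      using bc less.prems by (cases T) (auto simp: ordered_Cons intro: le_trans)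
    then show ?thesis
    proof cases
      case 1
      show ?thesis
      proof (cases "le b c")
        case True
        then show ?thesis using commutes_at_le [OF bc(2) 1] commutes_at_sym by blast
      next
        case False
        then have "le c b" using le_total bc by blast
        with 1 bc have "ordered (c # T)" by (auto simp: ordered_Cons intro: le_trans)
        then show ?thesis using commutes_at_le [OF bc(1)] \<open>le c b\<close> by blast
      qed
    next
      case 2
      show ?thesis
      proof (cases "le c b")
        case True
        then show ?thesis using commutes_at_le [OF bc(1) 2] by blast
      next
        case False
        then have "le b c" using le_total bc by blast
        with 2 bc have "ordered (b # T)" by (auto simp: ordered_Cons intro: le_trans)
        then show ?thesis using commutes_at_le [OF bc(2)] \<open>le b c\<close> commutes_at_sym by blast
      qed
    next
      case 3
      then have U: "ordered U" "k \<in> B" "ordered (k # U)" using less.prems by (auto simp: ordered_Cons)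
      then have k: "le k b" "le k c" using 3 bc le_total by blast+
      have IH: "commutes_at x y s" if "s \<in> words (length U)" for x y s
        by (rule commutes_at_span_right [OF less.hyps that]) (simp_all add: 3(1))
      have U': "word U \<in> words (length U)" using U word_in_words by simp
      \<comment> \<open>The induction hypothesis does not reach \<open>Act e (word U)\<close>, whose
        leading word \<open>ins r e U\<close> is longer than U. All letters of that word are at or
        above k, so \<open>commutes_at_le\<close> handles it; the rest is short enough for the
        induction.\<close>
      have Acomm: "commutes_at d k (Act e (word U))"
        if d: "d \<in> B" "le k d" and e: "e \<in> B" "le k e" for d e
      proof -
        have "commutes_at d k (word (ins r e U))"
          by (rule commutes_at_le) (use d e U in \<open>auto simp: ordered_Cons ordered_ins\<close>)
        moreover have "commutes_at d k (act e U - word (ins r e U))"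
          using IH act_lower [OF e(1) U(1)] by blast
        ultimately show ?thesis
          by (simp add: Act_word [OF e(1)] clinear_diff [OF clinear_Act] algebra_simps)
      qed
      have *: "Act d (Act e (word T)) = Act k (Act d (Act e (word U))) + Act (lie_br d k) (Act e (word U))
          + Act (lie_br e k) (Act d (word U)) + Act (lie_br d (lie_br e k)) (word U)"
        if "d \<in> B" "le k d" and "e \<in> B" "le k e" for d e
      proof -
        have "Act e (word T) = Act k (Act e (word U)) + Act (lie_br e k) (word U)"
          unfolding 3(1) Act_le [OF U(3), symmetric] by (rule IH [OF U'])
        then show ?thesis
          using Acomm [OF that] IH [OF U', of d "lie_br e k"] by (simp add: Act_add_right)
      qed
      have jac: "lie_br b (lie_br c k) - lie_br c (lie_br b k) = - lie_br k (lie_br b c)"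
        using lie_jacobi [of b c k] lie_br_antisym [of k b]
          clinear_minus [of "lie_br c" "lie_br b k"]
        by (simp add: clinearI lie_br_add_right lie_br_scale_right eq_neg_iff_add_eq_0)
      \<comment> \<open>The two middle terms of the expansion are exchanged when b and c are, so
        they cancel in the difference.\<close>
      have "Act b (Act c (word T)) - Act c (Act b (word T))
          = Act k (Act b (Act c (word U)) - Act c (Act b (word U)))
            + Act (lie_br b (lie_br c k) - lie_br c (lie_br b k)) (word U)"
        using * [of b c] * [of c b] bc k
        by (simp add: clinear_diff [OF clinear_Act] clinear_diff [OF clinear_Act_left])
      also have "\<dots> = Act k (Act (lie_br b c) (word U)) - Act (lie_br k (lie_br b c)) (word U)"
        using IH [OF U', of b c] by (simp add: jac clinear_minus [OF clinear_Act_left])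
      also have "\<dots> = Act (lie_br b c) (word T)"
        unfolding 3(1) Act_le [OF U(3), symmetric] using IH [OF U', of k "lie_br b c"] by simp
      finally show ?thesis by (simp add: algebra_simps)
    qed
  qed
  then show ?case by (rule commutes_at_span_left)
qed

section \<open>The representation of the enveloping algebra\<close>

primrec uact :: "'g uterm \<Rightarrow> ('g list \<Rightarrow>\<^sub>0 complex) \<Rightarrow> ('g list \<Rightarrow>\<^sub>0 complex)" where
  "uact (UGen x) s = Act x s"
| "uact UZero s = 0"
| "uact UOne s = s"
| "uact (UAdd t t') s = uact t s + uact t' s"
| "uact (UScale c t) s = c *\<^sub>C uact t s"
| "uact (UMul t t') s = uact t (uact t' s)"

lemma clinear_uact: "clinear (uact t)"
proof (rule clinearI)
  show "uact t (s + s') = uact t s + uact t s'" for s s'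
    by (induction t arbitrary: s s') (simp_all add: Act_add_right scaleC_add_right)
  show "uact t (c *\<^sub>C s) = c *\<^sub>C uact t s" for c s
    by (induction t arbitrary: s) (simp_all add: Act_scale_right scaleC_add_right scaleC_scaleC mult.commute)
qed

definition all_words :: "('g list \<Rightarrow>\<^sub>0 complex) set" where
  "all_words = (\<Union>n. words n)"

lemma all_words_closed:
  "0 \<in> all_words" "s \<in> all_words \<Longrightarrow> t \<in> all_words \<Longrightarrow> s + t \<in> all_words"
  "s \<in> all_words \<Longrightarrow> c *\<^sub>C s \<in> all_words" "s \<in> all_words \<Longrightarrow> Act x s \<in> all_words"
proof -
  show "0 \<in> all_words" by (simp add: all_words_def words_def cvec.span_zero)
  show "c *\<^sub>C s \<in> all_words" if "s \<in> all_words"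
    using that by (auto simp: all_words_def words_def intro: cvec.span_scale)
  show "Act x s \<in> all_words" if "s \<in> all_words"
    using that Act_words by (auto simp: all_words_def)
  assume "s \<in> all_words" "t \<in> all_words"
  then obtain m n where "s \<in> words m" "t \<in> words n" by (auto simp: all_words_def)
  then have "s \<in> words (max m n)" "t \<in> words (max m n)"
    using words_mono by (meson in_mono max.cobounded1 max.cobounded2)+
  then have "s + t \<in> words (max m n)" unfolding words_def by (rule cvec.span_add)
  then show "s + t \<in> all_words" by (auto simp: all_words_def)
qed

lemma uact_closed: "s \<in> all_words \<Longrightarrow> uact t s \<in> all_words"
  by (induction t arbitrary: s) (simp_all add: all_words_closed)

lemma Act_lie_br: "s \<in> all_words \<Longrightarrow> Act (lie_br x y) s = Act x (Act y s) - Act y (Act x s)"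
proof -
  assume "s \<in> all_words"
  then obtain n where "s \<in> words n" by (auto simp: all_words_def)
  then have "commutes_at x y s"
    using commutes_at_span_right [of n x y s] commutes_at_word by blast
  then show ?thesis by simp
qed

text \<open>All vectors that occur stay in the span of the ordered words, where the bracket relation
  holds; hence the action descends from terms to the enveloping algebra.\<close>

lemma uact_cong: "uea_cong t t' \<Longrightarrow> s \<in> all_words \<Longrightarrow> uact t s = uact t' s"
proof (induction arbitrary: s rule: uea_cong.induct)
  case (mul_cong t t' u u')
  then show ?case by (simp add: uact_closed)
next
  case (add_inverse t)
  have "(-1) *\<^sub>C uact t s + uact t s = (-1 + 1) *\<^sub>C uact t s"
    by (simp only: scaleC_add_left scaleC_one)
  then show ?case by simp
next
  case (mul_add_right t u v)
  then show ?case by (simp add: clinear_add [OF clinear_uact])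
next
  case (mul_scale_right t c u)
  then show ?case by (simp add: clinear_scale [OF clinear_uact])
next
  case (gen_br x y)
  then show ?case by (simp add: Act_lie_br scaleC_one)
qed (simp_all add: scaleC_add_right scaleC_add_left scaleC_scaleC scaleC_one add_ac
      Act_add_left Act_scale_left)

text \<open>Acting on the empty word returns all coordinates of u with respect to the ordered
  products of elements of B, not only those of highest degree; see
  \<open>symbol_ordered\<close>.\<close>

definition symbol :: "'g uea \<Rightarrow> ('g list \<Rightarrow>\<^sub>0 complex)" where
  "symbol u = uact (rep_uea u) (word [])"

lemma word_Nil: "word [] \<in> all_words"
  using word_in_words [of "[]" 0] by (auto simp: all_words_def)

lemma symbol_eqI: "abs_uea t = u \<Longrightarrow> symbol u = uact t (word [])"
proof -
  assume "abs_uea t = u"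
  then have "uea_cong (rep_uea u) t"
    using Quotient3_rel [OF Quotient3_uea, of "rep_uea u" t] uea_cong.refl abs_rep_uea by blast
  then show ?thesis unfolding symbol_def using uact_cong word_Nil by blast
qed

lemma clinear_symbol: "clinear symbol"
proof (rule clinearI)
  fix u v :: "'g uea" and c
  show "symbol (u + v) = symbol u + symbol v"
    using symbol_eqI [of "UAdd (rep_uea u) (rep_uea v)" "u + v"]
    by (simp add: symbol_def plus_uea.abs_eq [symmetric] abs_rep_uea)
  show "symbol (c *\<^sub>C u) = c *\<^sub>C symbol u"
    using symbol_eqI [of "UScale c (rep_uea u)" "c *\<^sub>C u"]
    by (simp add: symbol_def scaleC_uea.abs_eq [symmetric] abs_rep_uea)
qed

lemma symbol_1: "symbol 1 = word []"
  using symbol_eqI [of UOne 1] by (simp add: one_uea.abs_eq)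

lemma symbol_mult: "symbol (\<iota> x * u) = Act x (symbol u)"
  using symbol_eqI [of "UMul (UGen x) (rep_uea u)" "\<iota> x * u"]
  by (simp add: symbol_def times_uea.abs_eq [symmetric] \<iota>.abs_eq [symmetric] abs_rep_uea)

lemma symbol_ordered: "ordered T \<Longrightarrow> symbol (prod_list (map \<iota> T)) = word T"
  by (induction T) (simp_all add: symbol_1 symbol_mult Act_le ordered_Cons)

end

section \<open>The filtration of the enveloping algebra\<close>

abbreviation iprod :: "'g::complex_lie_algebra list \<Rightarrow> 'g uea" where
  "iprod xs \<equiv> prod_list (map \<iota> xs)"

lemma clinear_\<iota>: "clinear \<iota>"
  by (rule clinearI) (simp_all add: \<iota>_add \<iota>_scaleC)

lemma clinear_mult_left: "clinear (\<lambda>v. u * (v::'u::complex_algebra))"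
  and clinear_mult_right: "clinear (\<lambda>v. v * (u::'u::complex_algebra))"
  by (simp_all add: clinear_def distrib_left distrib_right scaleC_mult_left scaleC_mult_right)

lemma filtration_iprod: "length xs < n \<Longrightarrow> iprod xs \<in> filtration_less n"
  unfolding filtration_less_def by (rule cvec.span_base) blast

lemma filtration_mono: "m \<le> n \<Longrightarrow> u \<in> filtration_less m \<Longrightarrow> u \<in> filtration_less n"
  unfolding filtration_less_def
  by (rule subsetD [OF cvec.span_mono [of "{iprod xs | xs. length xs < m}"]]) auto

lemma filtration_0: "0 \<in> filtration_less n"
  and filtration_add: "u \<in> filtration_less n \<Longrightarrow> v \<in> filtration_less n \<Longrightarrow> u + v \<in> filtration_less n"
  and filtration_diff: "u \<in> filtration_less n \<Longrightarrow> v \<in> filtration_less n \<Longrightarrow> u - v \<in> filtration_less n"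
  and filtration_scale: "u \<in> filtration_less n \<Longrightarrow> c *\<^sub>C u \<in> filtration_less n"
  and filtration_sum: "(\<And>a. a \<in> A \<Longrightarrow> f a \<in> filtration_less n) \<Longrightarrow> sum f A \<in> filtration_less n"
  unfolding filtration_less_def
  by (rule cvec.span_zero cvec.span_add cvec.span_diff cvec.span_scale cvec.span_sum; assumption)+

lemma filtration_less_0 [simp]: "u \<in> filtration_less 0 \<longleftrightarrow> u = 0"
  by (simp add: filtration_less_def)

lemma filtration_mult_iprod:
  assumes "v \<in> filtration_less n"
  shows "iprod xs * v \<in> filtration_less (length xs + n)"
  unfolding filtration_less_def
proof (rule clinear_span_image [OF clinear_mult_left _ assms [unfolded filtration_less_def]])
  fix v :: "'a uea" assume "v \<in> {iprod ys | ys. length ys < n}"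
  then obtain ys where "v = iprod ys" "length ys < n" by blast
  then show "iprod xs * v \<in> cvec.span {iprod ys | ys. length ys < length xs + n}"
    using filtration_iprod [of "xs @ ys" "length xs + n"] by (simp add: filtration_less_def)
qed

lemma filtration_\<iota>_mult: "v \<in> filtration_less n \<Longrightarrow> \<iota> x * v \<in> filtration_less (Suc n)"
  using filtration_mult_iprod [of v n "[x]"] by simp

text \<open>One of the strict bounds has to be relaxed: degrees at most m and less than n add up to
  less than m + n.\<close>

lemma filtration_mult:
  assumes "u \<in> filtration_less (Suc m)" "v \<in> filtration_less n"
  shows "u * v \<in> filtration_less (m + n)"
  unfolding filtration_less_def
proof (rule clinear_span_image [OF clinear_mult_right _ assms(1) [unfolded filtration_less_def]])
  fix u :: "'a uea" assume "u \<in> {iprod ys | ys. length ys < Suc m}"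
  then obtain ys where "u = iprod ys" "length ys \<le> m" by auto
  then have "u * v \<in> filtration_less (m + n)"
    using filtration_mult_iprod [OF assms(2), of ys] filtration_mono [of "length ys + n" "m + n"] by simp
  then show "u * v \<in> cvec.span {iprod xs | xs. length xs < m + n}"
    by (simp add: filtration_less_def)
qed

lemma filtration_mult_Suc:
  assumes "u \<in> filtration_less m" "v \<in> filtration_less (Suc n)"
  shows "u * v \<in> filtration_less (m + n)"
proof (cases m)
  case 0
  then show ?thesis using assms by (simp add: filtration_0)
next
  case (Suc k)
  then show ?thesis using filtration_mult [of u k v "Suc n"] assms by simp
qed

lemma \<iota>_commute: "\<iota> x * \<iota> y = \<iota> y * \<iota> x + \<iota> (lie_br x y)"
  by (simp add: \<iota>_lie_br)

section \<open>The spanning half of the Poincare-Birkhoff-Witt theorem\<close>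

context ordered_lie_basis
begin

definition ordered_span :: "nat \<Rightarrow> 'g uea set" where
  "ordered_span n = cvec.span {iprod T | T. ordered T \<and> length T < n}"

lemma ordered_span_iprod: "ordered T \<Longrightarrow> length T < n \<Longrightarrow> iprod T \<in> ordered_span n"
  unfolding ordered_span_def by (rule cvec.span_base) blast

lemma ordered_span_mono: "m \<le> n \<Longrightarrow> u \<in> ordered_span m \<Longrightarrow> u \<in> ordered_span n"
  unfolding ordered_span_def
  by (rule subsetD [OF cvec.span_mono [of "{iprod T | T. ordered T \<and> length T < m}"]]) auto

lemma ordered_span_mult_aux:
  assumes low: "\<And>b T. b \<in> B \<Longrightarrow> ordered T \<Longrightarrow> length T < n \<Longrightarrow>
      \<iota> b * iprod T - iprod (ins r b T) \<in> ordered_span (Suc (length T))"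
    and u: "u \<in> ordered_span n"
  shows "\<iota> x * u \<in> ordered_span (Suc n)"
proof -
  have base: "\<iota> b * iprod T \<in> ordered_span (Suc n)" if "b \<in> B" "ordered T" "length T < n" for b T
  proof -
    have "\<iota> b * iprod T - iprod (ins r b T) \<in> ordered_span (Suc n)"
      using low [OF that] that(3) ordered_span_mono [of "Suc (length T)" "Suc n"] by simp
    moreover have "iprod (ins r b T) \<in> ordered_span (Suc n)"
      using that ordered_ins by (intro ordered_span_iprod) auto
    ultimately have "(\<iota> b * iprod T - iprod (ins r b T)) + iprod (ins r b T) \<in> ordered_span (Suc n)"
      unfolding ordered_span_def by (rule cvec.span_add)
    then show ?thesis by simp
  qed
  have lin: "clinear (\<lambda>x. \<iota> x * u)" for u
    by (simp add: clinear_def \<iota>_add \<iota>_scaleC distrib_right scaleC_mult_left)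
  have "\<iota> x * iprod T \<in> ordered_span (Suc n)" if "ordered T" "length T < n" for T
    unfolding ordered_span_def
    by (rule clinear_span_image [OF lin, of B])
      (use base that in \<open>simp_all add: span_B ordered_span_def\<close>)
  then show ?thesis unfolding ordered_span_def
    by (intro clinear_span_image [OF clinear_mult_left _ u [unfolded ordered_span_def]]) blast
qed

text \<open>Exchanging two neighbours in a product costs their bracket, which shortens it. The
  induction has the same shape as the one for \<open>act_lower\<close>.\<close>

lemma ordered_span_ins:
  "b \<in> B \<Longrightarrow> ordered T \<Longrightarrow> \<iota> b * iprod T - iprod (ins r b T) \<in> ordered_span (Suc (length T))"
proof (induction "length T" arbitrary: b T rule: less_induct)
  case less
  show ?case
  proof (cases T)
    case Nil
    then show ?thesis by (simp add: ordered_span_def cvec.span_zero)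
  next
    case (Cons j U)
    then have U: "ordered U" "j \<in> B" using less.prems by (auto simp: ordered_Cons)
    show ?thesis
    proof (cases "le b j")
      case True
      then show ?thesis by (simp add: Cons ordered_span_def cvec.span_zero)
    next
      case False
      have IH: "\<iota> x * u \<in> ordered_span (Suc (length T))" if "u \<in> ordered_span (length T)" for x u
        using that less.hyps by (intro ordered_span_mult_aux) auto
      let ?w = "\<iota> b * iprod U - iprod (ins r b U)"
      have "?w \<in> ordered_span (length T)"
        using less.hyps [of U b] U less.prems by (simp add: Cons)
      moreover have "iprod U \<in> ordered_span (length T)"
        using U by (intro ordered_span_iprod) (simp_all add: Cons)
      ultimately have "\<iota> j * ?w + \<iota> (lie_br b j) * iprod U \<in> ordered_span (Suc (length T))"
        using IH unfolding ordered_span_def by (intro cvec.span_add) (simp_all only:)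
      moreover have "\<iota> b * iprod T = \<iota> j * (\<iota> b * iprod U) + \<iota> (lie_br b j) * iprod U"
        using \<iota>_commute [of b j] by (simp add: Cons distrib_right flip: mult.assoc)
      ultimately show ?thesis using False by (simp add: Cons algebra_simps)
    qed
  qed
qed

text \<open>The ordered products already span each step of the filtration, so the coordinates given
  by \<open>symbol\<close> detect the filtration degree.\<close>

lemma filtration_eq: "filtration_less n = ordered_span n"
proof
  show "ordered_span n \<subseteq> filtration_less n"
    unfolding ordered_span_def filtration_less_def by (rule cvec.span_mono) blast
  have "iprod xs \<in> ordered_span (Suc (length xs))" for xs
  proof (induction xs)
    case Nil
    then show ?case using ordered_span_iprod [of "[]" 1] by simp
  next
    case (Cons x xs)
    then show ?case using ordered_span_mult_aux ordered_span_ins by simp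
  qed
  then have "iprod xs \<in> ordered_span n" if "length xs < n" for xs
    using ordered_span_mono [of "Suc (length xs)" n] that by simp
  then show "filtration_less n \<subseteq> ordered_span n"
    unfolding filtration_less_def ordered_span_def
    by (intro cvec.span_minimal) auto
qed

lemma symbol_filtration:
  "u \<in> filtration_less n \<Longrightarrow> n \<le> length T \<Longrightarrow> Poly_Mapping.lookup (symbol u) T = 0"
  unfolding filtration_eq ordered_span_def
proof (induction rule: cvec.span_induct_alt)
  case base
  then show ?case by (simp add: clinear_0 [OF clinear_symbol])
next
  case (step c x y)
  then show ?case
    by (auto simp: clinear_add [OF clinear_symbol] clinear_scale [OF clinear_symbol]
        lookup_add lookup_scaleC symbol_ordered lookup_single when_def split: if_splits)
qed

lemma symbol_\<iota>: "Poly_Mapping.lookup (symbol (\<iota> x)) [b] = cvec.representation B x b"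
proof -
  have "symbol (\<iota> x) = Act x (word [])"
    using symbol_mult [of x 1] by (simp add: symbol_1)
  also have "\<dots> = (\<Sum>c | cvec.representation B x c \<noteq> 0. cvec.representation B x c *\<^sub>C word [c])"
    by (simp add: Act_word_expand)
  finally have "Poly_Mapping.lookup (symbol (\<iota> x)) [b] =
      (\<Sum>c | cvec.representation B x c \<noteq> 0. if c = b then cvec.representation B x b else 0)"
    by (auto simp: clinear_sum [OF clinear_lookup] lookup_scaleC scaleC_complex_def lookup_single
        when_def intro!: sum.cong)
  then show ?thesis using cvec.finite_representation [of B x] by (simp add: sum.delta)
qed

lemma \<iota>_eq_0: "\<iota> x = 0 \<Longrightarrow> x = (0::'g)"
proof -
  assume "\<iota> x = 0"
  then have "cvec.representation B x b = 0" for b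
    using symbol_\<iota> [of x b] by (simp add: clinear_0 [OF clinear_symbol])
  then show ?thesis using cvec.sum_nonzero_representation_eq [OF indep, of x] span_B by simp
qed

end

text \<open>The coordinates of \<iota> x at one-letter words are those of x in a basis. Any basis
  with any total order serves, and a well-ordering supplies the order.\<close>

lemma inj_\<iota>: "inj (\<iota> :: 'g::complex_lie_algebra \<Rightarrow> 'g uea)"
proof -
  have 0: "cvec.independent ({} :: 'g set)" by (rule cvec.independent_empty)
  obtain r :: "'g rel" where "well_order_on (cvec.extend_basis {}) r"
    using well_order_on by blast
  then interpret ordered_lie_basis "cvec.extend_basis {} :: 'g set" r
    using cvec.independent_extend_basis [OF 0] cvec.span_extend_basis [OF 0]
    by unfold_locales (auto simp: well_order_on_def)
  show ?thesis
  proof (rule injI)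
    fix x y :: 'g assume "\<iota> x = \<iota> y"
    then have "\<iota> (x - y) = 0" by (simp add: clinear_diff [OF clinear_\<iota>])
    then show "x = y" using \<iota>_eq_0 by fastforce
  qed
qed

section \<open>Ordered monomials\<close>

definition total_degree :: "('a \<Rightarrow>\<^sub>0 nat) \<Rightarrow> nat" where
  "total_degree N = (\<Sum>x\<in>Poly_Mapping.keys N. Poly_Mapping.lookup N x)"

text \<open>The denominator of the leading coefficient of [N].\<close>

definition fact_prod :: "('a \<Rightarrow>\<^sub>0 nat) \<Rightarrow> complex" where
  "fact_prod N = (\<Prod>x\<in>Poly_Mapping.keys N. fact (Poly_Mapping.lookup N x))"

lemma fact_prod_nonzero [simp]: "fact_prod N \<noteq> 0"
  by (simp add: fact_prod_def)

definition monomial_word :: "'a rel \<Rightarrow> ('a \<Rightarrow>\<^sub>0 nat) \<Rightarrow> 'a list" where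
  "monomial_word r N =
    concat (map (\<lambda>x. replicate (Poly_Mapping.lookup N x) x) (ordered_list r (Poly_Mapping.keys N)))"

text \<open>An index set on which f is injective is selected, so that coefficients can be attached
  to indices instead of values.\<close>

lemma cspan_imageE:
  assumes "v \<in> cvec.span (f ` X)"
  obtains A c where "finite A" "A \<subseteq> X" "v = (\<Sum>a\<in>A. c a *\<^sub>C f a)"
proof -
  obtain t d where t: "finite t" "t \<subseteq> f ` X" "v = (\<Sum>a\<in>t. d a *\<^sub>C a)"
    using assms unfolding cvec.span_explicit by blast
  then obtain A where A: "A \<subseteq> X" "inj_on f A" "t = f ` A"
    by (meson subset_image_inj)
  then have "v = (\<Sum>a\<in>A. d (f a) *\<^sub>C f a)" by (simp add: t(3) sum.reindex)
  moreover have "finite A" using A t(1) finite_imageD by blast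
  ultimately show ?thesis by (intro that [OF _ A(1)])
qed

context ordered_lie_basis
begin

lemma ordered_list_exists:
  "finite K \<Longrightarrow> K \<subseteq> B \<Longrightarrow> \<exists>xs. distinct xs \<and> set xs = K \<and> sorted_wrt le xs"
proof (induction K rule: finite_induct)
  case (insert b K)
  then obtain xs where xs: "distinct xs" "set xs = K" "sorted_wrt le xs" by auto
  have "distinct (ins r b xs)"
    using mset_ins [of r b xs] insert(2) xs by (metis distinct.simps(2) mset_eq_imp_distinct_iff)
  moreover have "ordered (ins r b xs)"
    using insert xs by (intro ordered_ins) (auto simp: ordered_def)
  ultimately show ?case using xs by (intro exI [of _ "ins r b xs"]) (auto simp: ordered_def)
qed auto

lemma ordered_list:
  assumes "finite K" "K \<subseteq> B"
  shows "distinct (ordered_list r K)" "set (ordered_list r K) = K" "ordered (ordered_list r K)"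
proof -
  have "\<exists>!xs. distinct xs \<and> set xs = K \<and> sorted_wrt le xs"
  proof (rule ex_ex1I [OF ordered_list_exists [OF assms]])
    fix xs ys
    assume *: "distinct xs \<and> set xs = K \<and> sorted_wrt le xs" "distinct ys \<and> set ys = K \<and> sorted_wrt le ys"
    then have "mset xs = mset ys" by (metis set_eq_iff_mset_eq_distinct)
    then show "xs = ys" using * assms by (intro ordered_unique) (auto simp: ordered_def)
  qed
  from theI' [OF this]
  show "distinct (ordered_list r K)" "set (ordered_list r K) = K" "ordered (ordered_list r K)"
    using assms(2) by (auto simp: ordered_list_def ordered_def)
qed

abbreviation exponents :: "('g \<Rightarrow>\<^sub>0 nat) set" where
  "exponents \<equiv> {N. Poly_Mapping.keys N \<subseteq> B}"

lemma ordered_concat_replicate: "ordered xs \<Longrightarrow> ordered (concat (map (\<lambda>x. replicate (k x) x) xs))"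
proof (induction xs)
  case (Cons x xs)
  then have x: "x \<in> B" "\<forall>y\<in>set xs. le x y" and xs: "ordered (concat (map (\<lambda>x. replicate (k x) x) xs))"
    by (auto simp: ordered_Cons)
  have "ordered (replicate n x @ concat (map (\<lambda>x. replicate (k x) x) xs))" for n
    by (induction n) (use x xs le_refl in \<open>auto simp: ordered_Cons\<close>)
  then show ?case by simp
qed simp

lemma count_concat_replicate:
  "distinct xs \<Longrightarrow> count (mset (concat (map (\<lambda>x. replicate (k x) x) xs))) y = (if y \<in> set xs then k y else 0)"
  by (induction xs) auto

lemma ordered_monomial_word: "N \<in> exponents \<Longrightarrow> ordered (monomial_word r N)"
  unfolding monomial_word_def
  by (intro ordered_concat_replicate) (simp add: ordered_list)

lemma count_monomial_word:
  "N \<in> exponents \<Longrightarrow> count (mset (monomial_word r N)) x = Poly_Mapping.lookup N x"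
  unfolding monomial_word_def
  by (subst count_concat_replicate) (auto simp: ordered_list in_keys_iff)

lemma monomial_word_inject:
  "M \<in> exponents \<Longrightarrow> N \<in> exponents \<Longrightarrow> monomial_word r M = monomial_word r N \<longleftrightarrow> M = N"
  by (metis count_monomial_word poly_mapping_eqI)

lemma length_monomial_word: "N \<in> exponents \<Longrightarrow> length (monomial_word r N) = total_degree N"
  unfolding monomial_word_def total_degree_def
  using ordered_list [of "Poly_Mapping.keys N"]
  by (simp add: length_concat comp_def sum.distinct_set_conv_list [symmetric])

text \<open>The exponents are the multiplicities of the letters. With
  \<open>monomial_word_inject\<close> this makes exponents and ordered words two names for the same
  index set.\<close>

lemma monomial_word_surj:
  assumes "ordered T"
  obtains N where "N \<in> exponents" "monomial_word r N = T"
proof -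
  define N where "N = Abs_poly_mapping (count (mset T))"
  have N: "Poly_Mapping.lookup N = count (mset T)"
    unfolding N_def by (rule Abs_poly_mapping_inverse) simp
  then have "Poly_Mapping.keys N = set T"
    by (auto simp: in_keys_iff)
  then have N': "N \<in> exponents" using assms by (simp add: ordered_def)
  then have "mset (monomial_word r N) = mset T"
    by (intro multiset_eqI) (simp add: count_monomial_word N)
  then show ?thesis using that N' ordered_unique ordered_monomial_word assms by blast
qed

end

section \<open>Leading terms of the monomials\<close>

locale divided_basis = ordered_lie_basis B r for B :: "'g::complex_lie_algebra set" and r +
  fixes p :: "'g \<Rightarrow> nat \<Rightarrow> 'g uea"
  assumes p_n: "x \<in> B \<Longrightarrow> p x n - divided_power (\<iota> x) n \<in> filtration_less n"
begin

lemma divided_power_filtration: "divided_power (\<iota> x) n \<in> filtration_less (Suc n)"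
  using filtration_iprod [of "replicate n x" "Suc n"]
  by (simp add: divided_power_def filtration_scale prod_list_replicate)

lemma p_filtration:
  assumes "x \<in> B"
  shows "p x n \<in> filtration_less (Suc n)"
proof -
  have "p x n - divided_power (\<iota> x) n \<in> filtration_less (Suc n)"
    using p_n [OF assms, of n] filtration_mono [of n "Suc n"] by simp
  from filtration_add [OF this divided_power_filtration [of x n]] show ?thesis by simp
qed

text \<open>The factors are replaced by divided powers one at a time. The error of one factor gets
  multiplied by the product of the later ones, whose degree the first claim bounds; hence the joint
  induction.\<close>

lemma monomial_list:
  assumes "set xs \<subseteq> B"
  shows "prod_list (map (\<lambda>x. p x (k x)) xs) \<in> filtration_less (Suc (sum_list (map k xs)))"
    "prod_list (map (\<lambda>x. p x (k x)) xs) -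
      (1 / prod_list (map (\<lambda>x. fact (k x)) xs)) *\<^sub>C iprod (concat (map (\<lambda>x. replicate (k x) x) xs))
      \<in> filtration_less (sum_list (map k xs))"
  using assms
proof (induction xs)
  case Nil
  {
    case 1
    then show ?case using filtration_iprod [of "[]" 1] by simp
  next
    case 2
    then show ?case by (simp add: scaleC_one)
  }
next
  case (Cons x xs)
  define P where "P = prod_list (map (\<lambda>x. p x (k x)) xs)"
  define Q where "Q = iprod (concat (map (\<lambda>x. replicate (k x) x) xs))"
  define f where "f = (prod_list (map (\<lambda>x. fact (k x)) xs) :: complex)"
  let ?n = "sum_list (map k xs)"
  {
    case 1
    then have "p x (k x) * P \<in> filtration_less (k x + Suc ?n)"
      using Cons by (intro filtration_mult p_filtration) (simp_all add: P_def)
    then show ?case by (simp add: P_def)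
  next
    case 2
    have P: "P \<in> filtration_less (Suc ?n)" "P - (1 / f) *\<^sub>C Q \<in> filtration_less ?n"
      using Cons 2 by (simp_all add: P_def Q_def f_def)
    have "(p x (k x) - divided_power (\<iota> x) (k x)) * P \<in> filtration_less (k x + ?n)"
      using filtration_mult_Suc [OF p_n P(1)] 2 by simp
    moreover have "divided_power (\<iota> x) (k x) * (P - (1 / f) *\<^sub>C Q) \<in> filtration_less (k x + ?n)"
      using filtration_mult [OF divided_power_filtration P(2)] .
    ultimately have "(p x (k x) - divided_power (\<iota> x) (k x)) * P +
        divided_power (\<iota> x) (k x) * (P - (1 / f) *\<^sub>C Q) \<in> filtration_less (k x + ?n)"
      by (rule filtration_add)
    moreover have "(p x (k x) - divided_power (\<iota> x) (k x)) * P +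
        divided_power (\<iota> x) (k x) * (P - (1 / f) *\<^sub>C Q) =
        p x (k x) * P - (1 / (fact (k x) * f)) *\<^sub>C (\<iota> x ^ k x * Q)"
      by (simp add: algebra_simps divided_power_def scaleC_mult_left scaleC_mult_right scaleC_scaleC)
    ultimately show ?case by (simp add: P_def Q_def f_def prod_list_replicate)
  }
qed

lemma monomial_leading:
  assumes "N \<in> exponents"
  shows "monomial r p N - (1 / fact_prod N) *\<^sub>C iprod (monomial_word r N) \<in> filtration_less (total_degree N)"
    "monomial r p N \<in> filtration_less (Suc (total_degree N))"
proof -
  have *: "set (ordered_list r (Poly_Mapping.keys N)) \<subseteq> B" "distinct (ordered_list r (Poly_Mapping.keys N))"
    "set (ordered_list r (Poly_Mapping.keys N)) = Poly_Mapping.keys N"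
    using assms by (simp_all add: ordered_list)
  have eqs: "sum_list (map (Poly_Mapping.lookup N) (ordered_list r (Poly_Mapping.keys N))) = total_degree N"
    "prod_list (map (\<lambda>x. fact (Poly_Mapping.lookup N x)) (ordered_list r (Poly_Mapping.keys N))) = fact_prod N"
    unfolding total_degree_def fact_prod_def
    using sum.distinct_set_conv_list [OF *(2), of "Poly_Mapping.lookup N"]
      prod.distinct_set_conv_list [OF *(2), of "\<lambda>x. fact (Poly_Mapping.lookup N x) :: complex"]
    by (simp_all add: *(3))
  show "monomial r p N - (1 / fact_prod N) *\<^sub>C iprod (monomial_word r N) \<in> filtration_less (total_degree N)"
    "monomial r p N \<in> filtration_less (Suc (total_degree N))"
    using monomial_list [OF *(1), of "Poly_Mapping.lookup N"]
    by (simp_all add: monomial_def monomial_word_def eqs)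
qed

text \<open>The terms of [N] after the leading one have length less than
  \<open>total_degree N\<close>, too short for the word of M.\<close>

lemma symbol_monomial:
  assumes "M \<in> exponents" "N \<in> exponents" "total_degree N \<le> total_degree M"
  shows "Poly_Mapping.lookup (symbol (monomial r p N)) (monomial_word r M) =
    (if M = N then 1 / fact_prod N else 0)"
proof -
  let ?l = "\<lambda>u. Poly_Mapping.lookup (symbol u) (monomial_word r M)"
  have lin: "clinear ?l"
    by (simp add: clinear_def clinear_add [OF clinear_symbol] clinear_scale [OF clinear_symbol]
        lookup_add lookup_scaleC)
  have "?l (monomial r p N - (1 / fact_prod N) *\<^sub>C iprod (monomial_word r N)) = 0"
    using symbol_filtration [OF monomial_leading(1) [OF assms(2)]] length_monomial_word [OF assms(1)] assms(3)
    by simp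
  then have "?l (monomial r p N) = (1 / fact_prod N) *\<^sub>C ?l (iprod (monomial_word r N))"
    by (simp add: clinear_diff [OF lin] clinear_scale [OF lin])
  then show ?thesis
    using monomial_word_inject [OF assms(1,2)]
    by (auto simp: symbol_ordered [OF ordered_monomial_word [OF assms(2)]] lookup_single when_def
        scaleC_complex_def)
qed

lemma monomial_independent:
  assumes "finite A" "A \<subseteq> exponents" "(\<Sum>N\<in>A. c N *\<^sub>C monomial r p N) = 0" "N \<in> A"
  shows "c N = 0"
proof (rule ccontr)
  assume "c N \<noteq> 0"
  let ?A = "{N \<in> A. c N \<noteq> 0}"
  have A: "finite (total_degree ` ?A)" "total_degree ` ?A \<noteq> {}"
    using assms(1,4) \<open>c N \<noteq> 0\<close> by auto
  \<comment> \<open>M has the highest degree among the exponents with nonzero coefficient, so the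
    coordinate at its word sees [M] alone.\<close>
  from Max_in [OF A] obtain M where M: "M \<in> ?A" "total_degree M = Max (total_degree ` ?A)" by auto
  have max: "total_degree N \<le> total_degree M" if "N \<in> ?A" for N
    unfolding M(2) by (rule Max_ge [OF A(1)]) (use that in blast)
  let ?l = "\<lambda>u. Poly_Mapping.lookup (symbol u) (monomial_word r M)"
  have lin: "clinear ?l"
    by (simp add: clinear_def clinear_add [OF clinear_symbol] clinear_scale [OF clinear_symbol]
        lookup_add lookup_scaleC)
  have "0 = ?l (\<Sum>N\<in>A. c N *\<^sub>C monomial r p N)"
    by (simp add: assms(3) clinear_0 [OF clinear_symbol])
  also have "\<dots> = (\<Sum>N\<in>A. c N * ?l (monomial r p N))"
    by (simp add: clinear_sum [OF lin] clinear_scale [OF lin] scaleC_complex_def)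
  also have "\<dots> = (\<Sum>N\<in>A. if N = M then c M / fact_prod M else 0)"
  proof (rule sum.cong [OF HOL.refl])
    fix N assume "N \<in> A"
    moreover from this have "M \<in> exponents" "N \<in> exponents" using M(1) assms(2) by blast+
    ultimately show "c N * ?l (monomial r p N) = (if N = M then c M / fact_prod M else 0)"
      using symbol_monomial [of M N] M(1) max [of N] by (cases "c N = 0") auto
  qed
  also have "\<dots> = c M / fact_prod M" using M(1) assms(1) by simp
  finally show False using M(1) by simp
qed

lemma filtration_monomials:
  assumes "u \<in> filtration_less (Suc n)"
  obtains A c where "finite A" "A \<subseteq> exponents" "\<And>N. N \<in> A \<Longrightarrow> total_degree N = n"
    "u - (\<Sum>N\<in>A. c N *\<^sub>C monomial r p N) \<in> filtration_less n"
proof -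
  let ?X = "{N \<in> exponents. total_degree N = n}"
  have "\<exists>v\<in>cvec.span (monomial r p ` ?X). u - v \<in> filtration_less n"
    using assms unfolding filtration_eq [of "Suc n"] ordered_span_def
  proof (induction rule: cvec.span_induct_alt)
    case base
    then show ?case by (intro bexI [of _ 0]) (simp_all add: filtration_0 cvec.span_zero)
  next
    case (step c x y)
    then obtain T v where T: "x = iprod T" "ordered T" "length T \<le> n"
      and v: "v \<in> cvec.span (monomial r p ` ?X)" "y - v \<in> filtration_less n" by auto
    show ?case
    proof (cases "length T < n")
      case True
      then have "c *\<^sub>C x + (y - v) \<in> filtration_less n"
        using v T by (intro filtration_add filtration_scale) (auto intro: filtration_iprod)
      then show ?thesis using v(1) by (intro bexI [of _ v]) (simp_all add: algebra_simps)
    next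
      case False
      obtain N where N: "N \<in> exponents" "monomial_word r N = T"
        using monomial_word_surj T(2) by blast
      then have deg: "total_degree N = n" using False T(3) length_monomial_word [of N] by simp
      \<comment> \<open>The factor \<open>fact_prod N\<close> offsets the leading coefficient of
        [N], so that the ordered product over T cancels.\<close>
      let ?w = "(c * fact_prod N) *\<^sub>C monomial r p N + v"
      have w: "?w \<in> cvec.span (monomial r p ` ?X)"
        using N(1) deg by (intro cvec.span_add cvec.span_scale v) (auto intro: cvec.span_base)
      have "c *\<^sub>C x + y - ?w = (y - v) -
          (c * fact_prod N) *\<^sub>C (monomial r p N - (1 / fact_prod N) *\<^sub>C iprod (monomial_word r N))"
        by (simp add: N(2) T(1) cvec.scale_right_diff_distrib scaleC_scaleC)
      also have "\<dots> \<in> filtration_less n"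
        using filtration_diff [OF v(2) filtration_scale [OF monomial_leading(1) [OF N(1), unfolded deg]]] .
      finally show ?thesis by (rule bexI [OF _ w])
    qed
  qed
  then obtain v where v: "v \<in> cvec.span (monomial r p ` ?X)" "u - v \<in> filtration_less n" by blast
  obtain A c where A: "finite A" "A \<subseteq> ?X" "v = (\<Sum>N\<in>A. c N *\<^sub>C monomial r p N)"
    using cspan_imageE [OF v(1)] .
  show ?thesis by (rule that [OF A(1), of c]) (use A v(2) in auto)
qed

end

section \<open>Formal tensors\<close>

text \<open>A list of pairs is a formal sum of pure tensors, and this is its value under the map
  that \<open>\<beta>\<close> induces on the tensor product.\<close>

definition tsum :: "('m \<Rightarrow> 'u \<Rightarrow> 'v::ab_group_add) \<Rightarrow> ('m \<times> 'u) list \<Rightarrow> 'v" where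
  "tsum \<beta> l = (\<Sum>(m, u)\<leftarrow>l. \<beta> m u)"

lemma tsum_simps [simp]:
  "tsum \<beta> [] = 0" "tsum \<beta> ((m, u) # l) = \<beta> m u + tsum \<beta> l" "tsum \<beta> (l @ k) = tsum \<beta> l + tsum \<beta> k"
  by (simp_all add: tsum_def)

lemma tsum_Cons: "tsum \<beta> (a # l) = \<beta> (fst a) (snd a) + tsum \<beta> l"
  by (cases a) simp

lemma tsum_map: "tsum \<beta> (map (\<lambda>(m, u). (f m u, h m u)) l) = tsum (\<lambda>m u. \<beta> (f m u) (h m u)) l"
  by (induction l) (auto simp: tsum_Cons)

lemma tsum_cong: "(\<And>m u. (m, u) \<in> set l \<Longrightarrow> \<beta> m u = \<beta>' m u) \<Longrightarrow> tsum \<beta> l = tsum \<beta>' l"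
  by (induction l) (auto simp: tsum_Cons)

lemma tsum_add: "tsum (\<lambda>m u. \<beta> m u + \<beta>' m u) l = tsum \<beta> l + tsum \<beta>' l"
  by (induction l) (auto simp: tsum_Cons)

lemma tsum_diff: "tsum (\<lambda>m u. \<beta> m u - \<beta>' m u) l = tsum \<beta> l - tsum \<beta>' l"
  by (induction l) (auto simp: tsum_Cons)

lemma tsum_0: "tsum (\<lambda>m u. 0) l = 0"
  by (induction l) (auto simp: tsum_Cons)

lemma tsum_swap: "tsum (\<lambda>m u. tsum (\<beta> m u) k) l = tsum (\<lambda>m' u'. tsum (\<lambda>m u. \<beta> m u m' u') l) k"
  by (induction l) (auto simp: tsum_Cons tsum_0 tsum_add)

lemma tsum_clinear: "clinear f \<Longrightarrow> f (tsum \<beta> l) = tsum (\<lambda>m u. f (\<beta> m u)) l"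
  by (induction l) (auto simp: tsum_Cons clinear_0 clinear_add [of f])

text \<open>The product on the right factors is a parameter because it is the multiplication of the
  enveloping algebra in one use and the Lie bracket in another.\<close>

definition tmul :: "('m \<Rightarrow> 'm \<Rightarrow> 'm) \<Rightarrow> ('u \<Rightarrow> 'u \<Rightarrow> 'u) \<Rightarrow> ('m \<times> 'u) list \<Rightarrow> ('m \<times> 'u) list \<Rightarrow> ('m \<times> 'u) list" where
  "tmul mul br l k = concat (map (\<lambda>(m, u). map (\<lambda>(m', u'). (mul m m', br u u')) k) l)"

lemma tsum_tmul: "tsum \<beta> (tmul mul br l k) = tsum (\<lambda>m u. tsum (\<lambda>m' u'. \<beta> (mul m m') (br u u')) k) l"
  by (induction l) (auto simp: tmul_def tsum_Cons tsum_map)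

lemma set_tmul: "set (tmul mul br l k) = {(mul m m', br u u') | m u m' u'. (m, u) \<in> set l \<and> (m', u') \<in> set k}"
  by (force simp: tmul_def)

abbreviation tscale :: "(complex \<Rightarrow> 'm \<Rightarrow> 'm) \<Rightarrow> complex \<Rightarrow> ('m \<times> 'u) list \<Rightarrow> ('m \<times> 'u) list" where
  "tscale sc c l \<equiv> map (\<lambda>(m, u). (sc c m, u)) l"

text \<open>Lists of pairs stand for elements of a tensor product of \<open>'m\<close> with the enveloping algebra;
  two of them are identified if all functionals in \<open>F\<close> agree on them. Under the assumptions
  the map \<open>\<gamma>\<close> on the Lie algebra extends to an algebra homomorphism to this tensor product.\<close>

locale formal_tensor =
  fixes one :: 'm and mul :: "'m \<Rightarrow> 'm \<Rightarrow> 'm" and sc :: "complex \<Rightarrow> 'm \<Rightarrow> 'm"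
    and \<gamma> :: "'g::complex_lie_algebra \<Rightarrow> ('m \<times> 'g uea) list"
    and F :: "('m \<Rightarrow> 'g uea \<Rightarrow> 'v::ab_group_add) set"
  assumes mul_assoc: "mul (mul a b) m = mul a (mul b m)"
    and mul_one: "mul one a = a" "mul a one = a"
    and sc_one: "sc 1 a = a" and sc_sc: "sc c (sc d a) = sc (c * d) a"
    and sc_mul: "mul (sc c a) b = sc c (mul a b)" "mul a (sc c b) = sc c (mul a b)"
    and F_add: "\<beta> \<in> F \<Longrightarrow> \<beta> m (u + v) = \<beta> m u + \<beta> m v"
    and F_sc_add: "\<beta> \<in> F \<Longrightarrow> \<beta> (sc (c + d) m) u = \<beta> (sc c m) u + \<beta> (sc d m) u"
    and F_closed: "\<beta> \<in> F \<Longrightarrow> (\<lambda>m u. \<beta> (mul a (mul m b)) (v * (u * w))) \<in> F"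
    and \<gamma>_add: "\<beta> \<in> F \<Longrightarrow> tsum \<beta> (\<gamma> (x + y)) = tsum \<beta> (\<gamma> x) + tsum \<beta> (\<gamma> y)"
    and \<gamma>_scale: "\<beta> \<in> F \<Longrightarrow> tsum \<beta> (\<gamma> (c *\<^sub>C x)) = tsum \<beta> (tscale sc c (\<gamma> x))"
    and \<gamma>_br: "\<beta> \<in> F \<Longrightarrow> tsum \<beta> (\<gamma> (lie_br x y)) =
      tsum \<beta> (tmul mul (*) (\<gamma> x) (\<gamma> y)) - tsum \<beta> (tmul mul (*) (\<gamma> y) (\<gamma> x))"
begin

primrec expand :: "'g uterm \<Rightarrow> ('m \<times> 'g uea) list" where
  "expand (UGen x) = \<gamma> x"
| "expand UZero = []"
| "expand UOne = [(one, 1)]"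
| "expand (UAdd s t) = expand s @ expand t"
| "expand (UScale c t) = tscale sc c (expand t)"
| "expand (UMul s t) = tmul mul (*) (expand s) (expand t)"

definition equiv :: "('m \<times> 'g uea) list \<Rightarrow> ('m \<times> 'g uea) list \<Rightarrow> bool" where
  "equiv l k \<longleftrightarrow> (\<forall>\<beta>\<in>F. tsum \<beta> l = tsum \<beta> k)"

lemma F_left: "\<beta> \<in> F \<Longrightarrow> (\<lambda>m u. \<beta> (mul a m) (v * u)) \<in> F"
  using F_closed [of \<beta> a one v 1] by (simp add: mul_one)

lemma F_right: "\<beta> \<in> F \<Longrightarrow> (\<lambda>m u. \<beta> (mul m b) (u * w)) \<in> F"
  using F_closed [of \<beta> one b 1 w] by (simp add: mul_one)

lemma F_sc: "\<beta> \<in> F \<Longrightarrow> (\<lambda>m u. \<beta> (sc c m) u) \<in> F"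
  using F_left [of \<beta> "sc c one" 1] by (simp add: mul_one sc_mul)

lemma tsum_tscale: "tsum \<beta> (tscale sc c l) = tsum (\<lambda>m u. \<beta> (sc c m) u) l"
  using tsum_map [of \<beta> "\<lambda>m u. sc c m" "\<lambda>m u. u" l] by simp

lemma equiv_tscale: "equiv l k \<Longrightarrow> equiv (tscale sc c l) (tscale sc c k)"
  by (simp add: equiv_def tsum_tscale F_sc)

text \<open>The factors are replaced one at a time: with a pair of the other factor held fixed, the
  inner functional again belongs to F, by closure under multiplication on either side.\<close>

lemma equiv_tmul:
  assumes "equiv l l'" "equiv k k'"
  shows "equiv (tmul mul (*) l k) (tmul mul (*) l' k')"
  unfolding equiv_def
proof
  fix \<beta> assume \<beta>: "\<beta> \<in> F"
  have "tsum \<beta> (tmul mul (*) l k) = tsum \<beta> (tmul mul (*) l k')"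
    unfolding tsum_tmul
    by (rule tsum_cong) (use assms(2) F_left [OF \<beta>] in \<open>simp add: equiv_def\<close>)
  also have "\<dots> = tsum \<beta> (tmul mul (*) l' k')"
    unfolding tsum_tmul tsum_swap [of _ k']
    by (rule tsum_cong) (use assms(1) F_right [OF \<beta>] in \<open>simp add: equiv_def\<close>)
  finally show "tsum \<beta> (tmul mul (*) l k) = tsum \<beta> (tmul mul (*) l' k')" .
qed

lemma expand_cong: "uea_cong s t \<Longrightarrow> equiv (expand s) (expand t)"
proof (induction rule: uea_cong.induct)
  case (scale_cong t t' c)
  then show ?case by (simp add: equiv_tscale)
next
  case (mul_cong s s' t t')
  then show ?case by (simp add: equiv_tmul)
next
  case (add_inverse t)
  have "tsum (\<lambda>m u. \<beta> (sc (-1) m) u) l + tsum \<beta> l = 0" if "\<beta> \<in> F" for \<beta> l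
  proof -
    \<comment> \<open>The functionals are only assumed to be additive in the scalar, so that -1 acts
      as negation is derived from -1 + 1 = 0.\<close>
    have "\<beta> (sc 0 m) u = 0" for m u
      using F_sc_add [OF that, of 0 0 m u] by simp
    then have "\<beta> (sc (-1) m) u + \<beta> m u = 0" for m u
      using F_sc_add [OF that, of "-1" 1 m u] by (simp add: sc_one)
    then show ?thesis by (simp add: tsum_add [symmetric] tsum_0)
  qed
  then show ?case by (simp add: equiv_def tsum_tscale)
next
  case (gen_br x y)
  have "tsum (\<lambda>m u. \<beta> (sc (-1) m) u) l = - tsum \<beta> l" if "\<beta> \<in> F" for \<beta> l
  proof -
    have "\<beta> (sc 0 m) u = 0" for m u
      using F_sc_add [OF that, of 0 0 m u] by simp
    then have "\<beta> (sc (-1) m) u + \<beta> m u = 0" for m u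
      using F_sc_add [OF that, of "-1" 1 m u] by (simp add: sc_one)
    then have "tsum (\<lambda>m u. \<beta> (sc (-1) m) u) l + tsum \<beta> l = 0" by (simp add: tsum_add [symmetric] tsum_0)
    then show ?thesis by (simp add: eq_neg_iff_add_eq_0)
  qed
  then show ?case by (simp add: equiv_def tsum_tscale \<gamma>_br)
qed (auto simp: equiv_def tsum_tscale tsum_tmul add_ac mul_assoc mul_one mult.assoc sc_one sc_sc
    sc_mul F_sc_add tsum_add \<gamma>_add \<gamma>_scale simp del: map_map)

definition tensor :: "'g uea \<Rightarrow> ('m \<times> 'g uea) list" where
  "tensor u = expand (rep_uea u)"

text \<open>\<open>tensor u\<close> depends on the choice of a term for u and is meaningful only up
  to \<open>equiv\<close>. The relation says that the homomorphism sends u to the class of l, and it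
  leaves l free to be chosen well.\<close>

definition represents :: "'g uea \<Rightarrow> ('m \<times> 'g uea) list \<Rightarrow> bool" where
  "represents u l \<longleftrightarrow> equiv (tensor u) l"

lemma equiv_trans: "equiv l k \<Longrightarrow> equiv k k' \<Longrightarrow> equiv l k'"
  by (simp add: equiv_def)

lemma represents_tensor: "represents u (tensor u)"
  by (simp add: represents_def equiv_def)

lemma representsD: "represents u l \<Longrightarrow> \<beta> \<in> F \<Longrightarrow> tsum \<beta> (tensor u) = tsum \<beta> l"
  by (simp add: represents_def equiv_def)

lemma represents_equiv: "represents u l \<Longrightarrow> equiv l k \<Longrightarrow> represents u k"
  unfolding represents_def by (rule equiv_trans)

lemma represents_term: "represents (abs_uea t) (expand t)"
proof -
  have "uea_cong (rep_uea (abs_uea t)) t" by (simp add: uea_cong_iff abs_rep_uea)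
  then show ?thesis by (simp add: represents_def tensor_def expand_cong)
qed

lemma represents_\<iota>: "represents (\<iota> x) (\<gamma> x)"
  using represents_term [of "UGen x"] by (simp add: \<iota>.abs_eq)

lemma represents_0: "represents 0 []"
  using represents_term [of UZero] by (simp add: zero_uea.abs_eq)

lemma represents_1: "represents 1 [(one, 1)]"
  using represents_term [of UOne] by (simp add: one_uea.abs_eq)

lemma represents_add: "represents u l \<Longrightarrow> represents v k \<Longrightarrow> represents (u + v) (l @ k)"
proof -
  assume *: "represents u l" "represents v k"
  have "represents (u + v) (tensor u @ tensor v)"
    using represents_term [of "UAdd (rep_uea u) (rep_uea v)"]
    by (simp add: plus_uea.abs_eq [symmetric] abs_rep_uea tensor_def)
  then show ?thesis
    by (rule represents_equiv) (use * in \<open>simp add: represents_def equiv_def\<close>)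
qed

lemma represents_scale: "represents u l \<Longrightarrow> represents (c *\<^sub>C u) (tscale sc c l)"
proof -
  assume *: "represents u l"
  have "represents (c *\<^sub>C u) (tscale sc c (tensor u))"
    using represents_term [of "UScale c (rep_uea u)"]
    by (simp add: scaleC_uea.abs_eq [symmetric] abs_rep_uea tensor_def)
  then show ?thesis
    by (rule represents_equiv) (use * in \<open>simp add: represents_def equiv_tscale\<close>)
qed

lemma represents_mult: "represents u l \<Longrightarrow> represents v k \<Longrightarrow> represents (u * v) (tmul mul (*) l k)"
proof -
  assume *: "represents u l" "represents v k"
  have "represents (u * v) (tmul mul (*) (tensor u) (tensor v))"
    using represents_term [of "UMul (rep_uea u) (rep_uea v)"]
    by (simp add: times_uea.abs_eq [symmetric] abs_rep_uea tensor_def)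
  then show ?thesis
    by (rule represents_equiv) (use * in \<open>simp add: represents_def equiv_tmul\<close>)
qed

lemma represents_minus: "represents u l \<Longrightarrow> represents (- u) (tscale sc (-1) l)"
  using represents_scale [of u l "-1"] by (simp only: uminus_uea_def)

lemma represents_diff: "represents u l \<Longrightarrow> represents v k \<Longrightarrow> represents (u - v) (l @ tscale sc (-1) k)"
  using represents_add [OF _ represents_minus, of u l v k] by simp

end

section \<open>The coproduct\<close>

text \<open>Functionals of this kind are the linear maps out of the tensor product over the complex
  numbers.\<close>

definition bilinear_maps :: "('a::complex_vector \<Rightarrow> 'b::complex_vector \<Rightarrow> 'v::complex_vector) set" where
  "bilinear_maps = {\<beta>. (\<forall>u. clinear (\<lambda>m. \<beta> m u)) \<and> (\<forall>m. clinear (\<beta> m))}"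

lemma bilinear_mapsD:
  assumes "\<beta> \<in> bilinear_maps"
  shows "\<beta> (m + m') u = \<beta> m u + \<beta> m' u" "\<beta> m (u + u') = \<beta> m u + \<beta> m u'"
    "\<beta> (c *\<^sub>C m) u = c *\<^sub>C \<beta> m u" "\<beta> m (c *\<^sub>C u) = c *\<^sub>C \<beta> m u"
    "\<beta> (m - m') u = \<beta> m u - \<beta> m' u" "\<beta> m (u - u') = \<beta> m u - \<beta> m u'" "\<beta> (- m) u = - \<beta> m u"
  using assms clinear_minus [of "\<lambda>m. \<beta> m u"] clinear_diff [of "\<lambda>m. \<beta> m u"] clinear_diff [of "\<beta> m"]
  by (auto simp: bilinear_maps_def clinear_def)

text \<open>Elements of the Lie algebra are primitive: the list stands for x \<otimes> 1 + 1
  \<otimes> x.\<close>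

definition coproduct_gen :: "'g::complex_lie_algebra \<Rightarrow> ('g uea \<times> 'g uea) list" where
  "coproduct_gen x = [(\<iota> x, 1), (1, \<iota> x)]"

interpretation coproduct: formal_tensor 1 "(*)" scaleC coproduct_gen
  "bilinear_maps :: ('g::complex_lie_algebra uea \<Rightarrow> 'g uea \<Rightarrow> 'g uea) set"
proof
  fix \<beta> :: "'g uea \<Rightarrow> 'g uea \<Rightarrow> 'g uea" and a b u v w m :: "'g uea" and x y :: 'g and c d :: complex
  assume \<beta>: "\<beta> \<in> bilinear_maps"
  note * = bilinear_mapsD [OF \<beta>]
  show "\<beta> m (u + v) = \<beta> m u + \<beta> m v" "\<beta> ((c + d) *\<^sub>C m) u = \<beta> (c *\<^sub>C m) u + \<beta> (d *\<^sub>C m) u"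
    by (simp_all add: * scaleC_add_left)
  show "(\<lambda>m u. \<beta> (a * (m * b)) (v * (u * w))) \<in> bilinear_maps"
    by (simp add: bilinear_maps_def clinear_def distrib_left distrib_right
        scaleC_mult_left scaleC_mult_right *)
  show "tsum \<beta> (coproduct_gen (x + y)) = tsum \<beta> (coproduct_gen x) + tsum \<beta> (coproduct_gen y)"
    by (simp add: coproduct_gen_def \<iota>_add *)
  show "tsum \<beta> (coproduct_gen (c *\<^sub>C x)) = tsum \<beta> (tscale (*\<^sub>C) c (coproduct_gen x))"
    by (simp add: coproduct_gen_def \<iota>_scaleC *)
  show "tsum \<beta> (coproduct_gen (lie_br x y)) = tsum \<beta> (tmul (*) (*) (coproduct_gen x) (coproduct_gen y)) -
      tsum \<beta> (tmul (*) (*) (coproduct_gen y) (coproduct_gen x))"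
    by (simp add: coproduct_gen_def tmul_def \<iota>_lie_br *)
qed (simp_all add: mult.assoc scaleC_one scaleC_scaleC scaleC_mult_left scaleC_mult_right)

text \<open>The map \<open>(id \<otimes> \<psi>) \<circ> \<Delta>\<close>, where \<open>\<Delta>\<close> is the coproduct.\<close>

definition contract :: "('g::complex_lie_algebra uea \<Rightarrow> complex) \<Rightarrow> 'g uea \<Rightarrow> 'g uea" where
  "contract \<psi> u = tsum (\<lambda>a b. \<psi> b *\<^sub>C a) (coproduct.tensor u)"

lemma contract_bilinear: "clinear \<psi> \<Longrightarrow> (\<lambda>a b. \<psi> b *\<^sub>C a) \<in> bilinear_maps"
  by (simp add: bilinear_maps_def clinear_def scaleC_add_right scaleC_add_left scaleC_scaleC
      scaleC_complex_def mult.commute)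

lemma contract_eq: "clinear \<psi> \<Longrightarrow> coproduct.represents u l \<Longrightarrow> contract \<psi> u = tsum (\<lambda>a b. \<psi> b *\<^sub>C a) l"
  unfolding contract_def by (intro coproduct.representsD contract_bilinear)

lemma clinear_contract:
  assumes \<psi>: "clinear \<psi>"
  shows "clinear (contract \<psi>)"
proof (rule clinearI)
  fix u v :: "'a uea" and c
  show "contract \<psi> (u + v) = contract \<psi> u + contract \<psi> v"
    using contract_eq [OF \<psi> coproduct.represents_add [OF coproduct.represents_tensor coproduct.represents_tensor]]
    by (simp add: contract_def)
  have "contract \<psi> (c *\<^sub>C u) = tsum (\<lambda>a b. \<psi> b *\<^sub>C c *\<^sub>C a) (coproduct.tensor u)"
    using contract_eq [OF \<psi> coproduct.represents_scale [OF coproduct.represents_tensor]]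
    by (simp add: coproduct.tsum_tscale)
  also have "\<dots> = c *\<^sub>C contract \<psi> u"
    using tsum_clinear [of "\<lambda>a. c *\<^sub>C a" "\<lambda>a b. \<psi> b *\<^sub>C a" "coproduct.tensor u"]
    by (simp add: contract_def clinear_def scaleC_add_right scaleC_scaleC mult.commute)
  finally show "contract \<psi> (c *\<^sub>C u) = c *\<^sub>C contract \<psi> u" .
qed

lemma contract_1: "clinear \<psi> \<Longrightarrow> contract \<psi> 1 = \<psi> 1 *\<^sub>C 1"
  using contract_eq [OF _ coproduct.represents_1] by auto

text \<open>The two terms come from x \<otimes> 1 and 1 \<otimes> x. The second one changes the
  functional, which is why the induction for \<open>contract_filtration\<close> keeps
  \<open>\<psi>\<close> arbitrary.\<close>

lemma contract_mult:
  assumes \<psi>: "clinear \<psi>"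
  shows "contract \<psi> (\<iota> x * u) = \<iota> x * contract \<psi> u + contract (\<lambda>v. \<psi> (\<iota> x * v)) u"
proof -
  have "clinear (\<lambda>v. \<psi> (\<iota> x * v))"
    using \<psi> by (simp add: clinear_def distrib_left scaleC_mult_right)
  moreover have "\<iota> x * contract \<psi> u = tsum (\<lambda>a b. \<psi> b *\<^sub>C (\<iota> x * a)) (coproduct.tensor u)"
    unfolding contract_def using tsum_clinear [OF clinear_mult_left [of "\<iota> x"], of "\<lambda>a b. \<psi> b *\<^sub>C a" "coproduct.tensor u"]
    by (simp add: scaleC_mult_right)
  ultimately show ?thesis
    using contract_eq [OF \<psi> coproduct.represents_mult [OF coproduct.represents_\<iota> coproduct.represents_tensor], of x u]
    by (simp add: tsum_tmul coproduct_gen_def contract_def)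
qed

text \<open>In the coproduct of a product of n elements, only the term with 1 on the right has all n
  factors on the left.\<close>

lemma contract_filtration:
  assumes "clinear \<psi>"
  shows "contract \<psi> (iprod xs) - \<psi> 1 *\<^sub>C iprod xs \<in> filtration_less (length xs)"
  using assms
proof (induction xs arbitrary: \<psi>)
  case Nil
  then show ?case by (simp add: contract_1)
next
  case (Cons x xs)
  let ?\<psi> = "\<lambda>v. \<psi> (\<iota> x * v)"
  have \<psi>': "clinear ?\<psi>"
    using Cons.prems by (simp add: clinear_def distrib_left scaleC_mult_right)
  have "contract \<psi> (\<iota> x * iprod xs) - \<psi> 1 *\<^sub>C (\<iota> x * iprod xs) =
      \<iota> x * (contract \<psi> (iprod xs) - \<psi> 1 *\<^sub>C iprod xs) +
      ((contract ?\<psi> (iprod xs) - ?\<psi> 1 *\<^sub>C iprod xs) + ?\<psi> 1 *\<^sub>C iprod xs)"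
    by (simp add: contract_mult [OF Cons.prems] algebra_simps scaleC_mult_right)
  moreover have "\<dots> \<in> filtration_less (Suc (length xs))"
    using Cons.IH [OF Cons.prems] Cons.IH [OF \<psi>']
    by (intro filtration_add filtration_\<iota>_mult filtration_scale filtration_iprod)
      (auto intro: filtration_mono [of "length xs"])
  ultimately show ?case by simp
qed

lemma contract_lower:
  assumes "clinear \<psi>" "\<psi> 1 = 0" "u \<in> filtration_less (Suc n)"
  shows "contract \<psi> u \<in> filtration_less n"
  unfolding filtration_less_def
proof (rule clinear_span_image [OF clinear_contract [OF assms(1)] _ assms(3) [unfolded filtration_less_def]])
  fix u :: "'a uea" assume "u \<in> {iprod xs | xs. length xs < Suc n}"
  then obtain xs where "u = iprod xs" "length xs \<le> n" by auto
  then have "contract \<psi> u \<in> filtration_less n"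
    using contract_filtration [OF assms(1), of xs] filtration_mono [of "length xs" n] assms(2) by simp
  then show "contract \<psi> u \<in> cvec.span {iprod xs | xs. length xs < n}"
    by (simp add: filtration_less_def)
qed

context ordered_lie_basis
begin

text \<open>In an ordered word the copies of \<open>x\<close> are adjacent, so deleting any of them gives the same word.\<close>

lemma contract_iprod:
  assumes "clinear \<psi>" "\<psi> 1 = 0" "\<And>y. y \<in> set T \<Longrightarrow> \<psi> (\<iota> y) = (if y = x then 1 else 0)" "ordered T"
  shows "contract \<psi> (iprod T) - of_nat (count (mset T) x) *\<^sub>C iprod (remove1 x T) \<in> filtration_less (length T - 1)"
  using assms
proof (induction T)
  case Nil
  then show ?case by (simp add: contract_1)
next
  case (Cons y U)
  let ?\<psi> = "\<lambda>v. \<psi> (\<iota> y * v)"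
  have \<psi>': "clinear ?\<psi>"
    using Cons.prems by (simp add: clinear_def distrib_left scaleC_mult_right)
  have U: "ordered U" using Cons.prems by (simp add: ordered_Cons)
  have IH: "contract \<psi> (iprod U) - of_nat (count (mset U) x) *\<^sub>C iprod (remove1 x U) \<in> filtration_less (length U - 1)"
    using Cons U by simp
  have y: "contract ?\<psi> (iprod U) - \<psi> (\<iota> y) *\<^sub>C iprod U \<in> filtration_less (length U)"
    using contract_filtration [OF \<psi>', of U] by simp
  \<comment> \<open>For empty U the truncated bound \<open>length U - 1\<close> is not below
    \<open>length U\<close>; but then everything vanishes, because
    \<open>\<psi> 1 = 0\<close>.\<close>
  have low: "\<iota> y * (contract \<psi> (iprod U) - of_nat (count (mset U) x) *\<^sub>C iprod (remove1 x U)) \<in> filtration_less (length U)"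
  proof (cases U)
    case Nil
    then show ?thesis using Cons.prems by (simp add: contract_1)
  next
    case (Cons z V)
    then show ?thesis using filtration_\<iota>_mult [OF IH, of y] by simp
  qed
  have "contract \<psi> (iprod (y # U)) - of_nat (count (mset (y # U)) x) *\<^sub>C iprod (remove1 x (y # U)) =
      \<iota> y * (contract \<psi> (iprod U) - of_nat (count (mset U) x) *\<^sub>C iprod (remove1 x U)) +
      (contract ?\<psi> (iprod U) - \<psi> (\<iota> y) *\<^sub>C iprod U)"
  proof (cases "y = x")
    case True
    then have \<psi>x: "\<psi> (\<iota> x) = 1" using Cons.prems(3) [of y] by simp
    have "of_nat (count (mset U) x) *\<^sub>C (\<iota> x * iprod (remove1 x U)) = of_nat (count (mset U) x) *\<^sub>C iprod U"
    proof (cases "x \<in> set U")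
      case x: True
      then obtain z V where zV: "U = z # V" by (cases U) auto
      have "z = x"
        using Cons.prems(4) x True le_antisym by (auto simp: zV ordered_Cons)
      then show ?thesis by (simp add: zV)
    next
      case False
      then have "count (mset U) x = 0" by (simp add: count_eq_zero_iff)
      then show ?thesis by simp
    qed
    then show ?thesis
      by (simp add: True \<psi>x contract_mult [OF Cons.prems(1)] scaleC_add_left scaleC_one algebra_simps
          scaleC_mult_right)
  next
    case False
    then have "\<psi> (\<iota> y) = 0" using Cons.prems(3) [of y] by simp
    then show ?thesis using False
      by (simp add: contract_mult [OF Cons.prems(1)] algebra_simps scaleC_mult_right)
  qed
  then show ?case using filtration_add [OF low y] by simp
qed

end

section \<open>The integral form and the coproduct\<close>

lemma zscale_eq_scaleC: "zscale k v = of_int k *\<^sub>C (v::'v::complex_vector)"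
proof (induction k rule: int_induct [where k = 0])
  case (step1 i)
  then show ?case by (simp only: zscale_plus_1 of_int_add of_int_1 scaleC_add_left scaleC_one)
next
  case (step2 i)
  then show ?case
    by (simp only: zscale_minus_1 of_int_diff of_int_1 cvec.scale_left_diff_distrib scaleC_one)
qed simp

lemma is_subringD:
  assumes "is_subring T"
  shows "1 \<in> T" "0 \<in> T" "x \<in> T \<Longrightarrow> y \<in> T \<Longrightarrow> x - y \<in> T" "x \<in> T \<Longrightarrow> y \<in> T \<Longrightarrow> x * y \<in> T"
    "x \<in> T \<Longrightarrow> - x \<in> T" "x \<in> T \<Longrightarrow> y \<in> T \<Longrightarrow> x + y \<in> T"
proof -
  show 1: "1 \<in> T" and d: "x \<in> T \<Longrightarrow> y \<in> T \<Longrightarrow> x - y \<in> T" "x \<in> T \<Longrightarrow> y \<in> T \<Longrightarrow> x * y \<in> T" for x y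
    using assms by (auto simp: is_subring_def)
  show 0: "0 \<in> T" using d(1) [OF 1 1] by simp
  show m: "x \<in> T \<Longrightarrow> - x \<in> T" for x using d(1) [OF 0, of x] by simp
  show "x \<in> T \<Longrightarrow> y \<in> T \<Longrightarrow> x + y \<in> T" using d(1) [of x "- y"] m [of y] by simp
qed

lemma subring_zscale: "is_subring T \<Longrightarrow> x \<in> T \<Longrightarrow> zscale k x \<in> T"
  by (induction k rule: int_induct [where k = 0])
    (simp_all add: zscale_plus_1 zscale_minus_1 is_subringD)

lemma subring_zspan:
  assumes "is_subring T" "A \<subseteq> T"
  shows "zmod.span A \<subseteq> T"
  using assms by (intro zmod.span_minimal) (auto simp: zmod.subspace_def is_subringD subring_zscale)

text \<open>The divided powers and the binomials of \<open>\<iota> x\<close> are the cases \<open>\<kappa> = 0\<close> and \<open>\<kappa> = 1\<close>.\<close>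

definition binomial_sequence :: "'g::complex_lie_algebra \<Rightarrow> int \<Rightarrow> (nat \<Rightarrow> 'g uea) \<Rightarrow> bool" where
  "binomial_sequence x \<kappa> q \<longleftrightarrow> q 0 = 1 \<and>
    (\<forall>n. of_nat (Suc n) *\<^sub>C q (Suc n) = q n * (\<iota> x - of_int (int n * \<kappa>) *\<^sub>C 1))"

lemma binomial_sequence_divided_power: "binomial_sequence x 0 (divided_power (\<iota> x))"
proof -
  have "of_nat (Suc n) *\<^sub>C divided_power (\<iota> x) (Suc n) = divided_power (\<iota> x) n * \<iota> x" for n
  proof -
    have "of_nat (Suc n) / (fact (Suc n) :: complex) = 1 / fact n"
      by (simp add: field_simps del: of_nat_Suc)
    then show ?thesis
      by (simp add: divided_power_def scaleC_scaleC scaleC_mult_left power_commutes del: of_nat_Suc)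
  qed
  then show ?thesis by (simp add: binomial_sequence_def divided_power_def scaleC_one)
qed

lemma of_nat_uea: "of_nat n = of_nat n *\<^sub>C (1 :: 'u::complex_algebra)"
  by (induction n) (simp_all add: scaleC_add_left scaleC_one)

lemma binomial_sequence_binomial: "binomial_sequence x 1 (alg_binomial (\<iota> x))"
proof -
  have "of_nat (Suc n) *\<^sub>C alg_binomial (\<iota> x) (Suc n) = alg_binomial (\<iota> x) n * (\<iota> x - of_nat n *\<^sub>C 1)" for n
  proof -
    have "of_nat (Suc n) / (fact (Suc n) :: complex) = 1 / fact n"
      by (simp add: field_simps del: of_nat_Suc)
    then show ?thesis
      by (simp add: alg_binomial_def scaleC_scaleC scaleC_mult_left of_nat_uea [symmetric] del: of_nat_Suc)
  qed
  then show ?thesis by (simp add: binomial_sequence_def alg_binomial_def scaleC_one)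
qed

lemma binomial_sequence_Suc:
  assumes "binomial_sequence x \<kappa> q"
  shows "q (Suc n) = (1 / of_nat (Suc n)) *\<^sub>C (q n * (\<iota> x - of_int (int n * \<kappa>) *\<^sub>C 1))"
proof -
  have "(1 / of_nat (Suc n)) *\<^sub>C of_nat (Suc n) *\<^sub>C q (Suc n) = q (Suc n)"
    by (simp add: scaleC_scaleC scaleC_one del: of_nat_Suc)
  then show ?thesis using assms unfolding binomial_sequence_def by metis
qed

text \<open>Both sums are extended to i \<le> n + 1, where the weights i and n + 1 - i add up to n +
  1.\<close>

lemma binomial_sum_identity:
  fixes b :: "nat \<Rightarrow> nat \<Rightarrow> 'v::complex_vector"
  shows "(\<Sum>i\<le>n. of_nat (Suc i) *\<^sub>C b (Suc i) (n - i) + of_nat (Suc (n - i)) *\<^sub>C b i (Suc (n - i))) =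
    of_nat (Suc n) *\<^sub>C (\<Sum>i\<le>Suc n. b i (Suc n - i))"
proof -
  have "(\<Sum>i\<le>n. of_nat (Suc i) *\<^sub>C b (Suc i) (n - i)) = (\<Sum>i\<le>Suc n. of_nat i *\<^sub>C b i (Suc n - i))"
    by (subst sum.atMost_Suc_shift) simp
  moreover have "(\<Sum>i\<le>n. of_nat (Suc (n - i)) *\<^sub>C b i (Suc (n - i))) =
      (\<Sum>i\<le>Suc n. of_nat (Suc n - i) *\<^sub>C b i (Suc n - i))"
  proof -
    have "(\<Sum>i\<le>n. of_nat (Suc (n - i)) *\<^sub>C b i (Suc (n - i))) =
        (\<Sum>i\<le>n. of_nat (Suc n - i) *\<^sub>C b i (Suc n - i))"
      by (intro sum.cong HOL.refl) (simp only: atMost_iff Suc_diff_le)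
    then show ?thesis by simp
  qed
  moreover have "of_nat i *\<^sub>C b i (Suc n - i) + of_nat (Suc n - i) *\<^sub>C b i (Suc n - i) =
      of_nat (Suc n) *\<^sub>C b i (Suc n - i)" if "i \<le> Suc n" for i
    using that by (simp add: scaleC_add_left [symmetric] of_nat_diff del: of_nat_Suc)
  then have "(\<Sum>i\<le>Suc n. of_nat i *\<^sub>C b i (Suc n - i) + of_nat (Suc n - i) *\<^sub>C b i (Suc n - i)) =
      of_nat (Suc n) *\<^sub>C (\<Sum>i\<le>Suc n. b i (Suc n - i))"
    unfolding cvec.scale_sum_right by (intro sum.cong HOL.refl) (simp only: atMost_iff)
  ultimately show ?thesis by (simp only: sum.distrib)
qed

lemma tsum_upt: "tsum \<beta> (map (\<lambda>i. (f i, h i)) [0..<Suc n]) = (\<Sum>i\<le>n. \<beta> (f i) (h i))"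
  by (induction n) (simp_all add: add.commute)

text \<open>A form of Vandermonde's identity. Up to a scalar, q (n + 1) is q n times \<iota> x - n
  \<kappa>; on the i-th tensor the shift splits as i \<kappa> + (n - i) \<kappa>, one part for the
  recursion of each factor.\<close>

lemma binomial_sequence_coproduct:
  assumes q: "binomial_sequence x \<kappa> q"
  shows "coproduct.represents (q n) (map (\<lambda>i. (q i, q (n - i))) [0..<Suc n])"
proof (induction n)
  case 0
  then show ?case using q coproduct.represents_1 by (simp add: binomial_sequence_def)
next
  case (Suc n)
  let ?L = "map (\<lambda>i. (q i, q (n - i))) [0..<Suc n]"
  let ?h = "of_int (int n * \<kappa>) :: complex"
  have qS: "q i * \<iota> x = of_nat (Suc i) *\<^sub>C q (Suc i) + of_int (int i * \<kappa>) *\<^sub>C q i" for i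
    using q by (simp add: binomial_sequence_def right_diff_distrib scaleC_mult_right del: of_nat_Suc)
  have "coproduct.represents (\<iota> x - ?h *\<^sub>C 1)
      (coproduct_gen x @ tscale (*\<^sub>C) (-1) (tscale (*\<^sub>C) ?h [(1, 1)]))"
    by (intro coproduct.represents_diff coproduct.represents_scale coproduct.represents_\<iota> coproduct.represents_1)
  from coproduct.represents_scale [OF coproduct.represents_mult [OF Suc this], of "1 / of_nat (Suc n)"]
  have "coproduct.represents (q (Suc n)) (tscale (*\<^sub>C) (1 / of_nat (Suc n))
      (tmul (*) (*) ?L (coproduct_gen x @ tscale (*\<^sub>C) (-1) (tscale (*\<^sub>C) ?h [(1, 1)]))))"
    by (simp only: binomial_sequence_Suc [OF q])
  then show ?case
  proof (rule coproduct.represents_equiv)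
    show "coproduct.equiv (tscale (*\<^sub>C) (1 / of_nat (Suc n))
        (tmul (*) (*) ?L (coproduct_gen x @ tscale (*\<^sub>C) (-1) (tscale (*\<^sub>C) ?h [(1, 1)]))))
        (map (\<lambda>i. (q i, q (Suc n - i))) [0..<Suc (Suc n)])"
      unfolding coproduct.equiv_def
    proof
      fix \<beta> :: "'a uea \<Rightarrow> 'a uea \<Rightarrow> 'a uea" assume "\<beta> \<in> bilinear_maps"
      note \<beta> = bilinear_mapsD [OF this]
      let ?b = "\<lambda>i j. \<beta> (q i) (q j)"
      have "\<beta> (q i * \<iota> x) (q (n - i)) + \<beta> (q i) (q (n - i) * \<iota> x) - ?h *\<^sub>C ?b i (n - i) =
          of_nat (Suc i) *\<^sub>C ?b (Suc i) (n - i) + of_nat (Suc (n - i)) *\<^sub>C ?b i (Suc (n - i))"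
        if "i \<le> n" for i
      proof -
        have "of_int (int i * \<kappa>) *\<^sub>C ?b i (n - i) + of_int (int (n - i) * \<kappa>) *\<^sub>C ?b i (n - i) = ?h *\<^sub>C ?b i (n - i)"
          using that by (simp only: scaleC_add_left [symmetric] of_int_add [symmetric] distrib_right [symmetric])
            simp
        then show ?thesis
          unfolding qS \<beta> by (simp add: algebra_simps del: of_nat_Suc)
      qed
      then have "(\<Sum>i\<le>n. \<beta> (q i * \<iota> x) (q (n - i)) + \<beta> (q i) (q (n - i) * \<iota> x) - ?h *\<^sub>C ?b i (n - i)) =
          of_nat (Suc n) *\<^sub>C (\<Sum>i\<le>Suc n. ?b i (Suc n - i))"
        using binomial_sum_identity [of ?b n] by simp
      moreover have "tsum \<beta> (tscale (*\<^sub>C) (1 / of_nat (Suc n))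
          (tmul (*) (*) ?L (coproduct_gen x @ tscale (*\<^sub>C) (-1) (tscale (*\<^sub>C) ?h [(1, 1)])))) =
          (1 / of_nat (Suc n)) *\<^sub>C
          (\<Sum>i\<le>n. \<beta> (q i * \<iota> x) (q (n - i)) + \<beta> (q i) (q (n - i) * \<iota> x) - ?h *\<^sub>C ?b i (n - i))"
        unfolding coproduct.tsum_tscale tsum_tmul tsum_upt
        by (simp add: coproduct_gen_def \<beta> scaleC_mult_right cvec.scale_sum_right cvec.scale_right_diff_distrib
            scaleC_add_right add.assoc add_diff_eq del: of_nat_Suc)
      ultimately show "tsum \<beta> (tscale (*\<^sub>C) (1 / of_nat (Suc n))
          (tmul (*) (*) ?L (coproduct_gen x @ tscale (*\<^sub>C) (-1) (tscale (*\<^sub>C) ?h [(1, 1)])))) =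
          tsum \<beta> (map (\<lambda>i. (q i, q (Suc n - i))) [0..<Suc (Suc n)])"
        unfolding tsum_upt by (simp add: scaleC_scaleC scaleC_one del: of_nat_Suc sum.atMost_Suc)
    qed
  qed
qed

definition U_gens :: "('i, 'y) SGR \<Rightarrow> (('i, 'y) km_gen \<Rightarrow> 'g::complex_lie_algebra) \<Rightarrow> 'g uea set" where
  "U_gens S \<phi> = {divided_power (\<iota> (\<phi> (GenE i))) n | i n. i \<in> idx S} \<union>
      {divided_power (\<iota> (\<phi> (GenF i))) n | i n. i \<in> idx S} \<union>
      {alg_binomial (\<iota> (\<phi> (GenH y))) n | y n. True}"

lemma U_int_gens: "u \<in> U_gens S \<phi> \<Longrightarrow> u \<in> U_int S \<phi>"
  unfolding U_int_def U_gens_def by (rule hull_inc)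

lemma U_int_subring: "is_subring (U_int S \<phi>)"
  unfolding U_int_def by (rule hull_in) (auto simp: is_subring_def)

lemma U_int_minimal: "is_subring T \<Longrightarrow> U_gens S \<phi> \<subseteq> T \<Longrightarrow> U_int S \<phi> \<subseteq> T"
  unfolding U_int_def U_gens_def by (rule hull_minimal)

text \<open>A generator is delivered together with the sequence it belongs to, since its coproduct
  involves all earlier members.\<close>

lemma U_gens_cases:
  assumes "u \<in> U_gens S \<phi>"
  obtains (E_F) X q n where "X \<in> km_gens S" "binomial_sequence (\<phi> X) 0 q" "u = q n" "range q \<subseteq> U_gens S \<phi>"
  | (H) y q n where "binomial_sequence (\<phi> (GenH y)) 1 q" "u = q n" "range q \<subseteq> U_gens S \<phi>"
  using assms unfolding U_gens_def
proof (elim UnE CollectE exE conjE)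
  fix i n assume "u = divided_power (\<iota> (\<phi> (GenE i))) n" "i \<in> idx S"
  then show ?thesis
    by (intro E_F [of "GenE i" "divided_power (\<iota> (\<phi> (GenE i)))" n])
      (auto simp: km_gens_def U_gens_def binomial_sequence_divided_power)
next
  fix i n assume "u = divided_power (\<iota> (\<phi> (GenF i))) n" "i \<in> idx S"
  then show ?thesis
    by (intro E_F [of "GenF i" "divided_power (\<iota> (\<phi> (GenF i)))" n])
      (auto simp: km_gens_def U_gens_def binomial_sequence_divided_power)
next
  fix y n assume "u = alg_binomial (\<iota> (\<phi> (GenH y))) n"
  then show ?thesis
    by (intro H [of y "alg_binomial (\<iota> (\<phi> (GenH y)))" n])
      (auto simp: U_gens_def binomial_sequence_binomial)
qed

text \<open>The elements whose coproduct can be written with entries in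
  \<open>U_int S \<phi>\<close> form a subring, and \<open>binomial_sequence_coproduct\<close> puts
  the generators into it.\<close>

lemma U_int_coproduct:
  assumes "u \<in> U_int S \<phi>"
  obtains l where "coproduct.represents u l" "set l \<subseteq> U_int S \<phi> \<times> U_int S \<phi>"
proof -
  let ?U = "U_int S \<phi>"
  let ?T = "{u. \<exists>l. coproduct.represents u l \<and> set l \<subseteq> ?U \<times> ?U}"
  note [simp] = is_subringD [OF U_int_subring]
  have "is_subring ?T"
    unfolding is_subring_def
  proof (intro conjI ballI)
    show "1 \<in> ?T" using coproduct.represents_1 by (auto intro!: exI [of _ "[(1, 1)]"])
    fix u v assume "u \<in> ?T" "v \<in> ?T"
    then obtain l k where l: "coproduct.represents u l" "set l \<subseteq> ?U \<times> ?U"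
      and k: "coproduct.represents v k" "set k \<subseteq> ?U \<times> ?U" by blast
    have "set (l @ tscale (*\<^sub>C) (-1) k) \<subseteq> ?U \<times> ?U"
      using l(2) k(2) by (auto simp: cvec.scale_minus_left scaleC_one)
    then show "u - v \<in> ?T" using coproduct.represents_diff [OF l(1) k(1)] by blast
    have "set (tmul (*) (*) l k) \<subseteq> ?U \<times> ?U"
      unfolding set_tmul using l(2) k(2) by (auto intro!: is_subringD(4) [OF U_int_subring])
    then show "u * v \<in> ?T" using coproduct.represents_mult [OF l(1) k(1)] by blast
  qed
  moreover have *: "q n \<in> ?T" if "binomial_sequence x \<kappa> q" "range q \<subseteq> U_gens S \<phi>" for x \<kappa> q n
  proof -
    have "q i \<in> ?U" for i using that(2) U_int_gens by blast
    then have "set (map (\<lambda>i. (q i, q (n - i))) [0..<Suc n]) \<subseteq> ?U \<times> ?U" by auto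
    then show ?thesis using binomial_sequence_coproduct [OF that(1), of n] by blast
  qed
  have "U_gens S \<phi> \<subseteq> ?T"
  proof
    fix u assume "u \<in> U_gens S \<phi>"
    then show "u \<in> ?T" by (cases rule: U_gens_cases) (simp_all only: *)
  qed
  ultimately have "u \<in> ?T" using assms U_int_minimal by blast
  then show ?thesis using that by blast
qed

section \<open>The counit\<close>

definition counit :: "'g::complex_lie_algebra uea \<Rightarrow> complex" where
  "counit u = ueval (\<lambda>_. 0) (rep_uea u)"

lemma counit_term: "counit (abs_uea t) = ueval (\<lambda>_. 0) t"
proof -
  have "uea_cong (rep_uea (abs_uea t)) t" by (simp add: uea_cong_iff abs_rep_uea)
  from uea_cong_sound [OF this, of "\<lambda>_. 0 :: complex"]
  show ?thesis by (simp add: counit_def)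
qed

lemma counit_simps [simp]:
  "counit (u + v) = counit u + counit v" "counit (c *\<^sub>C u) = c * counit u" "counit (u * v) = counit u * counit v"
  "counit 1 = 1" "counit (\<iota> x) = 0"
  using counit_term [of "UAdd (rep_uea u) (rep_uea v)"] counit_term [of "UScale c (rep_uea u)"]
    counit_term [of "UMul (rep_uea u) (rep_uea v)"] counit_term [of UOne] counit_term [of "UGen x"]
  by (simp_all add: plus_uea.abs_eq [symmetric] scaleC_uea.abs_eq [symmetric] times_uea.abs_eq [symmetric]
      one_uea.abs_eq [symmetric] \<iota>.abs_eq [symmetric] abs_rep_uea counit_def [symmetric] scaleC_complex_def)

lemma clinear_counit: "clinear counit"
  by (simp add: clinear_def scaleC_complex_def)

lemma counit_binomial_sequence: "binomial_sequence x \<kappa> q \<Longrightarrow> counit (q n) = (if n = 0 then 1 else 0)"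
proof (induction n)
  case (Suc n)
  then show ?case
    by (cases n) (simp_all add: binomial_sequence_Suc [of x \<kappa> q] clinear_diff [OF clinear_counit] del: of_nat_Suc)
qed (simp add: binomial_sequence_def)

text \<open>On the generators the counit is 0 or 1. Its integrality settles degree zero and splits
  off multiples of 1.\<close>

lemma counit_U_int: "u \<in> U_int S \<phi> \<Longrightarrow> counit u \<in> \<int>"
proof -
  assume u: "u \<in> U_int S \<phi>"
  have "U_int S \<phi> \<subseteq> {u. counit u \<in> \<int>}"
  proof (rule U_int_minimal)
    show "is_subring {u. counit u \<in> \<int>}"
      by (simp add: is_subring_def clinear_diff [OF clinear_counit])
    show "U_gens S \<phi> \<subseteq> {u. counit u \<in> \<int>}"
    proof
      fix u assume "u \<in> U_gens S \<phi>"
      then show "u \<in> {u. counit u \<in> \<int>}"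
        by (cases rule: U_gens_cases) (simp_all add: counit_binomial_sequence)
    qed
  qed
  with u show ?thesis by blast
qed

section \<open>The grading and the rational form\<close>

type_synonym 'i weight = "'i \<Rightarrow>\<^sub>0 int"

fun km_degree :: "('i, 'y) km_gen \<Rightarrow> 'i weight" where
  "km_degree (GenE i) = simple_root i"
| "km_degree (GenF i) = - simple_root i"
| "km_degree (GenH y) = 0"

text \<open>A pair (c, \<alpha>) is the monomial of degree \<alpha> with coefficient c in the group
  ring of the root lattice.\<close>

abbreviation gmul :: "complex \<times> 'i weight \<Rightarrow> complex \<times> 'i weight \<Rightarrow> complex \<times> 'i weight" where
  "gmul \<equiv> \<lambda>a b. (fst a * fst b, snd a + snd b)"

abbreviation gscale :: "complex \<Rightarrow> complex \<times> 'i weight \<Rightarrow> complex \<times> 'i weight" where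
  "gscale c a \<equiv> (c * fst a, snd a)"

text \<open>A pair \<open>((c, \<alpha>), x)\<close> stands for \<open>c \<otimes> x\<close> in degree \<open>\<alpha>\<close>, where the tensor product is taken over
  the integers: the functionals are only additive in \<open>c\<close>.\<close>

definition graded_maps :: "(complex \<times> 'i weight \<Rightarrow> 'a::complex_vector \<Rightarrow> 'v::complex_vector) set" where
  "graded_maps = {\<beta>. (\<forall>c d \<alpha> u. \<beta> (c + d, \<alpha>) u = \<beta> (c, \<alpha>) u + \<beta> (d, \<alpha>) u) \<and> (\<forall>m. clinear (\<beta> m))}"

lemma graded_mapsD:
  assumes "\<beta> \<in> graded_maps"
  shows "\<beta> (c + d, \<alpha>) u = \<beta> (c, \<alpha>) u + \<beta> (d, \<alpha>) u" "\<beta> m (u + v) = \<beta> m u + \<beta> m v"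
    "\<beta> m (k *\<^sub>C u) = k *\<^sub>C \<beta> m u" "\<beta> m 0 = 0" "\<beta> m (- u) = - \<beta> m u" "\<beta> m (u - v) = \<beta> m u - \<beta> m v"
    "\<beta> (- c, \<alpha>) u = - \<beta> (c, \<alpha>) u"
proof -
  show 1: "\<beta> (c + d, \<alpha>) u = \<beta> (c, \<alpha>) u + \<beta> (d, \<alpha>) u" for c d
    using assms by (simp add: graded_maps_def)
  have "clinear (\<beta> m)" using assms by (cases m) (simp add: graded_maps_def)
  then show "\<beta> m (u + v) = \<beta> m u + \<beta> m v" "\<beta> m (k *\<^sub>C u) = k *\<^sub>C \<beta> m u" "\<beta> m 0 = 0"
    "\<beta> m (- u) = - \<beta> m u" "\<beta> m (u - v) = \<beta> m u - \<beta> m v"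
    by (simp_all add: clinear_add clinear_scale clinear_0 clinear_minus clinear_diff)
  have "\<beta> (0, \<alpha>) u = 0" using 1 [of 0 0] by simp
  then have "\<beta> (- c, \<alpha>) u + \<beta> (c, \<alpha>) u = 0" using 1 [of "- c" c] by simp
  then show "\<beta> (- c, \<alpha>) u = - \<beta> (c, \<alpha>) u" by (simp add: eq_neg_iff_add_eq_0)
qed

lemma graded_maps_int:
  assumes "\<beta> \<in> graded_maps"
  shows "\<beta> (of_int k * c, \<alpha>) u = of_int k *\<^sub>C \<beta> (c, \<alpha>) u"
proof (induction k rule: int_induct [where k = 0])
  case base
  then show ?case using graded_mapsD(1) [OF assms, of 0 0] by simp
next
  case (step1 i)
  have "of_int (i + 1) * c = of_int i * c + c" by (simp add: distrib_right)
  then show ?case using step1 by (simp only: graded_mapsD(1) [OF assms]) (simp add: scaleC_add_left scaleC_one)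
next
  case (step2 i)
  have "of_int (i - 1) * c = of_int i * c + - c" by (simp add: left_diff_distrib)
  then show ?case using step2
    by (simp only: graded_mapsD(1,7) [OF assms]) (simp add: cvec.scale_left_diff_distrib scaleC_one)
qed

lemma clinear_lie_br: "clinear (lie_br x)" "clinear (\<lambda>x. lie_br x y)"
  by (simp_all add: clinear_def lie_br_add_left lie_br_add_right lie_br_scale_left lie_br_scale_right)

lemma graded_maps_lie_left: "\<beta> \<in> graded_maps \<Longrightarrow> (\<lambda>m z. \<beta> (gmul a m) (lie_br w z)) \<in> graded_maps"
  and graded_maps_lie_right: "\<beta> \<in> graded_maps \<Longrightarrow> (\<lambda>m z. \<beta> (gmul m a) (lie_br z w)) \<in> graded_maps"
  and graded_maps_scale: "\<beta> \<in> graded_maps \<Longrightarrow> (\<lambda>m z. \<beta> (gscale c m) z) \<in> graded_maps"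
  by (simp_all add: graded_maps_def clinear_def distrib_left distrib_right
      lie_br_add_left lie_br_add_right lie_br_scale_left lie_br_scale_right)

text \<open>Scalars and degrees are collected in the left factors, while each right factor is an
  iterated bracket of generators.\<close>

primrec gexpand :: "(('i, 'y) km_gen \<Rightarrow> 'g::complex_lie_algebra) \<Rightarrow> ('i, 'y) km_gen lterm \<Rightarrow>
    ((complex \<times> 'i weight) \<times> 'g) list" where
  "gexpand \<phi> (LGen X) = [((1, km_degree X), \<phi> X)]"
| "gexpand \<phi> LZero = []"
| "gexpand \<phi> (LAdd s t) = gexpand \<phi> s @ gexpand \<phi> t"
| "gexpand \<phi> (LScale c t) = tscale gscale c (gexpand \<phi> t)"
| "gexpand \<phi> (LBr s t) = tmul gmul lie_br (gexpand \<phi> s) (gexpand \<phi> t)"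

lemma tsum_gscale: "tsum \<beta> (tscale gscale c l) = tsum (\<lambda>m u. \<beta> (gscale c m) u) l"
  using tsum_map [of \<beta> "\<lambda>m u. gscale c m" "\<lambda>m u. u" l] by simp

lemma tsum_minus: "tsum (\<lambda>m u. - \<beta> m u) l = - tsum \<beta> l"
  by (induction l) (auto simp: tsum_Cons)

text \<open>Brings the three cyclic terms of the Jacobi identity under the same order of
  summation.\<close>

lemma tsum_rotate:
  "tsum (\<lambda>b y. tsum (\<lambda>c z. tsum (\<lambda>a x. f a x b y c z) ls) lu) lt =
   tsum (\<lambda>a x. tsum (\<lambda>b y. tsum (\<lambda>c z. f a x b y c z) lu) lt) ls"
proof -
  have "tsum (\<lambda>b y. tsum (\<lambda>c z. tsum (\<lambda>a x. f a x b y c z) ls) lu) lt =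
      tsum (\<lambda>b y. tsum (\<lambda>a x. tsum (\<lambda>c z. f a x b y c z) lu) ls) lt"
    by (rule tsum_cong) (rule tsum_swap)
  also have "\<dots> = tsum (\<lambda>a x. tsum (\<lambda>b y. tsum (\<lambda>c z. f a x b y c z) lu) lt) ls"
    by (rule tsum_swap)
  finally show ?thesis .
qed

text \<open>A Serre term expands to a single pair with coefficient 1, so it is killed as soon as its
  value in the Lie algebra is zero.\<close>

lemma gexpand_funpow:
  "\<exists>\<alpha>. gexpand \<phi> ((LBr (LGen X) ^^ n) (LGen Y)) = [((1, \<alpha>), leval \<phi> ((LBr (LGen X) ^^ n) (LGen Y)))]"
proof (induction n)
  case (Suc n)
  then obtain \<alpha> where "gexpand \<phi> ((LBr (LGen X) ^^ n) (LGen Y)) =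
      [((1, \<alpha>), leval \<phi> ((LBr (LGen X) ^^ n) (LGen Y)))]" by blast
  then show ?case by (intro exI [of _ "km_degree X + \<alpha>"]) (simp add: tmul_def)
qed simp

text \<open>The integrality of the coefficients in the relations enters here: a functional that is
  merely additive in c still commutes with integers and so moves \<open>root_bar S i y\<close>
  across the tensor sign.\<close>

lemma gexpand_rel:
  assumes R: "km_rel S s t" and ev: "leval \<phi> s = leval \<phi> t" and \<beta>: "\<beta> \<in> graded_maps"
  shows "tsum \<beta> (gexpand \<phi> s) = tsum \<beta> (gexpand \<phi> t)"
  using R ev
proof (cases rule: km_rel.cases)
  case (H_add y y')
  then show ?thesis using ev graded_mapsD(2) [OF \<beta>] by simp
next
  case (H_H y y')
  then show ?thesis using ev graded_mapsD(4) [OF \<beta>] by (simp add: tmul_def)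
next
  case (H_E i y)
  then show ?thesis using ev graded_maps_int [OF \<beta>, of "root_bar S i y" 1] graded_mapsD(3) [OF \<beta>]
    by (simp add: tmul_def)
next
  case (H_F i y)
  then show ?thesis using ev graded_maps_int [OF \<beta>, of "- root_bar S i y" 1] graded_mapsD(3,5) [OF \<beta>]
    by (simp add: tmul_def)
next
  case (E_F i)
  then show ?thesis using ev graded_mapsD(5,7) [OF \<beta>] by (simp add: tmul_def)
next
  case (E_F_neq i j)
  then show ?thesis using ev graded_mapsD(4) [OF \<beta>] by (simp add: tmul_def)
next
  case (serre_E i j)
  then show ?thesis using ev graded_mapsD(4) [OF \<beta>]
      gexpand_funpow [of \<phi> "nat (1 - cartan S i j)" "GenE i" "GenE j"] by auto
next
  case (serre_F i j)
  then show ?thesis using ev graded_mapsD(4) [OF \<beta>]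
      gexpand_funpow [of \<phi> "nat (1 - cartan S i j)" "GenF i" "GenF j"] by auto
qed

text \<open>Exchanging the summations and antisymmetry show that the value equals its negative, and
  the target is a complex vector space.\<close>

lemma tsum_br_self:
  assumes \<beta>: "\<beta> \<in> graded_maps"
  shows "tsum \<beta> (tmul gmul lie_br l l) = 0"
proof -
  let ?X = "tsum \<beta> (tmul gmul lie_br l l)"
  have "?X = tsum (\<lambda>m' u'. tsum (\<lambda>m u. \<beta> (gmul m m') (lie_br u u')) l) l"
    unfolding tsum_tmul by (rule tsum_swap)
  also have "\<dots> = tsum (\<lambda>m' u'. tsum (\<lambda>m u. - \<beta> (gmul m' m) (lie_br u' u)) l) l"
  proof (intro tsum_cong)
    fix m' :: "complex \<times> 'a weight" and u' :: 'b and m :: "complex \<times> 'a weight" and u :: 'b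
    show "\<beta> (gmul m m') (lie_br u u') = - \<beta> (gmul m' m) (lie_br u' u)"
      unfolding lie_br_antisym [of u u']
      by (simp add: graded_mapsD(5) [OF \<beta>] mult.commute add.commute)
  qed
  also have "\<dots> = - ?X"
    unfolding tsum_tmul by (simp add: tsum_minus)
  finally have "?X + ?X = 0" by (simp add: scaleC_one eq_neg_iff_add_eq_0)
  then have "2 *\<^sub>C ?X = 0" by (simp add: scaleC_add_left [of 1 1, simplified] scaleC_one)
  then show ?thesis by simp
qed

text \<open>The functional is kept arbitrary because the congruence rules for scalars and brackets
  replace it by another one of the same class.\<close>

lemma gexpand_cong:
  assumes "lie_cong (km_rel S) s t" and rel: "\<And>s t. km_rel S s t \<Longrightarrow> leval \<phi> s = leval \<phi> t"
    and \<beta>: "\<beta> \<in> graded_maps"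
  shows "tsum \<beta> (gexpand \<phi> s) = tsum \<beta> (gexpand \<phi> t)"
  using assms(1) \<beta>
proof (induction arbitrary: \<beta> rule: lie_cong.induct)
  case (rel s t)
  then show ?case using gexpand_rel assms(2) by blast
next
  case (scale_cong t t' c)
  show ?case
    unfolding gexpand.simps tsum_gscale
    by (rule scale_cong.IH) (rule graded_maps_scale [OF scale_cong.prems])
next
  case (br_cong s s' t t')
  have "tsum \<beta> (gexpand \<phi> (LBr s t)) = tsum \<beta> (gexpand \<phi> (LBr s t'))"
    unfolding gexpand.simps tsum_tmul
    by (rule tsum_cong) (use br_cong.IH(2) graded_maps_lie_left [OF br_cong.prems] in blast)
  also have "\<dots> = tsum \<beta> (gexpand \<phi> (LBr s' t'))"
    unfolding gexpand.simps tsum_tmul tsum_swap [of _ "gexpand \<phi> t'"]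
    by (rule tsum_cong) (use br_cong.IH(1) graded_maps_lie_right [OF br_cong.prems] in blast)
  finally show ?case .
next
  case (add_inverse t)
  have "tsum (\<lambda>m u. \<beta> (gscale (-1) m) u) (gexpand \<phi> t) = tsum (\<lambda>m u. - \<beta> m u) (gexpand \<phi> t)"
    by (rule tsum_cong) (use graded_mapsD(7) [OF add_inverse] in force)
  then show ?case
    unfolding gexpand.simps tsum_simps tsum_gscale by (simp add: tsum_minus)
next
  case (scale_add_left c d t)
  then show ?case
    unfolding gexpand.simps tsum_simps tsum_gscale tsum_add [symmetric]
    by (intro tsum_cong) (simp add: graded_mapsD(1) distrib_right)
next
  case (scale_add_right c s t)
  then show ?case by simp
next
  case (scale_scale c d t)
  then show ?case unfolding gexpand.simps tsum_gscale by (simp add: mult.assoc)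
next
  case (scale_one t)
  then show ?case unfolding gexpand.simps tsum_gscale by simp
next
  case (br_scale_left c s t)
  then show ?case unfolding gexpand.simps tsum_gscale tsum_tmul by (simp add: mult.assoc)
next
  case (br_scale_right c s t)
  then show ?case unfolding gexpand.simps tsum_gscale tsum_tmul by (simp add: mult.left_commute)
next
  case (br_self t)
  then show ?case by (simp add: tsum_br_self)
next
  case (jacobi s t u)
  note \<beta> = graded_mapsD [OF jacobi.prems]
  let ?f = "\<lambda>a x b y c z. \<beta> (gmul a (gmul b c)) (lie_br x (lie_br y z))"
  let ?s = "gexpand \<phi> s" and ?t = "gexpand \<phi> t" and ?u = "gexpand \<phi> u"
  have t: "tsum \<beta> (gexpand \<phi> (LBr t (LBr u s))) =
      tsum (\<lambda>a x. tsum (\<lambda>b y. tsum (\<lambda>c z. ?f b y c z a x) ?u) ?t) ?s"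
    unfolding gexpand.simps tsum_tmul by (rule tsum_rotate)
  have u: "tsum \<beta> (gexpand \<phi> (LBr u (LBr s t))) =
      tsum (\<lambda>a x. tsum (\<lambda>b y. tsum (\<lambda>c z. ?f c z a x b y) ?u) ?t) ?s"
    unfolding gexpand.simps tsum_tmul by (rule HOL.trans [OF tsum_rotate tsum_rotate])
  have "?f a x b y c z + ?f b y c z a x + ?f c z a x b y = 0" for a b c x y z
  proof -
    have "gmul b (gmul c a) = gmul a (gmul b c)" "gmul c (gmul a b) = gmul a (gmul b c)"
      by (simp_all add: mult_ac add_ac)
    then show ?thesis by (simp only: \<beta>(2) [symmetric] lie_jacobi \<beta>(4))
  qed
  then show ?case
    unfolding gexpand.simps(2,3) tsum_simps t u
    unfolding gexpand.simps tsum_tmul tsum_add [symmetric] by (simp only: tsum_0)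
qed (simp_all add: tsum_tmul tsum_add add_ac)

text \<open>Additive maps between rational vector spaces are rational-linear. This admits the
  denominators of the divided powers and binomials.\<close>

lemma graded_maps_rat:
  assumes \<beta>: "\<beta> \<in> graded_maps"
  shows "\<beta> (of_int k / of_nat (Suc n), \<alpha>) u = (of_int k / of_nat (Suc n)) *\<^sub>C \<beta> (1, \<alpha>) u"
proof -
  let ?N = "of_nat (Suc n) :: complex"
  have "\<beta> (1, \<alpha>) u = ?N *\<^sub>C \<beta> (1 / ?N, \<alpha>) u"
    using graded_maps_int [OF \<beta>, of "int (Suc n)" "1 / ?N" \<alpha> u] by (simp del: of_nat_Suc)
  then have "(of_int k / ?N) *\<^sub>C \<beta> (1, \<alpha>) u = of_int k *\<^sub>C \<beta> (1 / ?N, \<alpha>) u"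
    by (simp add: scaleC_scaleC del: of_nat_Suc)
  then show ?thesis
    using graded_maps_int [OF \<beta>, of k "1 / ?N" \<alpha> u] by (simp del: of_nat_Suc)
qed

lemma km_rel_gens: "km_rel S s t \<Longrightarrow> lgens s \<subseteq> km_gens S \<and> lgens t \<subseteq> km_gens S"
proof -
  have "lgens ((LBr (LGen X) ^^ n) (LGen Y)) \<subseteq> {X, Y}" for X Y :: "('a, 'b) km_gen" and n
    by (induction n) auto
  then have *: "lgens ((LBr (LGen X) ^^ n) (LGen Y)) \<subseteq> km_gens S"
    if "X \<in> km_gens S" "Y \<in> km_gens S" for X Y n
    using that by blast
  assume "km_rel S s t"
  then show ?thesis
    by (cases rule: km_rel.cases) (use * in \<open>auto simp: km_gens_def\<close>)
qed

definition component :: "'i weight \<Rightarrow> complex \<times> 'i weight \<Rightarrow> 'v::complex_vector \<Rightarrow> 'v" where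
  "component \<delta> m z = (if snd m = \<delta> then fst m *\<^sub>C z else 0)"

text \<open>These functionals are complex linear in the left factor as well, so they factor through
  the tensor product over the complex numbers.\<close>

definition homogeneous_maps :: "(complex \<times> 'i weight \<Rightarrow> 'a::complex_vector \<Rightarrow> 'v::complex_vector) set" where
  "homogeneous_maps = {\<beta> \<in> graded_maps. \<forall>c m u. \<beta> (gscale c m) u = c *\<^sub>C \<beta> m u}"

lemma component_homogeneous: "component \<delta> \<in> homogeneous_maps"
  by (auto simp: homogeneous_maps_def graded_maps_def component_def clinear_def
      scaleC_add_left scaleC_add_right scaleC_scaleC mult.commute)

lemma component_graded: "component \<delta> \<in> graded_maps"
  using component_homogeneous by (auto simp: homogeneous_maps_def)

lemma sum_components:
  assumes "finite D" "\<And>m z. (m, z) \<in> set l \<Longrightarrow> snd m \<in> D"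
  shows "(\<Sum>\<delta>\<in>D. tsum (component \<delta>) l) = tsum (\<lambda>m z. fst m *\<^sub>C z) l"
  using assms
proof (induction l)
  case (Cons a l)
  have "(\<Sum>\<delta>\<in>D. component \<delta> (fst a) (snd a)) = fst (fst a) *\<^sub>C snd a"
    using Cons.prems(1) Cons.prems(2) [of "fst a" "snd a"] by (simp add: component_def)
  moreover have "(\<Sum>\<delta>\<in>D. tsum (component \<delta>) l) = tsum (\<lambda>m z. fst m *\<^sub>C z) l"
    using Cons.prems by (intro Cons.IH) auto
  ultimately show ?case by (simp add: tsum_Cons sum.distrib)
qed simp

lemma tsum_gexpand:
  fixes \<phi> :: "('i, 'y) km_gen \<Rightarrow> 'g::complex_lie_algebra"
  shows "tsum (\<lambda>m z. fst m *\<^sub>C z) (gexpand \<phi> t) = leval \<phi> t"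
proof (induction t)
  case (LScale c t)
  have "tsum (\<lambda>m z. fst (gscale c m) *\<^sub>C z) l = c *\<^sub>C tsum (\<lambda>m z. fst m *\<^sub>C z) l"
    for l :: "((complex \<times> 'i weight) \<times> 'g) list"
    by (induction l) (auto simp: tsum_Cons scaleC_scaleC scaleC_add_right)
  then show ?case using LScale unfolding gexpand.simps tsum_gscale by simp
next
  case (LBr s t)
  have "tsum (\<lambda>m z. tsum (\<lambda>m' z'. (fst m * fst m') *\<^sub>C lie_br z z') k) l =
      lie_br (tsum (\<lambda>m z. fst m *\<^sub>C z) l) (tsum (\<lambda>m z. fst m *\<^sub>C z) k)"
    for l k :: "((complex \<times> 'i weight) \<times> 'g) list"
  proof -
    have "lie_br (tsum (\<lambda>m z. fst m *\<^sub>C z) l) (tsum (\<lambda>m z. fst m *\<^sub>C z) k) =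
        tsum (\<lambda>m z. lie_br (fst m *\<^sub>C z) (tsum (\<lambda>m z. fst m *\<^sub>C z) k)) l"
      by (rule tsum_clinear [OF clinear_lie_br(2)])
    also have "\<dots> = tsum (\<lambda>m z. tsum (\<lambda>m' z'. lie_br (fst m *\<^sub>C z) (fst m' *\<^sub>C z')) k) l"
      by (intro tsum_cong tsum_clinear [OF clinear_lie_br(1)])
    finally show ?thesis by (simp add: lie_br_scale_left lie_br_scale_right scaleC_scaleC mult.commute)
  qed
  then show ?case using LBr by (simp add: tsum_tmul)
qed (simp_all add: scaleC_one)

section \<open>Homogeneous components in the Kac-Moody algebra\<close>

locale km_algebra =
  fixes S :: "('i, 'y::ab_group_add) SGR" and \<phi> :: "('i, 'y) km_gen \<Rightarrow> 'g::complex_lie_algebra"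
  assumes km: "is_kac_moody_algebra S \<phi>"
begin

lemma rel_eval: "km_rel S s t \<Longrightarrow> leval \<phi> s = leval \<phi> t"
  using km km_rel_gens [of S s t] lie_cong.rel [of "km_rel S" s t]
  by (auto simp: is_kac_moody_algebra_def lie_presented_def)

definition lterm_of :: "'g \<Rightarrow> ('i, 'y) km_gen lterm" where
  "lterm_of x = (SOME t. lgens t \<subseteq> km_gens S \<and> leval \<phi> t = x)"

lemma lterm_of: "lgens (lterm_of x) \<subseteq> km_gens S" "leval \<phi> (lterm_of x) = x"
proof -
  have "\<exists>t. lgens t \<subseteq> km_gens S \<and> leval \<phi> t = x"
    using km by (simp add: is_kac_moody_algebra_def lie_presented_def)
  from someI_ex [OF this] show "lgens (lterm_of x) \<subseteq> km_gens S" "leval \<phi> (lterm_of x) = x"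
    by (simp_all add: lterm_of_def)
qed

definition gtensor :: "'g \<Rightarrow> ((complex \<times> 'i weight) \<times> 'g) list" where
  "gtensor x = gexpand \<phi> (lterm_of x)"

lemma gtensor_eq:
  assumes "leval \<phi> t = x" "lgens t \<subseteq> km_gens S" "\<beta> \<in> graded_maps"
  shows "tsum \<beta> (gtensor x) = tsum \<beta> (gexpand \<phi> t)"
proof -
  have "lie_cong (km_rel S) (lterm_of x) t"
    using km lterm_of [of x] assms(1,2) by (auto simp: is_kac_moody_algebra_def lie_presented_def)
  then show ?thesis unfolding gtensor_def by (rule gexpand_cong [OF _ rel_eval assms(3)])
qed

lemma gtensor_add:
  "\<beta> \<in> graded_maps \<Longrightarrow> tsum \<beta> (gtensor (x + y)) = tsum \<beta> (gtensor x) + tsum \<beta> (gtensor y)"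
  using gtensor_eq [of "LAdd (lterm_of x) (lterm_of y)" "x + y" \<beta>] by (simp add: lterm_of gtensor_def)

lemma gtensor_scale:
  "\<beta> \<in> graded_maps \<Longrightarrow> tsum \<beta> (gtensor (c *\<^sub>C x)) = tsum (\<lambda>m u. \<beta> (gscale c m) u) (gtensor x)"
  using gtensor_eq [of "LScale c (lterm_of x)" "c *\<^sub>C x" \<beta>]
  unfolding gexpand.simps tsum_gscale by (simp add: lterm_of gtensor_def)

lemma gtensor_br:
  "\<beta> \<in> graded_maps \<Longrightarrow> tsum \<beta> (gtensor (lie_br x y)) = tsum \<beta> (tmul gmul lie_br (gtensor x) (gtensor y))"
  using gtensor_eq [of "LBr (lterm_of x) (lterm_of y)" "lie_br x y" \<beta>] by (simp add: lterm_of gtensor_def)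

text \<open>\<open>g_homogeneous\<close> only says how the elements of a degree are generated; this
  is what separates the degrees. Against complex linear functionals x becomes the pure tensor 1
  \<otimes> x in degree \<alpha>, whatever term presents it.\<close>

lemma gtensor_homogeneous:
  assumes "g_homogeneous S \<phi> \<alpha> x" "\<beta> \<in> homogeneous_maps"
  shows "tsum \<beta> (gtensor x) = \<beta> (1, \<alpha>) x"
  using assms
proof (induction arbitrary: \<beta> rule: g_homogeneous.induct)
  case (E i)
  then show ?case
    using gtensor_eq [of "LGen (GenE i)" _ \<beta>] by (simp add: homogeneous_maps_def km_gens_def)
next
  case (F i)
  then show ?case
    using gtensor_eq [of "LGen (GenF i)" _ \<beta>] by (simp add: homogeneous_maps_def km_gens_def)
next
  case (H y)
  then show ?case
    using gtensor_eq [of "LGen (GenH y)" _ \<beta>] by (simp add: homogeneous_maps_def km_gens_def)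
next
  case (zero \<alpha>)
  then show ?case
    using gtensor_eq [of LZero 0 \<beta>] by (simp add: homogeneous_maps_def graded_mapsD)
next
  case (add \<alpha> x y)
  then show ?case using gtensor_add [of \<beta> x y] by (simp add: homogeneous_maps_def graded_mapsD)
next
  case (scale \<alpha> x c)
  have \<beta>: "\<beta> \<in> graded_maps" "\<And>c m u. \<beta> (gscale c m) u = c *\<^sub>C \<beta> m u"
    using scale.prems by (auto simp: homogeneous_maps_def)
  have "tsum \<beta> (gtensor (c *\<^sub>C x)) = tsum (\<lambda>m u. c *\<^sub>C \<beta> m u) (gtensor x)"
    unfolding gtensor_scale [OF \<beta>(1)] \<beta>(2) ..
  also have "\<dots> = c *\<^sub>C tsum \<beta> (gtensor x)"
    by (rule tsum_clinear [symmetric]) (simp add: clinear_def scaleC_add_right scaleC_scaleC mult.commute)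
  finally show ?case using scale \<beta> by (simp add: graded_mapsD)
next
  case (br \<alpha> x \<alpha>' y)
  have \<beta>: "\<beta> \<in> graded_maps" "\<And>c d \<gamma> u. \<beta> (c * d, \<gamma>) u = c *\<^sub>C \<beta> (d, \<gamma>) u"
    using br.prems unfolding homogeneous_maps_def by force+
  have left: "(\<lambda>m' u'. \<beta> (gmul m m') (lie_br u u')) \<in> homogeneous_maps" for m u
    using graded_maps_lie_left [OF \<beta>(1), of m u] \<beta>(2) [of _ "fst m * _"]
    by (auto simp: homogeneous_maps_def mult.left_commute)
  have right: "(\<lambda>m u. \<beta> (gmul m (1, \<alpha>')) (lie_br u y)) \<in> homogeneous_maps"
    using graded_maps_lie_right [OF \<beta>(1), of "(1, \<alpha>')" y] \<beta>(2)
    by (auto simp: homogeneous_maps_def)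
  have "tsum \<beta> (gtensor (lie_br x y)) = tsum (\<lambda>m u. tsum (\<lambda>m' u'. \<beta> (gmul m m') (lie_br u u')) (gtensor y)) (gtensor x)"
    unfolding gtensor_br [OF \<beta>(1)] tsum_tmul ..
  also have "\<dots> = tsum (\<lambda>m u. \<beta> (gmul m (1, \<alpha>')) (lie_br u y)) (gtensor x)"
    unfolding br.IH(2) [OF left] ..
  also have "\<dots> = \<beta> (1, \<alpha> + \<alpha>') (lie_br x y)"
    unfolding br.IH(1) [OF right] by simp
  finally show ?case .
qed

definition gcomp :: "'i weight \<Rightarrow> 'g \<Rightarrow> 'g" where
  "gcomp \<delta> x = tsum (component \<delta>) (gtensor x)"

lemma gcomp_homogeneous: "x \<in> root_space S \<phi> \<alpha> \<Longrightarrow> gcomp \<delta> x = (if \<alpha> = \<delta> then x else 0)"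
  unfolding gcomp_def root_space_def
  by (simp add: gtensor_homogeneous component_homogeneous) (simp add: component_def scaleC_one)

lemma clinear_gcomp: "clinear (gcomp \<delta>)"
proof (rule clinearI)
  show "gcomp \<delta> (x + y) = gcomp \<delta> x + gcomp \<delta> y" for x y
    unfolding gcomp_def by (rule gtensor_add [OF component_graded])
  fix c :: complex and x :: 'g
  have "component \<delta> (gscale c m) u = c *\<^sub>C component \<delta> m u" for m and u :: 'g
    by (simp add: component_def scaleC_scaleC)
  then have "gcomp \<delta> (c *\<^sub>C x) = tsum (\<lambda>m u. c *\<^sub>C component \<delta> m u) (gtensor x)"
    unfolding gcomp_def gtensor_scale [OF component_graded] by (intro tsum_cong)
  also have "\<dots> = c *\<^sub>C gcomp \<delta> x"
    unfolding gcomp_def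
    by (rule tsum_clinear [symmetric]) (simp add: clinear_def scaleC_add_right scaleC_scaleC mult.commute)
  finally show "gcomp \<delta> (c *\<^sub>C x) = c *\<^sub>C gcomp \<delta> x" .
qed

lemma gexpand_root_space:
  "lgens t \<subseteq> km_gens S \<Longrightarrow> (m, z) \<in> set (gexpand \<phi> t) \<Longrightarrow> z \<in> root_space S \<phi> (snd m)"
proof (induction t arbitrary: m z)
  case (LGen X)
  then show ?case by (auto simp: km_gens_def root_space_def intro: g_homogeneous.intros)
next
  case (LBr s t)
  then show ?case by (auto simp: set_tmul root_space_def intro!: g_homogeneous.br)
qed force+

lemma gcomp_root_space: "gcomp \<delta> x \<in> root_space S \<phi> \<delta>"
proof -
  have "tsum (component \<delta>) l \<in> root_space S \<phi> \<delta>"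
    if "\<And>m z. (m, z) \<in> set l \<Longrightarrow> z \<in> root_space S \<phi> (snd m)" for l
    using that
  proof (induction l)
    case (Cons a l)
    have "component \<delta> (fst a) (snd a) \<in> root_space S \<phi> \<delta>"
      using Cons.prems [of "fst a" "snd a"]
      by (auto simp: component_def root_space_def intro: g_homogeneous.intros)
    then show ?case using Cons by (simp add: tsum_Cons root_space_def g_homogeneous.add)
  qed (simp add: root_space_def g_homogeneous.zero)
  then show ?thesis unfolding gcomp_def gtensor_def using gexpand_root_space lterm_of(1) by blast
qed

lemma gcomp_decomposition:
  obtains D where "finite D" "x = (\<Sum>\<delta>\<in>D. gcomp \<delta> x)"
proof
  show "finite ((\<lambda>a. snd (fst a)) ` set (gtensor x))" by simp
  have "(\<Sum>\<delta>\<in>(\<lambda>a. snd (fst a)) ` set (gtensor x). gcomp \<delta> x) = tsum (\<lambda>m z. fst m *\<^sub>C z) (gtensor x)"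
    unfolding gcomp_def by (rule sum_components) force+
  then show "x = (\<Sum>\<delta>\<in>(\<lambda>a. snd (fst a)) ` set (gtensor x). gcomp \<delta> x)"
    by (simp add: gtensor_def tsum_gexpand lterm_of)
qed

section \<open>Degrees and scalars in the enveloping algebra\<close>

abbreviation \<iota>tensor :: "'g \<Rightarrow> ((complex \<times> 'i weight) \<times> 'g uea) list" where
  "\<iota>tensor x \<equiv> map (\<lambda>(m, z). (m, \<iota> z)) (gtensor x)"

lemma tsum_\<iota>tensor: "tsum \<beta> (map (\<lambda>(m, z). (m, \<iota> z)) l) = tsum (\<lambda>m z. \<beta> m (\<iota> z)) l"
  using tsum_map [of \<beta> "\<lambda>m z. m" "\<lambda>m z. \<iota> z" l] by simp

lemma graded_maps_\<iota>: "\<beta> \<in> graded_maps \<Longrightarrow> (\<lambda>m z. \<beta> m (\<iota> z)) \<in> graded_maps"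
  by (simp add: graded_maps_def clinear_def \<iota>_add \<iota>_scaleC)

sublocale grading: formal_tensor "(1, 0)" gmul gscale \<iota>tensor
  "graded_maps :: (complex \<times> 'i weight \<Rightarrow> 'g uea \<Rightarrow> 'g uea) set"
proof
  fix \<beta> :: "complex \<times> 'i weight \<Rightarrow> 'g uea \<Rightarrow> 'g uea" and x y :: 'g and c d :: complex
    and a b m :: "complex \<times> 'i weight" and u v w :: "'g uea"
  assume \<beta>: "\<beta> \<in> graded_maps"
  note \<iota> = graded_maps_\<iota> [OF \<beta>]
  show "\<beta> m (u + v) = \<beta> m u + \<beta> m v" "\<beta> (gscale (c + d) m) u = \<beta> (gscale c m) u + \<beta> (gscale d m) u"
    using graded_mapsD [OF \<beta>] by (simp_all add: distrib_right)
  show "(\<lambda>m u. \<beta> (gmul a (gmul m b)) (v * (u * w))) \<in> graded_maps"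
    using \<beta> by (simp add: graded_maps_def clinear_def distrib_left distrib_right
        scaleC_mult_left scaleC_mult_right)
  show "tsum \<beta> (\<iota>tensor (x + y)) = tsum \<beta> (\<iota>tensor x) + tsum \<beta> (\<iota>tensor y)"
    unfolding tsum_\<iota>tensor by (rule gtensor_add [OF \<iota>])
  show "tsum \<beta> (\<iota>tensor (c *\<^sub>C x)) = tsum \<beta> (tscale gscale c (\<iota>tensor x))"
    unfolding tsum_gscale tsum_\<iota>tensor by (rule gtensor_scale [OF \<iota>])
  \<comment> \<open>The left factors commute, so the commutator of two pure tensors is governed by
    the commutator of the right factors.\<close>
  have swap: "gmul m' m = gmul m m'" for m m' :: "complex \<times> 'i weight"
    by (simp add: mult.commute add.commute)
  have "tsum \<beta> (\<iota>tensor (lie_br x y)) =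
      tsum (\<lambda>m u. tsum (\<lambda>m' u'. \<beta> (gmul m m') (\<iota> u * \<iota> u') - \<beta> (gmul m m') (\<iota> u' * \<iota> u)) (gtensor y)) (gtensor x)"
    unfolding tsum_\<iota>tensor gtensor_br [OF \<iota>] tsum_tmul \<iota>_lie_br graded_mapsD(6) [OF \<beta>] ..
  also have "\<dots> = tsum (\<lambda>m u. tsum (\<lambda>m' u'. \<beta> (gmul m m') (\<iota> u * \<iota> u')) (gtensor y)) (gtensor x) -
      tsum (\<lambda>m u. tsum (\<lambda>m' u'. \<beta> (gmul m m') (\<iota> u * \<iota> u')) (gtensor x)) (gtensor y)"
    unfolding tsum_diff tsum_swap [of _ "gtensor y" "gtensor x"] swap ..
  finally show "tsum \<beta> (\<iota>tensor (lie_br x y)) =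
      tsum \<beta> (tmul gmul (*) (\<iota>tensor x) (\<iota>tensor y)) - tsum \<beta> (tmul gmul (*) (\<iota>tensor y) (\<iota>tensor x))"
    unfolding tsum_tmul tsum_\<iota>tensor .
qed (simp_all add: mult.assoc add.assoc mult.left_commute)

lemma represents_gen:
  assumes "X \<in> km_gens S"
  shows "grading.represents (\<iota> (\<phi> X)) [((1, km_degree X), \<iota> (\<phi> X))]"
proof (rule grading.represents_equiv [OF grading.represents_\<iota>])
  show "grading.equiv (\<iota>tensor (\<phi> X)) [((1, km_degree X), \<iota> (\<phi> X))]"
    unfolding grading.equiv_def tsum_\<iota>tensor
    using gtensor_eq [of "LGen X" "\<phi> X"] assms graded_maps_\<iota> by auto
qed

text \<open>The shift n \<kappa> has degree zero, so for q n to stay homogeneous it must vanish or X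
  must have degree zero. The denominator n + 1 crosses the tensor sign by
  \<open>graded_maps_rat\<close>.\<close>

lemma represents_binomial_sequence:
  assumes q: "binomial_sequence (\<phi> X) \<kappa> q" and X: "X \<in> km_gens S" "\<kappa> = 0 \<or> km_degree X = 0"
  shows "\<exists>\<alpha>. grading.represents (q n) [((1, \<alpha>), q n)]"
proof (induction n)
  case 0
  then show ?case using q grading.represents_1 by (auto simp: binomial_sequence_def)
next
  case (Suc n)
  then obtain \<alpha> where \<alpha>: "grading.represents (q n) [((1, \<alpha>), q n)]" by blast
  let ?h = "of_int (int n * \<kappa>) :: complex" and ?x = "\<iota> (\<phi> X)" and ?d = "km_degree X"
  let ?N = "of_nat (Suc n) :: complex"
  have "grading.represents (?x - ?h *\<^sub>C 1)
      ([((1, ?d), ?x)] @ tscale gscale (-1) (tscale gscale ?h [((1, 0), 1)]))"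
    by (intro grading.represents_diff grading.represents_scale represents_gen X grading.represents_1)
  from grading.represents_scale [OF grading.represents_mult [OF \<alpha> this], of "1 / ?N"]
  have "grading.represents (q (Suc n)) (tscale gscale (1 / ?N)
      (tmul gmul (*) [((1, \<alpha>), q n)] ([((1, ?d), ?x)] @ tscale gscale (-1) (tscale gscale ?h [((1, 0), 1)]))))"
    by (simp only: binomial_sequence_Suc [OF q])
  moreover have "grading.equiv (tscale gscale (1 / ?N)
      (tmul gmul (*) [((1, \<alpha>), q n)] ([((1, ?d), ?x)] @ tscale gscale (-1) (tscale gscale ?h [((1, 0), 1)]))))
      [((1, \<alpha> + ?d), q (Suc n))]"
    unfolding grading.equiv_def
  proof
    fix \<beta> :: "complex \<times> 'i weight \<Rightarrow> 'g uea \<Rightarrow> 'g uea" assume \<beta>: "\<beta> \<in> graded_maps"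
    note \<beta>' = graded_mapsD [OF \<beta>]
    have "tsum \<beta> (tscale gscale (1 / ?N)
      (tmul gmul (*) [((1, \<alpha>), q n)] ([((1, ?d), ?x)] @ tscale gscale (-1) (tscale gscale ?h [((1, 0), 1)])))) =
      \<beta> (of_int 1 / ?N, \<alpha> + ?d) (q n * ?x) + \<beta> (of_int (- (int n * \<kappa>)) / ?N, \<alpha>) (q n)"
      by (simp add: tmul_def del: of_nat_Suc)
    also have "\<dots> = (1 / ?N) *\<^sub>C (\<beta> (1, \<alpha> + ?d) (q n * ?x) - ?h *\<^sub>C \<beta> (1, \<alpha>) (q n))"
      unfolding graded_maps_rat [OF \<beta>]
      by (simp add: cvec.scale_right_diff_distrib scaleC_scaleC del: of_nat_Suc)
    also have "?h *\<^sub>C \<beta> (1, \<alpha>) (q n) = ?h *\<^sub>C \<beta> (1, \<alpha> + ?d) (q n)"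
      using X(2) by auto
    also have "(1 / ?N) *\<^sub>C (\<beta> (1, \<alpha> + ?d) (q n * ?x) - ?h *\<^sub>C \<beta> (1, \<alpha> + ?d) (q n)) = \<beta> (1, \<alpha> + ?d) (q (Suc n))"
      by (simp add: binomial_sequence_Suc [OF q] \<beta>'(3,6) right_diff_distrib scaleC_mult_right del: of_nat_Suc)
    finally show "tsum \<beta> (tscale gscale (1 / ?N)
      (tmul gmul (*) [((1, \<alpha>), q n)] ([((1, ?d), ?x)] @ tscale gscale (-1) (tscale gscale ?h [((1, 0), 1)])))) =
      tsum \<beta> [((1, \<alpha> + ?d), q (Suc n))]" by simp
  qed
  ultimately show ?case using grading.represents_equiv by blast
qed

text \<open>Generators are represented by themselves with coefficient 1, and the property passes to
  differences and products. The second condition recovers u when the degrees are forgotten.\<close>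

lemma U_int_grading:
  assumes "u \<in> U_int S \<phi>"
  obtains l where "grading.represents u l" "tsum (\<lambda>m v. fst m *\<^sub>C v) l = u"
    "\<And>m v. (m, v) \<in> set l \<Longrightarrow> fst m \<in> \<int> \<and> v \<in> U_int S \<phi>"
proof -
  let ?U = "U_int S \<phi>"
  let ?P = "\<lambda>u l. grading.represents u l \<and> tsum (\<lambda>m v. fst m *\<^sub>C v) l = u \<and>
    (\<forall>(m, v)\<in>set l. fst m \<in> \<int> \<and> v \<in> ?U)"
  let ?T = "{u. \<exists>l. ?P u l}"
  have "is_subring ?T"
    unfolding is_subring_def
  proof (intro conjI ballI)
    have "?P 1 [((1, 0), 1)]" using grading.represents_1 by (simp add: scaleC_one is_subringD [OF U_int_subring])
    then show "1 \<in> ?T" by blast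
    fix u v assume "u \<in> ?T" "v \<in> ?T"
    then obtain l k where l: "?P u l" and k: "?P v k" by blast
    have "tsum (\<lambda>m v. fst (gscale (-1) m) *\<^sub>C v) k = tsum (\<lambda>m v. - (fst m *\<^sub>C v)) k"
      by (rule tsum_cong) simp
    then have m: "tsum (\<lambda>m v. fst (gscale (-1) m) *\<^sub>C v) k = - v"
      using k by (simp only: tsum_minus)
    have "tsum (\<lambda>m v. fst m *\<^sub>C v) (l @ tscale gscale (-1) k) = u - v"
      unfolding tsum_simps tsum_gscale m using l by simp
    then have "?P (u - v) (l @ tscale gscale (-1) k)"
      using grading.represents_diff [of u l v k] l k by force
    then show "u - v \<in> ?T" by blast
    have "tsum (\<lambda>m u. fst m *\<^sub>C u) l * tsum (\<lambda>m u. fst m *\<^sub>C u) k =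
        tsum (\<lambda>m u. fst m *\<^sub>C u * tsum (\<lambda>m u. fst m *\<^sub>C u) k) l"
      by (rule tsum_clinear [OF clinear_mult_right])
    also have "\<dots> = tsum (\<lambda>m u. tsum (\<lambda>m' u'. fst m *\<^sub>C u * fst m' *\<^sub>C u') k) l"
      by (intro tsum_cong tsum_clinear [OF clinear_mult_left])
    finally have "tsum (\<lambda>m v. fst m *\<^sub>C v) (tmul gmul (*) l k) = u * v"
      using l k by (simp add: tsum_tmul scaleC_mult_left scaleC_mult_right scaleC_scaleC mult.commute)
    moreover have "\<forall>(m, v)\<in>set (tmul gmul (*) l k). fst m \<in> \<int> \<and> v \<in> ?U"
      unfolding set_tmul using l k by (fastforce intro: is_subringD(4) [OF U_int_subring])
    ultimately have "?P (u * v) (tmul gmul (*) l k)"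
      using grading.represents_mult [of u l v k] l k by simp
    then show "u * v \<in> ?T" by blast
  qed
  moreover have *: "q n \<in> ?T"
    if q: "binomial_sequence (\<phi> X) \<kappa> q" "X \<in> km_gens S" "\<kappa> = 0 \<or> km_degree X = 0" "range q \<subseteq> U_gens S \<phi>"
    for X \<kappa> q n
  proof -
    obtain \<alpha> where "grading.represents (q n) [((1, \<alpha>), q n)]"
      using represents_binomial_sequence [OF q(1-3)] by blast
    moreover have "q n \<in> ?U" using q(4) U_int_gens by blast
    ultimately have "?P (q n) [((1, \<alpha>), q n)]" by (simp add: scaleC_one)
    then show ?thesis by blast
  qed
  have "U_gens S \<phi> \<subseteq> ?T"
  proof
    fix u assume "u \<in> U_gens S \<phi>"
    then show "u \<in> ?T"
    proof (cases rule: U_gens_cases)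
      case (E_F X q n)
      then show ?thesis using * by blast
    next
      case (H y q n)
      moreover have "GenH y \<in> km_gens S" by (simp add: km_gens_def)
      ultimately show ?thesis using * [of "GenH y" 1 q n] by simp
    qed
  qed
  ultimately obtain l where "?P u l" using assms U_int_minimal [of ?T S \<phi>] by blast
  then show ?thesis using that by blast
qed

lemma U_int_gcomp: "\<iota> x \<in> U_int S \<phi> \<Longrightarrow> gcomp \<delta> x \<in> g_int S \<phi> \<delta>"
proof -
  assume "\<iota> x \<in> U_int S \<phi>"
  then obtain l where l: "grading.represents (\<iota> x) l" "tsum (\<lambda>m v. fst m *\<^sub>C v) l = \<iota> x"
    "\<And>m v. (m, v) \<in> set l \<Longrightarrow> fst m \<in> \<int> \<and> v \<in> U_int S \<phi>"
    by (rule U_int_grading) blast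
  have "tsum (component \<delta>) (\<iota>tensor x) = tsum (component \<delta>) l"
    using grading.representsD [OF grading.represents_\<iota> component_graded, of \<delta> x]
      grading.representsD [OF l(1) component_graded, of \<delta>] by simp
  moreover have "tsum (component \<delta>) (\<iota>tensor x) = \<iota> (gcomp \<delta> x)"
    unfolding tsum_\<iota>tensor gcomp_def tsum_clinear [OF clinear_\<iota>]
    by (rule tsum_cong) (simp add: component_def \<iota>_scaleC clinear_0 [OF clinear_\<iota>])
  moreover have "tsum (component \<delta>) l \<in> U_int S \<phi>"
    using l(3)
  proof (induction l)
    case (Cons a l)
    have "component \<delta> (fst a) (snd a) \<in> U_int S \<phi>"
    proof (cases "snd (fst a) = \<delta>")
      case True
      obtain k where "fst (fst a) = of_int k" using Cons.prems [of "fst a" "snd a"] by (auto elim: Ints_cases)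
      then have "component \<delta> (fst a) (snd a) = zscale k (snd a)"
        using True by (simp add: component_def zscale_eq_scaleC)
      then show ?thesis
        using subring_zscale [OF U_int_subring, of "snd a" S \<phi> k] Cons.prems [of "fst a" "snd a"] by simp
    qed (simp add: component_def is_subringD [OF U_int_subring])
    moreover have "tsum (component \<delta>) l \<in> U_int S \<phi>"
      using Cons.prems by (intro Cons.IH) auto
    ultimately show ?case by (simp add: tsum_Cons is_subringD [OF U_int_subring])
  qed (simp add: is_subringD [OF U_int_subring])
  ultimately show ?thesis using gcomp_root_space by (simp add: g_int_def)
qed

end

text \<open>L is the coordinate at c0 in a basis of the complex numbers over the rationals that
  contains c0.\<close>

lemma rational_functional:
  assumes "c0 \<noteq> (0::complex)"
  obtains L :: "complex \<Rightarrow> complex"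
  where "\<And>x y. L (x + y) = L x + L y" "\<And>x. L x \<in> \<rat>" "L c0 = 1"
proof -
  interpret Q: vector_space "\<lambda>(q::rat) (c::complex). of_rat q * c"
    by unfold_locales (simp_all add: of_rat_add of_rat_mult algebra_simps)
  have ind: "Q.independent {c0}" using assms by simp
  define C where "C = Q.extend_basis {c0}"
  have C: "Q.independent C" "c0 \<in> C" "Q.span C = UNIV"
    using Q.independent_extend_basis [OF ind] Q.extend_basis_superset [OF ind] Q.span_extend_basis [OF ind]
    by (auto simp: C_def)
  show ?thesis
  proof (rule that [of "\<lambda>x. of_rat (Q.representation C x c0)"])
    show "of_rat (Q.representation C (x + y) c0) =
        of_rat (Q.representation C x c0) + (of_rat (Q.representation C y c0) :: complex)" for x y
      using Q.representation_add [OF C(1), of y x] C(3) by (simp add: of_rat_add)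
    show "of_rat (Q.representation C c0 c0) = (1 :: complex)"
      using Q.representation_basis [OF C(1,2)] by simp
  qed simp
qed

lemma common_denominator:
  assumes "finite t" "\<And>v. v \<in> t \<Longrightarrow> f v \<in> (\<rat> :: complex set)"
  obtains D :: int and m :: "'a \<Rightarrow> int" where "D \<noteq> 0" "\<And>v. v \<in> t \<Longrightarrow> of_int D * f v = of_int (m v)"
proof -
  have "\<exists>D::int. D \<noteq> 0 \<and> (\<forall>v\<in>t. of_int D * f v \<in> \<int>)"
    using assms
  proof (induction t rule: finite_induct)
    case empty
    then show ?case by (intro exI [of _ 1]) simp
  next
    case (insert a t)
    then obtain D :: int where D: "D \<noteq> 0" "\<And>v. v \<in> t \<Longrightarrow> of_int D * f v \<in> \<int>" by auto
    obtain q where q: "f a = of_rat q" using insert.prems [of a] by (auto elim: Rats_cases)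
    obtain k l :: int where kl: "q = Fract k l" "l > 0" by (cases q) auto
    have a: "of_int l * f a = of_int k"
      using kl by (simp add: q Fract_of_int_quotient of_rat_divide)
    have "of_int (l * D) * f v \<in> \<int>" if "v \<in> insert a t" for v
    proof (cases "v = a")
      case True
      have "of_int (l * D) * f a = of_int (D * k)" using a by (simp add: mult_ac)
      then show ?thesis using True by (simp only: Ints_of_int)
    next
      case False
      then have "of_int D * f v \<in> \<int>" using that D(2) by blast
      then have "of_int l * (of_int D * f v) \<in> \<int>" by (rule Ints_mult [OF Ints_of_int])
      then show ?thesis by (simp only: of_int_mult mult.assoc)
    qed
    then show ?case using D(1) kl(2) by (intro exI [of _ "l * D"]) auto
  qed
  then obtain D :: int where D: "D \<noteq> 0" "\<And>v. v \<in> t \<Longrightarrow> of_int D * f v \<in> \<int>" by blast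
  have "\<forall>v\<in>t. \<exists>k. of_int D * f v = of_int k" using D(2) by (auto elim!: Ints_cases)
  then obtain m where "\<And>v. v \<in> t \<Longrightarrow> of_int D * f v = of_int (m v)" by metis
  with D(1) show ?thesis by (rule that)
qed

context km_algebra
begin

text \<open>Applying an additive map L to the left factors turns the relation into one with the
  rational coefficients L (c v), since the f v are integral and contribute only integers on the
  left. Normalising L at c v0 keeps that coefficient nonzero; a common denominator makes all of them
  integers.\<close>

lemma rational_relation:
  assumes t: "finite t" "\<And>v. v \<in> t \<Longrightarrow> f v \<in> U_int S \<phi>" and rel: "(\<Sum>v\<in>t. c v *\<^sub>C f v) = 0"
    and v0: "v0 \<in> t" "c v0 \<noteq> 0"
  obtains m :: "'b \<Rightarrow> int" where "m v0 \<noteq> 0" "(\<Sum>v\<in>t. of_int (m v) *\<^sub>C f v) = 0"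
proof -
  obtain L :: "complex \<Rightarrow> complex" where L: "\<And>x y. L (x + y) = L x + L y" "\<And>x. L x \<in> \<rat>" "L (c v0) = 1"
    by (rule rational_functional [OF v0(2)]) blast
  let ?\<beta> = "\<lambda>m (u::'g uea). L (fst m) *\<^sub>C u"
  have \<beta>: "?\<beta> \<in> (graded_maps :: (complex \<times> 'i weight \<Rightarrow> 'g uea \<Rightarrow> 'g uea) set)"
    by (simp add: graded_maps_def clinear_def L(1) scaleC_add_left scaleC_add_right scaleC_scaleC mult.commute)
  define H where "H u = tsum ?\<beta> (grading.tensor u)" for u
  have add: "H (u + v) = H u + H v" for u v
    using grading.representsD [OF grading.represents_add [OF grading.represents_tensor grading.represents_tensor] \<beta>, of u v]
    by (simp add: H_def)
  have zero: "H 0 = 0"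
    using grading.representsD [OF grading.represents_0 \<beta>] by (simp add: H_def)
  have sum: "H (sum h A) = (\<Sum>a\<in>A. H (h a))" for h and A :: "'b set"
    by (induction A rule: infinite_finite_induct) (simp_all add: zero add)
  have scale: "H (d *\<^sub>C u) = L d *\<^sub>C u" if u: "u \<in> U_int S \<phi>" for d u
  proof -
    obtain l where l: "grading.represents u l" "tsum (\<lambda>m v. fst m *\<^sub>C v) l = u"
      "\<And>m v. (m, v) \<in> set l \<Longrightarrow> fst m \<in> \<int> \<and> v \<in> U_int S \<phi>"
      using u by (rule U_int_grading) blast
    \<comment> \<open>An additive map commutes with integers, and the coefficients in l are
      integers.\<close>
    have int: "L (d * of_int k) = L d * of_int k" for k
      using graded_maps_int [of "\<lambda>m (u::complex). L (fst m) *\<^sub>C u" k d 0 1] L(1)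
      by (simp add: graded_maps_def clinear_def scaleC_complex_def algebra_simps)
    have "H (d *\<^sub>C u) = tsum (\<lambda>m v. ?\<beta> (gscale d m) v) l"
      using grading.representsD [OF grading.represents_scale [OF l(1)] \<beta>] unfolding tsum_gscale H_def .
    also have "\<dots> = tsum (\<lambda>m v. L d *\<^sub>C fst m *\<^sub>C v) l"
    proof (rule tsum_cong)
      fix m :: "complex \<times> 'i weight" and v assume "(m, v) \<in> set l"
      then have "fst m \<in> \<int>" using l(3) by blast
      then obtain k where "fst m = of_int k" by (rule Ints_cases)
      then show "?\<beta> (gscale d m) v = L d *\<^sub>C fst m *\<^sub>C v" by (simp add: int scaleC_scaleC)
    qed
    also have "\<dots> = L d *\<^sub>C tsum (\<lambda>m v. fst m *\<^sub>C v) l"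
      by (rule tsum_clinear [symmetric]) (simp add: clinear_def scaleC_add_right scaleC_scaleC mult.commute)
    finally show ?thesis by (simp only: l(2))
  qed
  have "(\<Sum>v\<in>t. L (c v) *\<^sub>C f v) = H (\<Sum>v\<in>t. c v *\<^sub>C f v)"
    unfolding sum by (intro sum.cong HOL.refl) (simp only: scale t(2))
  then have L0: "(\<Sum>v\<in>t. L (c v) *\<^sub>C f v) = 0" by (simp only: rel zero)
  obtain D m where D: "D \<noteq> 0" "\<And>v. v \<in> t \<Longrightarrow> of_int D * L (c v) = of_int (m v)"
    using common_denominator [OF t(1), of "\<lambda>v. L (c v)"] L(2) by metis
  show ?thesis
  proof (rule that [of m])
    have "(of_int (m v0) :: complex) = of_int D" using D(2) [OF v0(1)] L(3) by simp
    then show "m v0 \<noteq> 0" using D(1) by simp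
    have "(\<Sum>v\<in>t. of_int (m v) *\<^sub>C f v) = of_int D *\<^sub>C (\<Sum>v\<in>t. L (c v) *\<^sub>C f v)"
      unfolding cvec.scale_sum_right by (intro sum.cong HOL.refl) (simp add: scaleC_scaleC D(2))
    then show "(\<Sum>v\<in>t. of_int (m v) *\<^sub>C f v) = 0" using L0 by simp
  qed
qed

lemma U_int_independent:
  assumes "zmod.independent P" "P \<subseteq> U_int S \<phi>"
  shows "cvec.independent P"
  unfolding cvec.independent_explicit_module
proof (intro allI impI)
  fix t c v assume t: "finite t" "t \<subseteq> P" "(\<Sum>v\<in>t. c v *\<^sub>C v) = 0" "v \<in> t"
  show "c v = 0"
  proof (rule ccontr)
    assume "c v \<noteq> 0"
    obtain m :: "'g uea \<Rightarrow> int" where m: "m v \<noteq> 0" "(\<Sum>v\<in>t. of_int (m v) *\<^sub>C v) = 0"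
      by (rule rational_relation [of t "\<lambda>v. v" c v]) (use t assms(2) \<open>c v \<noteq> 0\<close> in auto)
    then show False
      using zmod.independentD [OF assms(1) t(1,2), of m v] t(4) by (simp add: zscale_eq_scaleC)
  qed
qed

lemma g_int_independent:
  assumes "zmod.independent P" "\<iota> ` P \<subseteq> U_int S \<phi>"
  shows "cvec.independent P"
  unfolding cvec.independent_explicit_module
proof (intro allI impI)
  fix t c v assume t: "finite t" "t \<subseteq> P" "(\<Sum>v\<in>t. c v *\<^sub>C v) = 0" "v \<in> t"
  show "c v = 0"
  proof (rule ccontr)
    assume "c v \<noteq> 0"
    have lin: "\<iota> (\<Sum>v\<in>t. h v *\<^sub>C v) = (\<Sum>v\<in>t. h v *\<^sub>C \<iota> v)" for h
      by (simp add: clinear_sum [OF clinear_\<iota>] \<iota>_scaleC)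
    have "(\<Sum>v\<in>t. c v *\<^sub>C \<iota> v) = 0" unfolding lin [symmetric] t(3) by (rule clinear_0 [OF clinear_\<iota>])
    then obtain m :: "'g \<Rightarrow> int" where m: "m v \<noteq> 0" "(\<Sum>v\<in>t. of_int (m v) *\<^sub>C \<iota> v) = 0"
      by (rule rational_relation [OF t(1), of \<iota> c v, rotated]) (use t assms(2) \<open>c v \<noteq> 0\<close> in auto)
    then have "\<iota> (\<Sum>v\<in>t. of_int (m v) *\<^sub>C v) = \<iota> 0" by (simp add: lin clinear_0 [OF clinear_\<iota>])
    then have "(\<Sum>v\<in>t. of_int (m v) *\<^sub>C v) = 0" by (rule injD [OF inj_\<iota>])
    then show False
      using zmod.independentD [OF assms(1) t(1,2), of m v] t(4) m(1) by (simp add: zscale_eq_scaleC)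
  qed
qed

lemma g_int_br: "x \<in> g_int S \<phi> \<alpha> \<Longrightarrow> y \<in> g_int S \<phi> \<beta> \<Longrightarrow> lie_br x y \<in> g_int S \<phi> (\<alpha> + \<beta>)"
  by (simp add: g_int_def root_space_def g_homogeneous.br \<iota>_lie_br is_subringD [OF U_int_subring])

text \<open>The integral elements contain the generators and are stable under brackets.\<close>

lemma root_space_span: "g_homogeneous S \<phi> \<alpha> x \<Longrightarrow> x \<in> cvec.span (g_int S \<phi> \<alpha>)"
proof (induction rule: g_homogeneous.induct)
  case (E i)
  then have "divided_power (\<iota> (\<phi> (GenE i))) 1 \<in> U_int S \<phi>"
    by (intro U_int_gens) (auto simp: U_gens_def)
  then show ?case using E
    by (intro cvec.span_base) (simp add: g_int_def root_space_def g_homogeneous.E divided_power_def scaleC_one)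
next
  case (F i)
  then have "divided_power (\<iota> (\<phi> (GenF i))) 1 \<in> U_int S \<phi>"
    by (intro U_int_gens) (auto simp: U_gens_def)
  then show ?case using F
    by (intro cvec.span_base) (simp add: g_int_def root_space_def g_homogeneous.F divided_power_def scaleC_one)
next
  case (H y)
  have "alg_binomial (\<iota> (\<phi> (GenH y))) 1 \<in> U_int S \<phi>"
    by (intro U_int_gens) (auto simp: U_gens_def)
  then show ?case
    by (intro cvec.span_base) (simp add: g_int_def root_space_def g_homogeneous.H alg_binomial_def scaleC_one)
next
  case (br \<alpha> x \<beta> y)
  have "lie_br x z \<in> cvec.span (g_int S \<phi> (\<alpha> + \<beta>))" if "z \<in> g_int S \<phi> \<beta>" for z
    by (rule clinear_span_image [OF clinear_lie_br(2) _ br.IH(1)])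
      (use g_int_br that in \<open>blast intro: cvec.span_base\<close>)
  then show ?case by (intro clinear_span_image [OF clinear_lie_br(1) _ br.IH(2)])
qed (simp_all add: cvec.span_zero cvec.span_add cvec.span_scale)

end

section \<open>Extending bases of pure subgroups\<close>

text \<open>When P lies in a subgroup M, this says that the quotient of M by the span of P is
  torsion-free.\<close>

definition pure_in :: "'a::ab_group_add set \<Rightarrow> 'a set \<Rightarrow> bool" where
  "pure_in P M \<longleftrightarrow> (\<forall>k z. k \<noteq> 0 \<longrightarrow> z \<in> M \<longrightarrow> zscale k z \<in> zmod.span P \<longrightarrow> z \<in> zmod.span P)"

text \<open>The Euclidean algorithm on the coefficients of a relation modulo \<open>P\<close>.\<close>

lemma relation_drops_generator:
  fixes v :: "'b \<Rightarrow> 'a::ab_group_add"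
  assumes "finite I" "zmod.subspace M" "pure_in P M"
    and "v ` I \<subseteq> M" "(\<Sum>i\<in>I. zscale (m i) (v i)) \<in> zmod.span P" "i \<in> I" "m i \<noteq> 0"
  shows "\<exists>i0\<in>I. \<exists>w. w ` (I - {i0}) \<subseteq> M \<and> v ` I \<subseteq> zmod.span (P \<union> w ` (I - {i0}))"
  using assms(4-7)
proof (induction "\<Sum>i\<in>I. nat \<bar>m i\<bar>" arbitrary: v m i rule: less_induct)
  case less
  show ?case
  proof (cases "\<exists>j\<in>I. j \<noteq> i \<and> m j \<noteq> 0")
    case False
    have "(\<Sum>j\<in>I. zscale (m j) (v j)) = (\<Sum>j\<in>I. if j = i then zscale (m i) (v i) else 0)"
      using False by (intro sum.cong) auto
    then have "zscale (m i) (v i) \<in> zmod.span P" using less.prems assms(1) by simp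
    then have "v i \<in> zmod.span P" using assms(3) less.prems by (auto simp: pure_in_def)
    then have "v i \<in> zmod.span (P \<union> v ` (I - {i}))"
      using zmod.span_mono [of P "P \<union> v ` (I - {i})"] by blast
    moreover have "v j \<in> zmod.span (P \<union> v ` (I - {i}))" if "j \<in> I" "j \<noteq> i" for j
      using that by (intro zmod.span_base) blast
    ultimately have "v ` I \<subseteq> zmod.span (P \<union> v ` (I - {i}))" by blast
    then show ?thesis using less.prems by (intro bexI [of _ i] exI [of _ v]) auto
  next
    case True
    then obtain a b where ab: "a \<in> I" "b \<in> I" "a \<noteq> b" "m a \<noteq> 0" "m b \<noteq> 0" "\<bar>m b\<bar> \<le> \<bar>m a\<bar>"
      using less.prems by (metis linear)
    \<comment> \<open>The sum is unchanged when m a becomes m a - s m b and v b becomes v b + s v a;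
      this sign of s makes the absolute value of m a drop by that of m b.\<close>
    define s where "s = sgn (m a) * sgn (m b)"
    define m' where "m' = m(a := m a - s * m b)"
    define v' where "v' = v(b := v b + zscale s (v a))"
    have "\<bar>m a - s * m b\<bar> = \<bar>m a\<bar> - \<bar>m b\<bar>"
      using ab by (auto simp: s_def sgn_if)
    then have a: "nat \<bar>m' a\<bar> < nat \<bar>m a\<bar>" using ab by (simp add: m'_def)
    have "(\<Sum>i\<in>I. nat \<bar>m' i\<bar>) < (\<Sum>i\<in>I. nat \<bar>m i\<bar>)"
      by (rule sum_strict_mono_ex1 [OF assms(1)]) (use a ab in \<open>auto simp: m'_def\<close>)
    moreover have "v' ` I \<subseteq> M"
    proof -
      have "v b + zscale s (v a) \<in> M"
        using less.prems(1) ab by (intro zmod.subspace_add [OF assms(2)] zmod.subspace_scale [OF assms(2)]) blast+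
      then show ?thesis using less.prems(1) by (auto simp: v'_def)
    qed
    moreover have "(\<Sum>i\<in>I. zscale (m' i) (v' i)) = (\<Sum>i\<in>I. zscale (m i) (v i))"
    proof -
      have I: "sum h I = h a + h b + sum h (I - {a, b})" for h :: "'b \<Rightarrow> 'a"
        using sum.remove [OF assms(1) ab(1), of h] sum.remove [of "I - {a}" b h] assms(1) ab
        by (simp add: add.assoc Diff_insert2 [symmetric])
      have "(\<Sum>i\<in>I - {a, b}. zscale (m' i) (v' i)) = (\<Sum>i\<in>I - {a, b}. zscale (m i) (v i))"
        by (intro sum.cong) (auto simp: m'_def v'_def)
      moreover have "zscale (m' a) (v' a) + zscale (m' b) (v' b) = zscale (m a) (v a) + zscale (m b) (v b)"
        using ab by (simp add: m'_def v'_def zmod.scale_left_diff_distrib zscale_add_right zscale_zscale mult.commute)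
      ultimately show ?thesis unfolding I by (simp only:)
    qed
    \<comment> \<open>The new coefficient of a may vanish, so the recursion continues with b as the
      index of a nonzero coefficient.\<close>
    moreover have "m' b \<noteq> 0" using ab by (simp add: m'_def)
    ultimately obtain i0 w where w: "i0 \<in> I" "w ` (I - {i0}) \<subseteq> M" "v' ` I \<subseteq> zmod.span (P \<union> w ` (I - {i0}))"
      using less.hyps [of m' v' b] less.prems(2) ab(2) by auto
    let ?Z = "zmod.span (P \<union> w ` (I - {i0}))"
    have "v j \<in> ?Z" if "j \<in> I" "j \<noteq> b" for j
      using w(3) that by (auto simp: v'_def image_subset_iff)
    moreover have "v' b \<in> ?Z" using w(3) ab(2) by blast
    then have "v' b - zscale s (v a) \<in> ?Z"
      using calculation [OF ab(1,3)] by (intro zmod.span_diff zmod.span_scale)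
    then have "v b \<in> ?Z" by (simp add: v'_def)
    ultimately have "v ` I \<subseteq> ?Z" by blast
    then show ?thesis using w by blast
  qed
qed

text \<open>A finitely generated torsion-free group is free, here relative to the span of P.
  Families are used instead of sets because a Euclidean step may make two generators
  coincide.\<close>

lemma independent_generators_mod:
  fixes v :: "'b \<Rightarrow> 'a::ab_group_add"
  assumes "zmod.subspace M" "pure_in P M" "finite I" "v ` I \<subseteq> M"
  shows "\<exists>J w. finite J \<and> w ` J \<subseteq> M \<and> v ` I \<subseteq> zmod.span (P \<union> w ` J) \<and>
    (\<forall>m. (\<Sum>j\<in>J. zscale (m j) ((w :: 'b \<Rightarrow> 'a) j)) \<in> zmod.span P \<longrightarrow> (\<forall>j\<in>J. m j = 0))"
  using assms(3,4)
proof (induction "card I" arbitrary: I v rule: less_induct)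
  case less
  show ?case
  proof (cases "\<forall>m. (\<Sum>j\<in>I. zscale (m j) (v j)) \<in> zmod.span P \<longrightarrow> (\<forall>j\<in>I. m j = 0)")
    case True
    moreover have "v ` I \<subseteq> zmod.span (P \<union> v ` I)" by (meson Un_upper2 order_trans zmod.span_superset)
    ultimately show ?thesis using less.prems by blast
  next
    case False
    then obtain m i where "(\<Sum>j\<in>I. zscale (m j) (v j)) \<in> zmod.span P" "i \<in> I" "m i \<noteq> 0" by blast
    from relation_drops_generator [OF less.prems(1) assms(1,2) less.prems(2) this]
    obtain i0 w where w: "i0 \<in> I" "w ` (I - {i0}) \<subseteq> M" "v ` I \<subseteq> zmod.span (P \<union> w ` (I - {i0}))" by blast
    have "card (I - {i0}) < card I" using w(1) less.prems(1) by (rule card_Diff1_less [rotated])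
    from less.hyps [OF this _ w(2)] less.prems(1) obtain J and w' :: "'b \<Rightarrow> 'a" where J: "finite J" "w' ` J \<subseteq> M"
      "w ` (I - {i0}) \<subseteq> zmod.span (P \<union> w' ` J)"
      "\<forall>m. (\<Sum>j\<in>J. zscale (m j) (w' j)) \<in> zmod.span P \<longrightarrow> (\<forall>j\<in>J. m j = 0)" by auto
    have "P \<subseteq> zmod.span (P \<union> w' ` J)" by (meson Un_upper1 order_trans zmod.span_superset)
    then have "zmod.span (P \<union> w ` (I - {i0})) \<subseteq> zmod.span (P \<union> w' ` J)"
      using J(3) by (intro zmod.span_minimal zmod.subspace_span) blast
    then show ?thesis using w(3) J by blast
  qed
qed

lemma extend_pure_basis:
  fixes P :: "'a::ab_group_add set"
  assumes M: "zmod.subspace M" "pure_in P M" and P: "zmod.independent P" "P \<subseteq> M" and F: "finite F" "F \<subseteq> M"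
  obtains P' where "P \<subseteq> P'" "P' \<subseteq> M" "zmod.independent P'" "F \<subseteq> zmod.span P'"
proof -
  obtain J w where J: "finite J" "w ` J \<subseteq> M" "F \<subseteq> zmod.span (P \<union> w ` J)"
    "\<And>m j. (\<Sum>j\<in>J. zscale (m j) ((w :: 'a \<Rightarrow> 'a) j)) \<in> zmod.span P \<Longrightarrow> j \<in> J \<Longrightarrow> m j = 0"
    using independent_generators_mod [OF M F(1), of "\<lambda>x. x"] F(2) by auto
  have "zmod.independent (P \<union> w ` J)"
    unfolding zmod.independent_explicit_module
  proof (intro allI impI)
    fix t u v assume t: "finite t" "t \<subseteq> P \<union> w ` J" "(\<Sum>v\<in>t. zscale (u v) v) = 0" "v \<in> t"
    \<comment> \<open>The terms outside P form a relation modulo the span of P, so their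
      coefficients vanish; what remains is a relation inside P.\<close>
    have split: "(\<Sum>v\<in>t. zscale (u v) v) = (\<Sum>v\<in>t - P. zscale (u v) v) + (\<Sum>v\<in>t \<inter> P. zscale (u v) v)"
      using t(1) by (subst sum.union_disjoint [symmetric]) (auto intro!: sum.cong)
    have "(\<Sum>v\<in>t \<inter> P. zscale (u v) v) \<in> zmod.span P"
      by (intro zmod.span_sum zmod.span_scale zmod.span_base) blast
    moreover have "(\<Sum>v\<in>t - P. zscale (u v) v) = - (\<Sum>v\<in>t \<inter> P. zscale (u v) v)"
      using t(3) by (simp add: split eq_neg_iff_add_eq_0)
    ultimately have span: "(\<Sum>v\<in>t - P. zscale (u v) v) \<in> zmod.span P"
      by (simp add: zmod.span_neg)
    have "t - P \<subseteq> w ` J" using t(2) by blast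
    then obtain J' where J': "J' \<subseteq> J" "inj_on w J'" "t - P = w ` J'" by (auto simp: subset_image_inj)
    have "(\<Sum>v\<in>t - P. zscale (u v) v) = (\<Sum>j\<in>J'. zscale (u (w j)) (w j))"
      by (simp add: J'(3) sum.reindex [OF J'(2)])
    also have "\<dots> = (\<Sum>j\<in>J. zscale (if j \<in> J' then u (w j) else 0) (w j))"
      using J'(1) J(1) by (intro sum.mono_neutral_cong_left) auto
    finally have "(if j \<in> J' then u (w j) else 0) = 0" if "j \<in> J" for j
      using J(4) [of "\<lambda>j. if j \<in> J' then u (w j) else 0" j] span that by simp
    then have "u (w j) = 0" if "j \<in> J'" for j
      using that J'(1) by (metis subsetD)
    then have out: "u x = 0" if "x \<in> t - P" for x
      using that unfolding J'(3) by blast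
    show "u v = 0"
    proof (cases "v \<in> P")
      case True
      have "(\<Sum>v\<in>t - P. zscale (u v) v) = 0" by (rule sum.neutral) (simp add: out)
      then have "(\<Sum>v\<in>t \<inter> P. zscale (u v) v) = 0" using t(3) split by simp
      then show ?thesis using zmod.independentD [OF P(1), of "t \<inter> P" u v] t True by simp
    next
      case False
      then show ?thesis using out t(4) by blast
    qed
  qed
  then show ?thesis using that [of "P \<union> w ` J"] P(2) J(2,3) by blast
qed

section \<open>Integrality of the coefficients\<close>

lemma zspan_subset_cspan: "zmod.span (A :: 'a::complex_vector set) \<subseteq> cvec.span A"
  by (rule zmod.span_minimal)
    (auto simp: zmod.subspace_def zscale_eq_scaleC cvec.span_zero cvec.span_add cvec.span_scale cvec.span_base)

lemma cindependent_imp_zindependent: "cvec.independent P \<Longrightarrow> zmod.independent P"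
  unfolding zmod.independent_explicit_module
  using cvec.independentD [of P] by (fastforce simp: zscale_eq_scaleC)

lemma clinear_zspan_Ints:
  assumes "clinear f" "\<And>x. x \<in> A \<Longrightarrow> f x \<in> (\<int> :: complex set)" "x \<in> zmod.span A"
  shows "f x \<in> \<int>"
  using assms(3)
  by (induction rule: zmod.span_induct_alt)
    (simp_all add: zscale_eq_scaleC clinear_0 [OF assms(1)] clinear_add [OF assms(1)]
      clinear_scale [OF assms(1)] scaleC_complex_def assms(2))

lemma zspan_\<iota>: "x \<in> zmod.span (\<iota> ` A) \<Longrightarrow> \<exists>z\<in>zmod.span A. x = \<iota> z"
proof (induction rule: zmod.span_induct_alt)
  case base
  show ?case by (rule bexI [of _ 0]) (simp_all add: clinear_0 [OF clinear_\<iota>] zmod.span_zero)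
next
  case (step c x y)
  then obtain a z where "a \<in> A" "x = \<iota> a" "z \<in> zmod.span A" "y = \<iota> z" by blast
  then show ?case
    by (intro bexI [of _ "zscale c a + z"] zmod.span_add zmod.span_scale)
      (simp_all add: zscale_eq_scaleC \<iota>_add \<iota>_scaleC zmod.span_base)
qed

lemma filtration_exhaust: "\<exists>n. u \<in> filtration_less n"
proof -
  have "\<exists>n. abs_uea t \<in> filtration_less n" for t :: "'a uterm"
  proof (induction t)
    case (UGen x)
    then show ?case using filtration_iprod [of "[x]" 2] by (auto simp: \<iota>.abs_eq)
  next
    case UZero
    then show ?case using filtration_0 by (auto simp: zero_uea.abs_eq [symmetric])
  next
    case UOne
    then show ?case using filtration_iprod [of "[]" 1] by (auto simp: one_uea.abs_eq [symmetric])
  next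
    case (UAdd s t)
    then obtain m n where "abs_uea s \<in> filtration_less m" "abs_uea t \<in> filtration_less n" by blast
    then have "abs_uea s + abs_uea t \<in> filtration_less (max m n)"
      by (intro filtration_add) (auto intro: filtration_mono [rotated])
    then show ?case by (auto simp: plus_uea.abs_eq)
  next
    case (UScale c t)
    then show ?case using filtration_scale by (metis scaleC_uea.abs_eq)
  next
    case (UMul s t)
    then obtain m n where mn: "abs_uea s \<in> filtration_less m" "abs_uea t \<in> filtration_less n" by blast
    from mn(1) have "abs_uea s \<in> filtration_less (Suc m)" by (rule filtration_mono [rotated]) simp
    then have "abs_uea s * abs_uea t \<in> filtration_less (m + n)" using mn(2) by (rule filtration_mult)
    then show ?case by (auto simp: times_uea.abs_eq)
  qed
  then show ?thesis by (metis abs_rep_uea)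
qed

section \<open>Bases of the Lie algebra and purity\<close>

locale km_basis = km_algebra S \<phi>
  for S :: "('i, 'y::ab_group_add) SGR" and \<phi> :: "('i, 'y) km_gen \<Rightarrow> 'g::complex_lie_algebra" +
  fixes Bf :: "('i \<Rightarrow>\<^sub>0 int) \<Rightarrow> 'g set" and r :: "'g rel" and p :: "'g \<Rightarrow> nat \<Rightarrow> 'g uea"
  assumes basis: "\<alpha> \<in> roots S \<phi> \<union> {0} \<Longrightarrow> is_Z_basis (Bf \<alpha>) (g_int S \<phi> \<alpha>)"
    and basis_order: "linear_order_on (basis_union S \<phi> Bf) r"
    and p_int: "x \<in> basis_union S \<phi> Bf \<Longrightarrow> p x n \<in> U_int S \<phi>"
    and p_leading: "x \<in> basis_union S \<phi> Bf \<Longrightarrow> p x n - divided_power (\<iota> x) n \<in> filtration_less n"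
begin

lemma Bf_span: "\<alpha> \<in> roots S \<phi> \<union> {0} \<Longrightarrow> zmod.span (Bf \<alpha>) = g_int S \<phi> \<alpha>"
  using basis by (simp add: is_Z_basis_def)

lemma Bf_g_int: "\<alpha> \<in> roots S \<phi> \<union> {0} \<Longrightarrow> x \<in> Bf \<alpha> \<Longrightarrow> x \<in> g_int S \<phi> \<alpha>"
  using Bf_span zmod.span_base by blast

lemma Bf_independent: "\<alpha> \<in> roots S \<phi> \<union> {0} \<Longrightarrow> cvec.independent (Bf \<alpha>)"
proof (rule g_int_independent)
  assume "\<alpha> \<in> roots S \<phi> \<union> {0}"
  then show "zmod.independent (Bf \<alpha>)" using basis by (simp add: is_Z_basis_def)
  show "\<iota> ` Bf \<alpha> \<subseteq> U_int S \<phi>" using Bf_g_int [OF \<open>\<alpha> \<in> roots S \<phi> \<union> {0}\<close>] by (auto simp: g_int_def)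
qed

text \<open>Projecting a relation to degree \<alpha> keeps exactly its terms in
  \<open>Bf \<alpha>\<close>, and these are independent over the complex numbers by
  \<open>g_int_independent\<close>.\<close>

lemma basis_union_independent: "cvec.independent (basis_union S \<phi> Bf)"
  unfolding cvec.independent_explicit_module
proof (intro allI impI)
  fix t c v
  assume t: "finite t" "t \<subseteq> basis_union S \<phi> Bf" "(\<Sum>v\<in>t. c v *\<^sub>C v) = 0" "v \<in> t"
  then obtain \<alpha> where \<alpha>: "\<alpha> \<in> roots S \<phi> \<union> {0}" "v \<in> Bf \<alpha>" by (auto simp: basis_union_def)
  have comp: "gcomp \<alpha> w = (if w \<in> Bf \<alpha> then w else 0)" if w: "w \<in> t" for w
  proof -
    obtain \<beta> where \<beta>: "\<beta> \<in> roots S \<phi> \<union> {0}" "w \<in> Bf \<beta>" using w t(2) by (auto simp: basis_union_def)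
    show ?thesis
    proof (cases "w \<in> Bf \<alpha>")
      case True
      then show ?thesis using gcomp_homogeneous [of w \<alpha> \<alpha>] Bf_g_int [OF \<alpha>(1)] by (simp add: g_int_def)
    next
      case False
      then have "\<beta> \<noteq> \<alpha>" using \<beta>(2) by blast
      then show ?thesis using False gcomp_homogeneous [of w \<beta> \<alpha>] Bf_g_int [OF \<beta>] by (simp add: g_int_def)
    qed
  qed
  have "0 = gcomp \<alpha> (\<Sum>v\<in>t. c v *\<^sub>C v)" by (simp add: t(3) clinear_0 [OF clinear_gcomp])
  also have "\<dots> = (\<Sum>w\<in>t. c w *\<^sub>C gcomp \<alpha> w)"
    by (simp add: clinear_sum [OF clinear_gcomp] clinear_scale [OF clinear_gcomp])
  also have "\<dots> = (\<Sum>w\<in>t \<inter> Bf \<alpha>. c w *\<^sub>C w)"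
    using t(1) by (intro sum.mono_neutral_cong_right) (auto simp: comp)
  finally show "c v = 0"
    using cvec.independentD [OF Bf_independent [OF \<alpha>(1)], of "t \<inter> Bf \<alpha>" c v] t(1,4) \<alpha>(2) by simp
qed

lemma gcomp_in_span:
  assumes "x \<in> root_space S \<phi> \<alpha>"
  shows "x \<in> cvec.span (basis_union S \<phi> Bf)"
proof (cases "x = 0")
  case False
  then have \<alpha>: "\<alpha> \<in> roots S \<phi> \<union> {0}" using assms by (auto simp: roots_def)
  have "g_int S \<phi> \<alpha> \<subseteq> cvec.span (basis_union S \<phi> Bf)"
    using zspan_subset_cspan [of "Bf \<alpha>"] cvec.span_mono [of "Bf \<alpha>" "basis_union S \<phi> Bf"] \<alpha>
    by (auto simp: Bf_span basis_union_def)
  then have "cvec.span (g_int S \<phi> \<alpha>) \<subseteq> cvec.span (basis_union S \<phi> Bf)"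
    by (intro cvec.span_minimal cvec.subspace_span)
  then show ?thesis using root_space_span [of \<alpha> x] assms by (auto simp: root_space_def)
qed (simp add: cvec.span_zero)

lemma basis_union_span: "cvec.span (basis_union S \<phi> Bf) = UNIV"
proof -
  have "x \<in> cvec.span (basis_union S \<phi> Bf)" for x
  proof -
    obtain D where "x = (\<Sum>\<delta>\<in>D. gcomp \<delta> x)" by (rule gcomp_decomposition)
    then show ?thesis using gcomp_in_span [OF gcomp_root_space] cvec.span_sum by metis
  qed
  then show ?thesis by blast
qed

sublocale divided_basis "basis_union S \<phi> Bf" r p
  by unfold_locales (fact basis_union_independent basis_union_span basis_order p_leading)+

text \<open>The homogeneous components of an integral element are integral by
  \<open>U_int_gcomp\<close>, so each lies in the span of the given basis of its degree.\<close>

lemma integral_element: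
  assumes "\<iota> x \<in> U_int S \<phi>"
  shows "x \<in> zmod.span (basis_union S \<phi> Bf)"
proof -
  obtain D where D: "x = (\<Sum>\<delta>\<in>D. gcomp \<delta> x)" by (rule gcomp_decomposition)
  have "gcomp \<delta> x \<in> zmod.span (basis_union S \<phi> Bf)" for \<delta>
  proof (cases "gcomp \<delta> x = 0")
    case False
    then have \<delta>: "\<delta> \<in> roots S \<phi> \<union> {0}" using gcomp_root_space [of \<delta> x] by (auto simp: roots_def)
    have "gcomp \<delta> x \<in> zmod.span (Bf \<delta>)" unfolding Bf_span [OF \<delta>] by (rule U_int_gcomp [OF assms])
    then show ?thesis
      using zmod.span_mono [of "Bf \<delta>" "basis_union S \<phi> Bf"] \<delta> by (auto simp: basis_union_def)
  qed (simp add: zmod.span_zero)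
  then have "(\<Sum>\<delta>\<in>D. gcomp \<delta> x) \<in> zmod.span (basis_union S \<phi> Bf)" by (intro zmod.span_sum)
  then show ?thesis by (simp only: D [symmetric])
qed

lemma basis_union_U_int: "x \<in> basis_union S \<phi> Bf \<Longrightarrow> \<iota> x \<in> U_int S \<phi>"
  using Bf_g_int by (auto simp: basis_union_def g_int_def)

text \<open>Let k z = m + \<iota> s. The counit shows that k divides m, so y = s / k satisfies
  \<iota> y = z - c with an integer c, and y is integral. Hence its coordinates are integers, and
  those outside B0 vanish because those of s do.\<close>

lemma pure_generators:
  assumes "B0 \<subseteq> basis_union S \<phi> Bf"
  shows "pure_in (insert 1 (\<iota> ` B0)) (U_int S \<phi>)"
  unfolding pure_in_def
proof (intro allI impI)
  fix k :: int and z
  assume k: "k \<noteq> 0" and z: "z \<in> U_int S \<phi>" and kz: "zscale k z \<in> zmod.span (insert 1 (\<iota> ` B0))"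
  then obtain m where "zscale k z - zscale m 1 \<in> zmod.span (\<iota> ` B0)"
    unfolding zmod.span_insert by blast
  then obtain s where s: "s \<in> zmod.span B0" "zscale k z - zscale m 1 = \<iota> s" using zspan_\<iota> by blast
  obtain c where c: "counit z = of_int c" using counit_U_int [OF z] by (rule Ints_cases)
  have "counit (zscale k z - zscale m 1) = 0" by (simp add: s(2))
  then have m: "of_int m = (of_int k * of_int c :: complex)"
    by (simp add: clinear_diff [OF clinear_counit] zscale_eq_scaleC c)
  define y where "y = (1 / of_int k) *\<^sub>C s"
  have ky: "of_int k *\<^sub>C y = s" using k by (simp add: y_def scaleC_scaleC scaleC_one)
  have "\<iota> y = (1 / of_int k) *\<^sub>C (zscale k z - zscale m 1)"
    by (simp add: y_def \<iota>_scaleC s(2))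
  also have "\<dots> = z - zscale c 1"
    using k by (simp add: zscale_eq_scaleC m cvec.scale_right_diff_distrib scaleC_scaleC scaleC_one)
  finally have \<iota>y: "\<iota> y = z - zscale c 1" .
  then have "\<iota> y \<in> U_int S \<phi>"
    using z by (simp add: is_subringD [OF U_int_subring] subring_zscale [OF U_int_subring])
  then have y: "y \<in> zmod.span (basis_union S \<phi> Bf)" by (rule integral_element)
  let ?R = "cvec.representation (basis_union S \<phi> Bf)"
  have lin: "clinear (\<lambda>x. ?R x b)" for b
    using cvec.representation_add [OF basis_union_independent] cvec.representation_scale [OF basis_union_independent]
    by (simp add: clinear_def basis_union_span scaleC_complex_def)
  have R_basis: "?R x b = (if b = x then 1 else 0)" if "x \<in> basis_union S \<phi> Bf" for x b
    using cvec.representation_basis [OF basis_union_independent that] by auto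
  have int: "?R y b \<in> \<int>" for b
    by (rule clinear_zspan_Ints [OF lin _ y]) (simp add: R_basis)
  have "?R y b = 0" if "b \<notin> B0" for b
  proof -
    have "?R s b = 0"
      using s(1) by (rule clinear_eq_on_span [OF lin, of "\<lambda>_. 0" B0, rotated 2, OF subsetD [OF zspan_subset_cspan]])
        (use assms that in \<open>auto simp: R_basis clinear_def\<close>)
    then show ?thesis using k by (simp add: ky [symmetric] clinear_scale [OF lin] scaleC_complex_def)
  qed
  then have sub: "{b. ?R y b \<noteq> 0} \<subseteq> B0" by blast
  have "y = (\<Sum>b | ?R y b \<noteq> 0. ?R y b *\<^sub>C b)"
    using cvec.sum_nonzero_representation_eq [OF basis_union_independent, of y] basis_union_span by simp
  also have "\<dots> \<in> zmod.span B0"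
  proof (rule zmod.span_sum)
    fix b assume b: "b \<in> {b. ?R y b \<noteq> 0}"
    obtain j where "?R y b = of_int j" using int [of b] by (rule Ints_cases)
    then have "?R y b *\<^sub>C b = zscale j b" by (simp add: zscale_eq_scaleC)
    then show "?R y b *\<^sub>C b \<in> zmod.span B0" using b sub by (auto intro: zmod.span_scale zmod.span_base)
  qed
  finally have "y \<in> zmod.span B0" .
  then have "\<iota> y \<in> zmod.span (insert 1 (\<iota> ` B0))"
  proof (induction rule: zmod.span_induct_alt)
    case base
    then show ?case by (simp add: clinear_0 [OF clinear_\<iota>] zmod.span_zero)
  next
    case (step c x y)
    have "\<iota> (zscale c x + y) = zscale c (\<iota> x) + \<iota> y" by (simp add: zscale_eq_scaleC \<iota>_add \<iota>_scaleC)
    then show ?case using step by (auto intro!: zmod.span_add zmod.span_scale intro: zmod.span_base)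
  qed
  then have "\<iota> y + zscale c 1 \<in> zmod.span (insert 1 (\<iota> ` B0))"
    by (intro zmod.span_add zmod.span_scale) (auto intro: zmod.span_base)
  then show "z \<in> zmod.span (insert 1 (\<iota> ` B0))" by (simp add: \<iota>y)
qed

text \<open>The counit separates 1 from the Lie algebra, on which it vanishes.\<close>

lemma independent_generators:
  assumes "B0 \<subseteq> basis_union S \<phi> Bf"
  shows "cvec.independent (insert 1 (\<iota> ` B0))"
proof (rule cvec.independent_insertI)
  have "counit u = 0" if "u \<in> cvec.span (\<iota> ` B0)" for u
    by (rule clinear_eq_on_span [OF clinear_counit, of "\<lambda>_. 0", OF _ _ that]) (auto simp: clinear_def)
  then show "1 \<notin> cvec.span (\<iota> ` B0)" by force
  have "cvec.independent B0" using basis_union_independent assms cvec.independent_mono by blast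
  moreover have "Vector_Spaces.linear (*\<^sub>C) (*\<^sub>C) (\<iota> :: 'g \<Rightarrow> 'g uea)"
    by (simp add: Vector_Spaces.linear_iff \<iota>_add \<iota>_scaleC cvec.vector_space_axioms)
  ultimately show "cvec.independent (\<iota> ` B0)"
    by (intro cvec_pair.linear_independent_injective_image) (auto intro: inj_on_subset [OF inj_\<iota>])
qed

text \<open>By purity, 1 and the \<iota> y extend to an integrally independent subset of
  \<open>U_int S \<phi>\<close> whose span contains F. It is independent over the complex numbers
  too, so values on it can be prescribed: 1 at \<iota> x and 0 at every other member.\<close>

lemma integral_functional:
  assumes "finite B0" "B0 \<subseteq> basis_union S \<phi> Bf" "finite F" "F \<subseteq> U_int S \<phi>"
  obtains \<psi> where "clinear \<psi>" "\<psi> 1 = 0" "\<And>y. y \<in> B0 \<Longrightarrow> \<psi> (\<iota> y) = (if y = x then 1 else 0)"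
    "\<And>u. u \<in> F \<Longrightarrow> \<psi> u \<in> (\<int> :: complex set)"
proof -
  let ?P = "insert 1 (\<iota> ` B0)"
  have "zmod.subspace (U_int S \<phi>)"
    by (auto simp: zmod.subspace_def is_subringD [OF U_int_subring] subring_zscale [OF U_int_subring])
  moreover have "?P \<subseteq> U_int S \<phi>"
    using basis_union_U_int assms(2) by (auto simp: is_subringD [OF U_int_subring])
  ultimately obtain P' where P': "?P \<subseteq> P'" "P' \<subseteq> U_int S \<phi>" "zmod.independent P'" "F \<subseteq> zmod.span P'"
    using extend_pure_basis [OF _ pure_generators [OF assms(2)] cindependent_imp_zindependent
        [OF independent_generators [OF assms(2)]] _ assms(3,4)] by metis
  obtain \<psi> where \<psi>: "clinear \<psi>" "\<And>u. u \<in> P' \<Longrightarrow> \<psi> u = (if u = \<iota> x then 1 else 0 :: complex)"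
    using clinear_functional_exists [OF U_int_independent [OF P'(3,2)], of "\<lambda>u. if u = \<iota> x then 1 else 0 :: complex"]
    by blast
  show ?thesis
  proof (rule that [OF \<psi>(1)])
    have "1 \<noteq> \<iota> x" using counit_simps(4,5) by (metis zero_neq_one)
    then show "\<psi> 1 = 0" using \<psi>(2) [of 1] P'(1) by simp
    show "\<psi> (\<iota> y) = (if y = x then 1 else 0)" if "y \<in> B0" for y
      using \<psi>(2) [of "\<iota> y"] P'(1) that inj_eq [OF inj_\<iota>, of y x] by auto
    show "\<psi> u \<in> \<int>" if "u \<in> F" for u
      by (rule clinear_zspan_Ints [OF \<psi>(1), of P']) (use \<psi>(2) P'(4) that in auto)
  qed
qed

lemma ordered_remove1: "ordered T \<Longrightarrow> ordered (remove1 x T)"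
  by (induction T) (auto simp: ordered_Cons dest: notin_set_remove1 [rotated])

lemma contract_U_int:
  assumes "clinear \<psi>" "coproduct.represents u l" "set l \<subseteq> U_int S \<phi> \<times> U_int S \<phi>"
    "\<And>a b. (a, b) \<in> set l \<Longrightarrow> \<psi> b \<in> \<int>"
  shows "contract \<psi> u \<in> U_int S \<phi>"
  unfolding contract_eq [OF assms(1,2)]
  using assms(3,4)
proof (induction l)
  case Nil
  show ?case by (simp add: is_subringD [OF U_int_subring])
next
  case (Cons a l)
  obtain k where k: "\<psi> (snd a) = of_int k" using Cons.prems(2) [of "fst a" "snd a"] by (auto elim: Ints_cases)
  have "zscale k (fst a) \<in> U_int S \<phi>"
    using Cons.prems(1) by (intro subring_zscale [OF U_int_subring]) (auto simp: mem_Times_iff)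
  moreover have "tsum (\<lambda>a b. \<psi> b *\<^sub>C a) l \<in> U_int S \<phi>" using Cons by auto
  ultimately show ?case
    by (simp add: tsum_Cons k zscale_eq_scaleC [symmetric] is_subringD [OF U_int_subring])
qed

lemma monomial_U_int: "N \<in> exponents \<Longrightarrow> monomial r p N \<in> U_int S \<phi>"
proof -
  assume "N \<in> exponents"
  then have "set (ordered_list r (Poly_Mapping.keys N)) \<subseteq> basis_union S \<phi> Bf" by (simp add: ordered_list)
  moreover have "prod_list (map (\<lambda>x. p x (k x)) xs) \<in> U_int S \<phi>" if "set xs \<subseteq> basis_union S \<phi> Bf" for xs k
    using that by (induction xs) (simp_all add: is_subringD [OF U_int_subring] p_int)
  ultimately show ?thesis by (simp add: monomial_def)
qed

text \<open>Contracting with a functional dual to \<open>x\<close> lowers the degree and turns the coefficient of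
  \<open>[N]\<close> into that of \<open>[N']\<close>, where \<open>N'\<close> is \<open>N\<close> with the exponent of \<open>x\<close> lowered by one.\<close>

lemma contract_monomial_coefficient:
  assumes N: "N \<in> exponents" "M \<in> exponents" "total_degree M = total_degree N" "x \<in> Poly_Mapping.keys N"
    and N': "N' \<in> exponents" "monomial_word r N' = remove1 x (monomial_word r N)"
    and \<psi>: "clinear \<psi>" "\<psi> 1 = 0" "\<And>y. y \<in> Poly_Mapping.keys M \<Longrightarrow> \<psi> (\<iota> y) = (if y = x then 1 else 0)"
  shows "fact_prod N' * Poly_Mapping.lookup (symbol (contract \<psi> (monomial r p M))) (monomial_word r N') =
    (if M = N then 1 else 0)"
proof -
  let ?l = "\<lambda>u. Poly_Mapping.lookup (symbol u) (monomial_word r N')"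
  have lin: "clinear ?l"
    by (simp add: clinear_def clinear_add [OF clinear_symbol] clinear_scale [OF clinear_symbol]
        lookup_add lookup_scaleC)
  have word: "set (monomial_word r K) = Poly_Mapping.keys K" "ordered (monomial_word r K)"
    "length (monomial_word r K) = total_degree K" if "K \<in> exponents" for K
  proof -
    show "set (monomial_word r K) = Poly_Mapping.keys K"
      using count_monomial_word [OF that] by (auto simp: in_keys_iff count_greater_zero_iff [symmetric] simp del: count_greater_zero_iff simp flip: set_mset_mset)
    show "ordered (monomial_word r K)" "length (monomial_word r K) = total_degree K"
      using that ordered_monomial_word length_monomial_word by blast+
  qed
  have len: "length (monomial_word r N') = total_degree N - 1"
    using word(1) [OF N(1)] word(3) [OF N(1)] N(4) by (simp add: N'(2) length_remove1)
  have low: "?l u = 0" if "u \<in> filtration_less (total_degree N - 1)" for u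
    using symbol_filtration [OF that] len by simp
  \<comment> \<open>After contraction the lower terms of [M] fall below the degree of N' and do not
    reach its word.\<close>
  let ?m = "monomial r p M - (1 / fact_prod M) *\<^sub>C iprod (monomial_word r M)"
  have "?m \<in> filtration_less (total_degree N)" using monomial_leading(1) [OF N(2)] N(3) by simp
  moreover have "total_degree N = Suc (total_degree N - 1)"
    using word(1,3) [OF N(1)] N(4) by (cases "monomial_word r N") auto
  ultimately have "contract \<psi> ?m \<in> filtration_less (total_degree N - 1)"
    using contract_lower [OF \<psi>(1,2), of ?m "total_degree N - 1"] by simp
  from low [OF this]
  have "?l (contract \<psi> (monomial r p M)) = (1 / fact_prod M) * ?l (contract \<psi> (iprod (monomial_word r M)))"
    by (simp add: clinear_diff [OF clinear_contract [OF \<psi>(1)]] clinear_scale [OF clinear_contract [OF \<psi>(1)]]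
        clinear_diff [OF lin] clinear_scale [OF lin] scaleC_complex_def)
  also have "?l (contract \<psi> (iprod (monomial_word r M))) =
      of_nat (Poly_Mapping.lookup M x) * ?l (iprod (remove1 x (monomial_word r M)))"
  proof -
    have "contract \<psi> (iprod (monomial_word r M)) - of_nat (count (mset (monomial_word r M)) x) *\<^sub>C
        iprod (remove1 x (monomial_word r M)) \<in> filtration_less (total_degree N - 1)"
      using contract_iprod [OF \<psi>(1,2), of "monomial_word r M" x] \<psi>(3) word [OF N(2)] N(3) by simp
    from low [OF this] show ?thesis
      by (simp add: clinear_diff [OF lin] clinear_scale [OF lin] scaleC_complex_def count_monomial_word [OF N(2)])
  qed
  finally have *: "?l (contract \<psi> (monomial r p M)) =
      (1 / fact_prod M) * (of_nat (Poly_Mapping.lookup M x) * ?l (iprod (remove1 x (monomial_word r M))))" .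
  show ?thesis
  proof (cases "x \<in> Poly_Mapping.keys M")
    case False
    then have "Poly_Mapping.lookup M x = 0" "M \<noteq> N" using N(4) by (auto simp: in_keys_iff)
    then show ?thesis using * by simp
  next
    case True
    have "ordered (remove1 x (monomial_word r M))"
      by (rule ordered_remove1 [OF word(2) [OF N(2)]])
    then have l: "?l (iprod (remove1 x (monomial_word r M))) =
        (if remove1 x (monomial_word r M) = remove1 x (monomial_word r N) then 1 else 0)"
      by (simp add: symbol_ordered N'(2) lookup_single when_def)
    show ?thesis
    proof (cases "M = N")
      case True
      have "Poly_Mapping.lookup N' y = (if y = x then Poly_Mapping.lookup N y - 1 else Poly_Mapping.lookup N y)" for y
        using count_monomial_word [OF N'(1), of y] count_monomial_word [OF N(1), of y]
        unfolding N'(2) by auto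
      then have N'_lookup: "Poly_Mapping.lookup N' x = Poly_Mapping.lookup N x - 1"
        "y \<noteq> x \<Longrightarrow> Poly_Mapping.lookup N' y = Poly_Mapping.lookup N y" for y by simp_all
      have keys: "Poly_Mapping.keys N' \<subseteq> Poly_Mapping.keys N"
        using N'_lookup N(4) by (metis in_keys_iff subsetI)
      have "fact_prod N' = (\<Prod>y\<in>Poly_Mapping.keys N. fact (Poly_Mapping.lookup N' y))"
        unfolding fact_prod_def by (rule prod.mono_neutral_left) (use keys in \<open>auto simp: in_keys_iff\<close>)
      also have "\<dots> = fact (Poly_Mapping.lookup N x - 1) * (\<Prod>y\<in>Poly_Mapping.keys N - {x}. fact (Poly_Mapping.lookup N y))"
        using N(4) by (subst prod.remove [of _ x]) (simp_all add: N'_lookup)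
      \<comment> \<open>The multiplicity of x, which the contraction produces, is the factor by
        which \<open>fact_prod N\<close> exceeds \<open>fact_prod N'\<close>.\<close>
      finally have "of_nat (Poly_Mapping.lookup N x) * fact_prod N' =
          fact (Poly_Mapping.lookup N x) * (\<Prod>y\<in>Poly_Mapping.keys N - {x}. fact (Poly_Mapping.lookup N y))"
        using N(4) fact_reduce [of "Poly_Mapping.lookup N x", where 'a = complex] by (simp add: in_keys_iff)
      also have "\<dots> = fact_prod N"
        unfolding fact_prod_def using N(4) by (subst (2) prod.remove [of _ x]) simp_all
      finally show ?thesis using * l True by (simp add: mult_ac)
    next
      case False
      \<comment> \<open>Both words contain x, so they have the same multiset of letters as soon as
        they do so after losing one x.\<close>
      have "remove1 x (monomial_word r M) \<noteq> remove1 x (monomial_word r N)"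
      proof
        assume "remove1 x (monomial_word r M) = remove1 x (monomial_word r N)"
        then have "mset (monomial_word r M) - {#x#} = mset (monomial_word r N) - {#x#}" by (metis mset_remove1)
        moreover have "x \<in># mset (monomial_word r M)" "x \<in># mset (monomial_word r N)"
          using True N(4) word(1) [OF N(1)] word(1) [OF N(2)] by simp_all
        ultimately have "mset (monomial_word r M) = mset (monomial_word r N)" by (metis insert_DiffM)
        then show False
          using False monomial_word_inject [OF N(2,1)] ordered_unique word(2) N by blast
      qed
      then show ?thesis using * l False by simp
    qed
  qed
qed

lemma monomial_0: "monomial r p 0 = 1"
  using ordered_list(2) [of "{}"] by (simp add: monomial_def)

lemma U_int_filtration:
  "u \<in> U_int S \<phi> \<Longrightarrow> u \<in> filtration_less n \<Longrightarrow>
    u \<in> zmod.span (monomial r p ` {N \<in> exponents. total_degree N < n})"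
proof (induction n arbitrary: u)
  case 0
  then show ?case by (simp add: zmod.span_zero)
next
  case (Suc n)
  obtain A c where A: "finite A" "A \<subseteq> exponents" "\<And>N. N \<in> A \<Longrightarrow> total_degree N = n"
    and low: "u - (\<Sum>N\<in>A. c N *\<^sub>C monomial r p N) \<in> filtration_less n"
    using filtration_monomials [OF Suc.prems(2)] by blast
  define v where "v = u - (\<Sum>N\<in>A. c N *\<^sub>C monomial r p N)"
  have u: "u = (\<Sum>N\<in>A. c N *\<^sub>C monomial r p N) + v" by (simp add: v_def)
  have "c N \<in> \<int>" if "N \<in> A" for N
  proof (cases n)
    \<comment> \<open>In degree zero u is a multiple of 1, and the counit returns its
      coefficient.\<close>
    case 0
    have "K = 0" if "K \<in> A" for K
    proof -
      have "length (monomial_word r K) = 0" using length_monomial_word [of K] A(2,3) that 0 by auto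
      then have "Poly_Mapping.lookup K x = 0" for x
        using count_monomial_word [of K x] A(2) that by auto
      then show ?thesis by (intro poly_mapping_eqI) simp
    qed
    then have "A = {0}" "N = 0" using that by auto
    moreover have "v = 0" using low 0 by (simp add: v_def)
    ultimately have "u = c N *\<^sub>C 1" using u by (simp add: monomial_0)
    then show ?thesis using counit_U_int [OF Suc.prems(1)] by simp
  next
    case (Suc k)
    have N: "N \<in> exponents" using A(2) that by blast
    have "Poly_Mapping.keys N \<noteq> {}"
      using A(3) [OF that] Suc by (auto simp: total_degree_def)
    then obtain x where x: "x \<in> Poly_Mapping.keys N" by blast
    obtain l where l: "coproduct.represents u l" "set l \<subseteq> U_int S \<phi> \<times> U_int S \<phi>"
      using \<open>u \<in> U_int S \<phi>\<close> by (rule U_int_coproduct)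
    \<comment> \<open>The functional has to be dual to x on all letters of the top-degree monomials
      at once, and integral on the right factors of the chosen expression for the coproduct.\<close>
    let ?B0 = "\<Union>M\<in>A. Poly_Mapping.keys M"
    obtain \<psi> :: "'g uea \<Rightarrow> complex" where \<psi>: "clinear \<psi>" "\<psi> 1 = 0" "\<And>y. y \<in> ?B0 \<Longrightarrow> \<psi> (\<iota> y) = (if y = x then 1 else 0)"
      "\<And>w. w \<in> snd ` set l \<Longrightarrow> \<psi> w \<in> \<int>"
    proof -
      have "finite ?B0" using A(1) by simp
      moreover have "?B0 \<subseteq> basis_union S \<phi> Bf" using A(2) by auto
      moreover have "finite (snd ` set l)" by simp
      moreover have "snd ` set l \<subseteq> U_int S \<phi>" using l(2) by auto
      ultimately show thesis by (rule integral_functional [where x = x]) (fact that)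
    qed
    have "contract \<psi> u \<in> U_int S \<phi>"
      by (rule contract_U_int [OF \<psi>(1) l]) (use \<psi>(4) in force)
    moreover have "contract \<psi> u \<in> filtration_less n"
      using contract_lower [OF \<psi>(1,2) \<open>u \<in> filtration_less (Suc n)\<close>] .
    ultimately have span: "contract \<psi> u \<in> zmod.span (monomial r p ` {N \<in> exponents. total_degree N < n})"
      by (rule Suc.IH)
    have "ordered (remove1 x (monomial_word r N))"
      by (rule ordered_remove1 [OF ordered_monomial_word [OF N]])
    then obtain N' where N': "N' \<in> exponents" "monomial_word r N' = remove1 x (monomial_word r N)"
      by (rule monomial_word_surj)
    have "x \<in> set (monomial_word r N)"
      using count_monomial_word [OF N, of x] x by (metis count_mset_0_iff in_keys_iff)
    then have deg: "total_degree N' = k"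
      using length_monomial_word [OF N'(1)] length_monomial_word [OF N] A(3) [OF that] Suc
      by (simp add: N'(2) length_remove1)
    \<comment> \<open>On combinations of monomials of degree at most that of N', the factor
      \<open>fact_prod N'\<close> turns the coordinate at the word of N' into the coefficient of
      [N'].\<close>
    let ?l = "\<lambda>u. fact_prod N' * Poly_Mapping.lookup (symbol u) (monomial_word r N')"
    have lin: "clinear ?l"
      by (simp add: clinear_def clinear_add [OF clinear_symbol] clinear_scale [OF clinear_symbol]
          lookup_add lookup_scaleC scaleC_complex_def algebra_simps)
    have "?l (contract \<psi> u) \<in> \<int>"
    proof (rule clinear_zspan_Ints [OF lin _ span])
      fix w assume "w \<in> monomial r p ` {N \<in> exponents. total_degree N < n}"
      then obtain M where "w = monomial r p M" "M \<in> exponents" "total_degree M \<le> total_degree N'"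
        using deg Suc by auto
      then show "?l w \<in> \<int>" using symbol_monomial [OF N'(1), of M] by simp
    qed
    moreover have "?l (contract \<psi> u) = c N"
    proof -
      \<comment> \<open>The remainder v has degree less than n = k + 1, so its contraction has
        degree less than k, the degree of N'.\<close>
      have "contract \<psi> v \<in> filtration_less k"
        using contract_lower [OF \<psi>(1,2), of v k] low Suc by (simp add: v_def)
      then have "?l (contract \<psi> v) = 0"
        using symbol_filtration [of "contract \<psi> v" k "monomial_word r N'"] length_monomial_word [OF N'(1)] deg by simp
      then have "?l (contract \<psi> u) = (\<Sum>M\<in>A. c M * ?l (contract \<psi> (monomial r p M)))"
        unfolding u by (simp only: clinear_add [OF clinear_contract [OF \<psi>(1)]] clinear_sum [OF clinear_contract [OF \<psi>(1)]]
            clinear_scale [OF clinear_contract [OF \<psi>(1)]] clinear_add [OF lin] clinear_sum [OF lin]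
            clinear_scale [OF lin] scaleC_complex_def add_0_right)
      also have "\<dots> = (\<Sum>M\<in>A. if M = N then c N else 0)"
      proof (rule sum.cong [OF HOL.refl])
        fix M assume M: "M \<in> A"
        have "\<psi> (\<iota> y) = (if y = x then 1 else 0)" if "y \<in> Poly_Mapping.keys M" for y
          using M that by (intro \<psi>(3)) blast
        moreover have "M \<in> exponents" "total_degree M = total_degree N"
          using A(2,3) M \<open>N \<in> A\<close> by auto
        ultimately have "?l (contract \<psi> (monomial r p M)) = (if M = N then 1 else 0)"
          by (intro contract_monomial_coefficient [OF N _ _ x N' \<psi>(1,2)])
        then show "c M * ?l (contract \<psi> (monomial r p M)) = (if M = N then c N else 0)" by simp
      qed
      also have "\<dots> = c N" using A(1) that by simp
      finally show ?thesis .
    qed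
    ultimately show ?thesis by simp
  qed
  then have "\<forall>N\<in>A. \<exists>k. c N = of_int k" by (auto elim!: Ints_cases)
  then obtain k where k: "\<And>N. N \<in> A \<Longrightarrow> c N = of_int (k N)" by metis
  have top: "(\<Sum>N\<in>A. c N *\<^sub>C monomial r p N) = (\<Sum>N\<in>A. zscale (k N) (monomial r p N))"
    by (intro sum.cong HOL.refl) (simp add: k zscale_eq_scaleC)
  have top_span: "(\<Sum>N\<in>A. c N *\<^sub>C monomial r p N) \<in>
      zmod.span (monomial r p ` {N \<in> exponents. total_degree N < Suc n})"
    unfolding top by (intro zmod.span_sum zmod.span_scale zmod.span_base imageI) (use A in auto)
  have "monomial r p ` {N \<in> exponents. total_degree N < Suc n} \<subseteq> U_int S \<phi>"
    using monomial_U_int by blast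
  then have "(\<Sum>N\<in>A. c N *\<^sub>C monomial r p N) \<in> U_int S \<phi>"
    using subring_zspan [OF U_int_subring] top_span by blast
  \<comment> \<open>With integral coefficients the top part lies in the integral form, so the
    remainder does too, and the induction hypothesis is used a second time.\<close>
  then have "v \<in> U_int S \<phi>" unfolding v_def by (intro is_subringD(3) [OF U_int_subring] Suc.prems(1))
  then have "v \<in> zmod.span (monomial r p ` {N \<in> exponents. total_degree N < n})"
    using low by (intro Suc.IH) (simp_all add: v_def)
  then have "v \<in> zmod.span (monomial r p ` {N \<in> exponents. total_degree N < Suc n})"
    by (rule subsetD [OF zmod.span_mono, rotated]) auto
  then show ?case unfolding u using top_span by (intro zmod.span_add)
qed

text \<open>Equal monomials with different exponents would give a relation with coefficients 1 and
  -1.\<close>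

lemma monomial_inj: "inj_on (monomial r p) exponents"
proof (rule inj_onI, rule ccontr)
  fix M N assume MN: "M \<in> exponents" "N \<in> exponents" "monomial r p M = monomial r p N" "M \<noteq> N"
  have "(\<Sum>K\<in>{M, N}. (if K = M then 1 else -1) *\<^sub>C monomial r p K) = 0"
    using MN(3,4) by (simp add: scaleC_one)
  from monomial_independent [OF _ _ this, of M] MN(1,2) show False by simp
qed

lemma monomial_zindependent: "zmod.independent (monomial r p ` exponents)"
  unfolding zmod.independent_explicit_module
proof (intro allI impI)
  fix t u v assume t: "finite t" "t \<subseteq> monomial r p ` exponents" "(\<Sum>v\<in>t. zscale (u v) v) = 0" "v \<in> t"
  then obtain A where A: "A \<subseteq> exponents" "inj_on (monomial r p) A" "t = monomial r p ` A"
    by (auto simp: subset_image_inj)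
  obtain N where N: "N \<in> A" "v = monomial r p N" using t(4) A(3) by blast
  have "finite A" using A t(1) finite_imageD by blast
  moreover have "(\<Sum>N\<in>A. of_int (u (monomial r p N)) *\<^sub>C monomial r p N) = 0"
    using t(3) by (simp add: A(3) sum.reindex [OF A(2)] zscale_eq_scaleC)
  ultimately have "of_int (u (monomial r p N)) = (0 :: complex)"
    using monomial_independent [of A "\<lambda>N. of_int (u (monomial r p N))" N] A(1) N(1) by blast
  then show "u v = 0" by (simp add: N(2))
qed

lemma monomial_basis: "is_Z_basis (monomial r p ` exponents) (U_int S \<phi>)"
proof -
  have "zmod.span (monomial r p ` exponents) \<subseteq> U_int S \<phi>"
    using subring_zspan [OF U_int_subring] monomial_U_int by blast
  moreover have "u \<in> zmod.span (monomial r p ` exponents)" if "u \<in> U_int S \<phi>" for u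
  proof -
    obtain n where "u \<in> filtration_less n" using filtration_exhaust by blast
    from U_int_filtration [OF that this] show ?thesis
      by (rule subsetD [OF zmod.span_mono, rotated]) auto
  qed
  ultimately show ?thesis using monomial_zindependent by (auto simp: is_Z_basis_def)
qed

end

text \<open>Injectivity is part of the claim so that the family of the [N], and not only the set of
  its values, is a basis.\<close>

theorem mainTheorem3:
  fixes S :: "('i, 'y::ab_group_add) SGR"
    and \<phi> :: "('i, 'y) km_gen \<Rightarrow> 'g::complex_lie_algebra"
    and B :: "('i \<Rightarrow>\<^sub>0 int) \<Rightarrow> 'g set"
    and r :: "'g rel"
    and p :: "'g \<Rightarrow> nat \<Rightarrow> 'g uea"
  assumes SGR: "is_SGR S"
    and g: "is_kac_moody_algebra S \<phi>"
    and basis: "\<And>\<alpha>. \<alpha> \<in> roots S \<phi> \<union> {0} \<Longrightarrow> is_Z_basis (B \<alpha>) (g_int S \<phi> \<alpha>)"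
    and simple: "\<And>i. i \<in> idx S \<Longrightarrow>
      B (simple_root i) = {\<phi> (GenE i)} \<and> B (- simple_root i) = {\<phi> (GenF i)}"
    and real: "\<And>\<alpha> c. real_root S \<alpha> c \<Longrightarrow>
      \<exists>e f. B \<alpha> = {e} \<and> B (- \<alpha>) = {f} \<and> lie_br e f = - \<phi> (GenH c)"
    and order: "linear_order_on (basis_union S \<phi> B) r"
    and p_deg: "\<And>\<alpha> x n. \<alpha> \<in> roots S \<phi> \<union> {0} \<Longrightarrow> x \<in> B \<alpha> \<Longrightarrow> p x n \<in> U_int_deg S \<phi> (zscale (int n) \<alpha>)"
    and p_0: "\<And>x. x \<in> basis_union S \<phi> B \<Longrightarrow> p x 0 = 1"
    and p_1: "\<And>x. x \<in> basis_union S \<phi> B \<Longrightarrow> p x 1 = \<iota> x"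
    and p_n: "\<And>x n. x \<in> basis_union S \<phi> B \<Longrightarrow> p x n - divided_power (\<iota> x) n \<in> filtration_less n"
  shows "inj_on (monomial r p) {N. Poly_Mapping.keys N \<subseteq> basis_union S \<phi> B} \<and>
    is_Z_basis (monomial r p ` {N. Poly_Mapping.keys N \<subseteq> basis_union S \<phi> B}) (U_int S \<phi>)"
proof -
  have p_int: "p x n \<in> U_int S \<phi>" if "x \<in> basis_union S \<phi> B" for x n
    using that p_deg by (auto simp: basis_union_def U_int_deg_def)
  interpret km_basis S \<phi> B r p
    by unfold_locales (use g basis order p_int p_n in auto)
  show ?thesis using monomial_inj monomial_basis by blast
qed

end
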